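(* Let $1\le t\le n$ be integers, $K$ a field, $S=K[x_1,\ldots,x_n]$, and let $I=I_t(P_n)\subset S$ be the $t$-path ideal of the path $P_n$ on vertices $x_1,\ldots,x_n$. If $I$ has a linear resolution (equivalently, $I$ has linear powers), then $\mathrm v(I^k)=\alpha(I)k-1$ for all $k\geq1$.
   Context: $S=\bigoplus_{d\ge 0}S_d$ is graded with $\deg x_i=1$. $P_n$ is the path graph with edges $\{x_i,x_{i+1}\}$, $1\le i<n$. For a graph $G$ with vertices identified with variables, the $t$-path ideal is $I_t(G)=\langle x_{i_1}\cdots x_{i_t}\mid \{x_{i_1},\ldots,x_{i_t}\}\text{ is the vertex set of a path on } t \text{ vertices in } G\rangle$; thus $I_t(P_n)=\langle x_1x_2\cdots x_t,\ x_2\cdots x_{t+1},\ \ldots,\ x_{n-t+1}\cdots x_n\rangle$. For a nonzero graded ideal $I$, $\alpha(I):=\min\{\deg(f)\mid f\in I\setminus\{0\}\}$ (over homogeneous $f$). An equigenerated graded ideal $I$ (generated by homogeneous elements of a single degree) has a linear resolution if its Castelnuovo–Mumford regularity satisfies $\operatorname{reg}(I)=\alpha(I)$; $I$ has linear powers if $I^k$ has a linear resolution for all $k\ge 1$. For a proper graded ideal $I$, $\mathrm{v}(I):=\min\{d\geq 0\mid \exists f\in S_d,\ \mathfrak{p}\in\operatorname{Ass}(I)\text{ with }(I:f)=\mathfrak{p}\}$, where $\operatorname{Ass}(I)$ is the set of associated primes of $S/I$ and $(I:f)=\{g\in S\mid gf\in I\}$. *)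

theory Defs
  imports
    "HOL-Library.Poly_Mapping"
    "HOL-Library.Extended_Real"
    "HOL-Library.Extended_Nat"
    "Jordan_Normal_Form.Matrix_Kernel"
begin

text \<open>
  The polynomial ring over the field \<open>'k\<close> whose variables are the elements of the finite type
  \<open>'n\<close>, as finitely supported functions from exponent vectors to coefficients.
\<close>

type_synonym ('n, 'k) mpoly = "('n \<Rightarrow>\<^sub>0 nat) \<Rightarrow>\<^sub>0 'k"

definition Var :: "'n \<Rightarrow> ('n, 'k::field) mpoly" where
  "Var a = Poly_Mapping.single (Poly_Mapping.single a 1) 1"

definition mdeg :: "('n::finite \<Rightarrow>\<^sub>0 nat) \<Rightarrow> nat" where
  "mdeg m = (\<Sum>a\<in>UNIV. Poly_Mapping.lookup m a)"

text \<open>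
  The graded component of degree \<open>j\<close>. The degree is an integer, so that a component of negative
  degree is zero; every component contains 0.
\<close>

definition graded_part :: "int \<Rightarrow> ('n::finite, 'k::field) mpoly set" where
  "graded_part j = {f. \<forall>m\<in>Poly_Mapping.keys f. int (mdeg m) = j}"


section \<open>Ideals\<close>

text \<open>
  Ideals are the submodules of the ring as a module over itself. The qualifier selects the locale
  from HOL's theory Modules, which HOL-Algebra's locale of the same name hides.
\<close>

abbreviation is_ideal :: "'a::comm_ring_1 set \<Rightarrow> bool" where
  "is_ideal \<equiv> Modules.module.subspace (*)"

abbreviation ideal_gen :: "'a::comm_ring_1 set \<Rightarrow> 'a set" where
  "ideal_gen \<equiv> Modules.module.span (*)"

definition prime_ideal :: "'a::comm_ring_1 set \<Rightarrow> bool" where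
  "prime_ideal P \<longleftrightarrow>
     is_ideal P \<and> P \<noteq> UNIV \<and> (\<forall>a b. a * b \<in> P \<longrightarrow> a \<in> P \<or> b \<in> P)"

definition ideal_mult :: "'a::comm_ring_1 set \<Rightarrow> 'a set \<Rightarrow> 'a set" where
  "ideal_mult I J = ideal_gen {a * b | a b. a \<in> I \<and> b \<in> J}"

primrec ideal_power :: "'a::comm_ring_1 set \<Rightarrow> nat \<Rightarrow> 'a set" where
  "ideal_power I 0 = UNIV"
| "ideal_power I (Suc k) = ideal_mult I (ideal_power I k)"

definition ideal_colon :: "'a::comm_ring_1 set \<Rightarrow> 'a \<Rightarrow> 'a set" where
  "ideal_colon I f = {g. g * f \<in> I}"

text \<open>
  The associated primes of the quotient by \<open>I\<close>: the primes that are the annihilator of some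
  residue class \<open>f + I\<close>, and this annihilator is \<open>(I : f)\<close>.
\<close>

definition Ass :: "'a::comm_ring_1 set \<Rightarrow> 'a set set" where
  "Ass I = {P. prime_ideal P \<and> (\<exists>f. P = ideal_colon I f)}"

definition irrelevant_ideal :: "('n::finite, 'k::field) mpoly set" where
  "irrelevant_ideal = ideal_gen (range Var)"


section \<open>Initial degree and v-number\<close>

definition alpha :: "('n::finite, 'k::field) mpoly set \<Rightarrow> nat" where
  "alpha I = (LEAST d. \<exists>f\<in>I - {0}. f \<in> graded_part (int d))"

text \<open>
  The v-number is an extended natural number only so that the infimum of an empty set is not a
  natural number; for a proper graded ideal the set is nonempty and the infimum is a minimum.
\<close>

definition v_number :: "('n::finite, 'k::field) mpoly set \<Rightarrow> enat" where
  "v_number I =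
     Inf (enat ` {d. \<exists>f\<in>graded_part (int d). \<exists>P\<in>Ass I. ideal_colon I f = P})"


section \<open>Graded free resolutions and regularity\<close>

definition mat_image :: "'a::comm_ring_1 mat \<Rightarrow> 'a vec set" where
  "mat_image A = {A *\<^sub>v w | w. w \<in> carrier_vec (dim_col A)}"

text \<open>
  The list \<open>ds = [d\<^sub>0, \<dots>, d\<^sub>r]\<close> stands for the graded free module
  \<open>S(-d\<^sub>0) \<oplus> \<dots> \<oplus> S(-d\<^sub>r)\<close>, whose basis elements have the degrees
  \<open>d\<^sub>0, \<dots>, d\<^sub>r\<close>. A homomorphism of degree 0 from the module of \<open>es\<close> to that
  of \<open>ds\<close> is a matrix acting on column vectors.
\<close>

definition graded_map ::
    "int list \<Rightarrow> int list \<Rightarrow> ('n::finite, 'k::field) mpoly mat \<Rightarrow> bool" where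
  "graded_map ds es A \<longleftrightarrow>
     A \<in> carrier_mat (length ds) (length es) \<and>
     (\<forall>a<length ds. \<forall>b<length es. A $$ (a, b) \<in> graded_part (es ! b - ds ! a))"

text \<open>
  The resolution \<open>\<dots> \<rightarrow> F\<^sub>1 \<rightarrow> F\<^sub>0 \<rightarrow> I \<rightarrow> 0\<close>, where \<open>d i\<close> lists the degrees of
  the basis of \<open>F\<^sub>i\<close>. The matrix \<open>\<phi> 0\<close> is the augmentation, composed with the
  inclusion of \<open>I\<close> into the ring, and \<open>\<phi> (Suc i)\<close> is the differential from
  \<open>F\<^sub>i\<^sub>+\<^sub>1\<close> to \<open>F\<^sub>i\<close>.
\<close>

definition graded_free_resolution ::
    "('n::finite, 'k::field) mpoly set \<Rightarrow> (nat \<Rightarrow> int list) \<Rightarrow> (nat \<Rightarrow> ('n, 'k) mpoly mat) \<Rightarrow> bool"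
  where
  "graded_free_resolution I d \<phi> \<longleftrightarrow>
     graded_map [0] (d 0) (\<phi> 0) \<and>
     mat_image (\<phi> 0) = {vec 1 (\<lambda>_. f) | f. f \<in> I} \<and>
     (\<forall>i. graded_map (d i) (d (Suc i)) (\<phi> (Suc i)) \<and>
          mat_kernel (\<phi> i) = mat_image (\<phi> (Suc i)))"

definition minimal_graded_free_resolution ::
    "('n::finite, 'k::field) mpoly set \<Rightarrow> (nat \<Rightarrow> int list) \<Rightarrow> (nat \<Rightarrow> ('n, 'k) mpoly mat) \<Rightarrow> bool"
  where
  "minimal_graded_free_resolution I d \<phi> \<longleftrightarrow>
     graded_free_resolution I d \<phi> \<and>
     (\<forall>i. \<forall>a<length (d i). \<forall>b<length (d (Suc i)). \<phi> (Suc i) $$ (a, b) \<in> irrelevant_ideal)"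

text \<open>
  A graded ideal has a minimal graded free resolution, unique up to isomorphism, so the graded
  Betti numbers do not depend on the choice made here.
\<close>

definition resolution_degrees :: "('n::finite, 'k::field) mpoly set \<Rightarrow> nat \<Rightarrow> int list" where
  "resolution_degrees I = (SOME d. \<exists>\<phi>. minimal_graded_free_resolution I d \<phi>)"

definition graded_betti :: "('n::finite, 'k::field) mpoly set \<Rightarrow> nat \<Rightarrow> int \<Rightarrow> nat" where
  "graded_betti I i j = count_list (resolution_degrees I i) j"

text \<open>
  The supremum is taken in the extended reals so that no boundedness is presupposed; by Hilbert's
  syzygy theorem it is a maximum for nonzero graded ideals.
\<close>

definition regularity :: "('n::finite, 'k::field) mpoly set \<Rightarrow> ereal" where
  "regularity I = Sup {ereal (of_int (j - int i)) | i j. graded_betti I i j \<noteq> 0}"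

definition equigenerated :: "('n::finite, 'k::field) mpoly set \<Rightarrow> bool" where
  "equigenerated I \<longleftrightarrow> (\<exists>d G. G \<subseteq> graded_part d \<and> I = ideal_gen G)"

definition has_linear_resolution :: "('n::finite, 'k::field) mpoly set \<Rightarrow> bool" where
  "has_linear_resolution I \<longleftrightarrow>
     equigenerated I \<and> regularity I = ereal (real (alpha I))"

definition has_linear_powers :: "('n::finite, 'k::field) mpoly set \<Rightarrow> bool" where
  "has_linear_powers I \<longleftrightarrow> (\<forall>k\<ge>1. has_linear_resolution (ideal_power I k))"


section \<open>Path ideals\<close>

text \<open>
  A simple graph whose vertices are all elements of \<open>'n\<close> is given by its set of edges.
\<close>

definition is_path :: "'n set set \<Rightarrow> 'n list \<Rightarrow> bool" where
  "is_path E vs \<longleftrightarrow> distinct vs \<and> successively (\<lambda>a b. {a, b} \<in> E) vs"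

definition path_ideal :: "nat \<Rightarrow> 'n::finite set set \<Rightarrow> ('n, 'k::field) mpoly set" where
  "path_ideal t E = ideal_gen {\<Prod>a\<in>set vs. Var a | vs. is_path E vs \<and> length vs = t}"

text \<open>The path on the vertices \<open>x 1, \<dots>, x n\<close>.\<close>

definition path_graph :: "(nat \<Rightarrow> 'n) \<Rightarrow> nat \<Rightarrow> 'n set set" where
  "path_graph x n = {{x i, x (Suc i)} | i. 1 \<le> i \<and> i < n}"

end

theory Submission
  imports Defs "HOL-Library.List_Lexorder"
begin

text \<open>
  Number the vertices by \<open>1, \<dots>, n\<close>. The path ideal is generated by the \<open>m = n - t + 1\<close> monomials
  \<open>u\<^sub>0, \<dots>, u\<^sub>m\<^sub>-\<^sub>1\<close>, where \<open>u\<^sub>i\<close> is the product of the variables \<open>i + 1, \<dots>, i + t\<close>. If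
  \<open>t = 1 \<or> n \<le> 2 * t\<close>, all its powers have a linear resolution; otherwise not even the ideal itself
  has one.

  Let \<open>t = 1 \<or> n \<le> 2 * t\<close>. A product of \<open>k\<close> generators is recorded by the list of multiplicities
  of its factors. If two such lists first differ at position \<open>j\<close>, then one factor \<open>u\<^sub>j\<close> of the
  lexicographically larger one can be traded for a later factor, at the price of a single variable,
  and this variable occurs to a higher power in the smaller product
  (\<open>exchange_property_E\<close>). So in the lexicographic order of the lists every
  colon ideal of the earlier products by the next one is generated by variables: the power has
  linear quotients (\<open>has_linear_resolution_power\<close>). Linear quotients are inherited by the syzygies,
  in the next degree (\<open>linear_quotients_kernel\<close>), and they determine the degrees in any minimal
  resolution (\<open>linear_quotients_minimal_step\<close>). So the resolution is linear.

  Let \<open>t \<ge> 2\<close> and \<open>n > 2 * t\<close>. The first path and the path that starts two vertices after its end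
  are separated by the vertex \<open>t + 1\<close>. Hence \<open>u\<^sub>0\<close> and \<open>u\<^sub>t\<^sub>+\<^sub>1\<close> are the only
  generators that divide their least common multiple, and the relation between them is not a
  combination of linear relations (\<open>not_has_linear_resolution\<close>).

  Both directions need that a minimal graded free resolution exists, because the Betti numbers are
  read off a chosen one. This follows from Hilbert's basis theorem (\<open>hilbert_basis\<close>, by
  Dickson's lemma and leading terms): every graded submodule of a graded free module has a finite
  set of homogeneous generators, and a shortest list of them has no relation with a unit
  coefficient (\<open>minimal_graded_free_resolution_exists\<close>).

  For the v-number, let the ideal be generated by monomials of degree \<open>e\<close>. A prime colon ideal by
  \<open>f\<close> contains a monomial, hence a variable, so the variable times \<open>f\<close> is a nonzero element of the
  ideal and \<open>f\<close> has degree at least \<open>e - 1\<close>. For the \<open>k\<close>-th power this degree is attained by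
  \<open>u\<^sub>0\<^sup>k\<close> divided by the first variable: the same exchange property shows that the
  colon ideal is generated by variables, hence prime (\<open>v_number_power\<close>).
\<close>

section \<open>Monomials and coefficients\<close>

interpretation ring_mod: Modules.module "(*) :: 'a::comm_ring_1 \<Rightarrow> 'a \<Rightarrow> 'a"
  by unfold_locales (simp_all add: algebra_simps)

abbreviation lookup :: "('a \<Rightarrow>\<^sub>0 'b::zero) \<Rightarrow> 'a \<Rightarrow> 'b" where
  "lookup \<equiv> Poly_Mapping.lookup"

abbreviation keys :: "('a \<Rightarrow>\<^sub>0 'b::zero) \<Rightarrow> 'a set" where
  "keys \<equiv> Poly_Mapping.keys"

text \<open>
  Over a finite set of variables every function is an exponent vector.
\<close>

definition expt :: "('n::finite \<Rightarrow> nat) \<Rightarrow> ('n \<Rightarrow>\<^sub>0 nat)" where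
  "expt f = Abs_poly_mapping f"

lemma lookup_expt [simp]: "lookup (expt f) = f"
  unfolding expt_def by (rule lookup_Abs_poly_mapping) simp

text \<open>
  Divisibility of the monomials with these exponent vectors.
\<close>

definition mdvd :: "('n \<Rightarrow>\<^sub>0 nat) \<Rightarrow> ('n \<Rightarrow>\<^sub>0 nat) \<Rightarrow> bool" where
  "mdvd g k \<longleftrightarrow> (\<forall>a. lookup g a \<le> lookup k a)"

lemma mdvd_iff: "mdvd g k \<longleftrightarrow> (\<exists>l. k = g + l)"
proof
  assume "mdvd g k"
  then have "k = g + (k - g)"
    by (intro poly_mapping_eqI) (simp add: mdvd_def lookup_add lookup_minus)
  then show "\<exists>l. k = g + l" ..
qed (auto simp: mdvd_def lookup_add)

lemma mdvd_refl [simp]: "mdvd g g" by (simp add: mdvd_def)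

lemma mdeg_add [simp]: "mdeg (m + m') = mdeg m + mdeg m'"
  by (simp add: mdeg_def lookup_add sum.distrib)

lemma mdeg_single [simp]: "mdeg (Poly_Mapping.single a c) = c"
  by (simp add: mdeg_def lookup_single when_def)

lemma mdeg_zero [simp]: "mdeg 0 = 0"
  by (simp add: mdeg_def)

lemma mdeg_eq_0_iff: "mdeg m = 0 \<longleftrightarrow> m = 0"
  by (auto simp: mdeg_def intro!: poly_mapping_eqI)

lemma mdeg_1_cases:
  assumes "mdeg m = 1"
  obtains a where "m = Poly_Mapping.single a 1"
proof -
  have "(\<Sum>a\<in>UNIV. lookup m a) = 1" using assms by (simp add: mdeg_def)
  then obtain a where a: "lookup m a = 1" "\<And>b. b \<noteq> a \<Longrightarrow> lookup m b = 0"
    using sum_eq_1_iff[of UNIV "lookup m"] by auto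
  then have "m = Poly_Mapping.single a 1"
    by (intro poly_mapping_eqI) (auto simp: lookup_single when_def)
  then show ?thesis using that by blast
qed

abbreviation xpow :: "('n \<Rightarrow>\<^sub>0 nat) \<Rightarrow> ('n, 'k::field) mpoly" where
  "xpow m \<equiv> Poly_Mapping.single m 1"

lemma Var_eq: "Var a = xpow (Poly_Mapping.single a 1)"
  by (simp add: Var_def)

lemma xpow_mult: "xpow m * xpow m' = (xpow (m + m') :: ('n,'k::field) mpoly)"
  by (simp add: mult_single)

text \<open>
  The product formula with sums over the finite supports, in place of sums over all exponents.
\<close>

lemma lookup_mult_sum:
  fixes f g :: "('n, 'k::field) mpoly"
  shows "lookup (f * g) k =
    (\<Sum>l\<in>keys f. \<Sum>q\<in>keys g. if l + q = k then lookup f l * lookup g q else 0)"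
proof -
  have "lookup (f * g) k = Sum_any (\<lambda>l. lookup f l * Sum_any (\<lambda>q. lookup g q when k = l + q))"
    by (simp add: lookup_mult)
  also have "\<dots> = (\<Sum>l\<in>keys f. lookup f l * Sum_any (\<lambda>q. lookup g q when k = l + q))"
    by (rule Sum_any.expand_superset) (auto simp: in_keys_iff)
  also have "\<dots> = (\<Sum>l\<in>keys f. lookup f l * (\<Sum>q\<in>keys g. lookup g q when k = l + q))"
  proof (rule sum.cong[OF refl])
    fix l
    have "Sum_any (\<lambda>q. lookup g q when k = l + q) = (\<Sum>q\<in>keys g. lookup g q when k = l + q)"
      by (rule Sum_any.expand_superset) (auto simp: in_keys_iff)
    then show "lookup f l * Sum_any (\<lambda>q. lookup g q when k = l + q)
        = lookup f l * (\<Sum>q\<in>keys g. lookup g q when k = l + q)" by simp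
  qed
  also have "\<dots> = (\<Sum>l\<in>keys f. \<Sum>q\<in>keys g. if l + q = k then lookup f l * lookup g q else 0)"
    by (auto simp: sum_distrib_left when_def intro!: sum.cong)
  finally show ?thesis .
qed

lemma keys_multE:
  fixes f g :: "('n, 'k::field) mpoly"
  assumes "k \<in> keys (f * g)"
  obtains l q where "l \<in> keys f" "q \<in> keys g" "k = l + q"
  using keys_mult[of f g] assms by blast

text \<open>
  The way in which coefficients of products are computed below: if a monomial can be written in only
  one way as a product of monomials of the factors, nothing cancels.
\<close>

lemma lookup_mult_unique:
  fixes f g :: "('n, 'k::field) mpoly"
  assumes "\<And>l q. l \<in> keys f \<Longrightarrow> q \<in> keys g \<Longrightarrow> l + q = l0 + q0 \<Longrightarrow> l = l0 \<and> q = q0"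
  shows "lookup (f * g) (l0 + q0) = lookup f l0 * lookup g q0"
proof -
  have "lookup (f * g) (l0 + q0) = (\<Sum>l\<in>keys f. \<Sum>q\<in>keys g.
      if l = l0 then (if q = q0 then lookup f l0 * lookup g q0 else 0) else 0)"
    unfolding lookup_mult_sum using assms by (intro sum.cong refl) auto
  also have "\<dots> = (\<Sum>l\<in>keys f. if l = l0 then (\<Sum>q\<in>keys g.
       if q = q0 then lookup f l0 * lookup g q0 else 0) else 0)"
    by (intro sum.cong refl) auto
  also have "\<dots> = lookup f l0 * lookup g q0"
    by (auto simp: in_keys_iff)
  finally show ?thesis .
qed

lemma lookup_mult_eq_0:
  fixes f g :: "('n, 'k::field) mpoly"
  assumes "\<And>l q. l \<in> keys f \<Longrightarrow> q \<in> keys g \<Longrightarrow> l + q \<noteq> k"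
  shows "lookup (f * g) k = 0"
  using keys_multE[of k f g] assms by (metis in_keys_iff)

lemma lookup_xpow_mult_add [simp]:
  fixes f :: "('n, 'k::field) mpoly"
  shows "lookup (Poly_Mapping.single m c * f) (m + k) = c * lookup f k"
  by (subst lookup_mult_unique) (auto split: if_splits)

lemma lookup_mult_xpow_add [simp]:
  fixes f :: "('n, 'k::field) mpoly"
  shows "lookup (f * Poly_Mapping.single m c) (k + m) = lookup f k * c"
  using lookup_xpow_mult_add[of m c f k] by (simp add: mult.commute add.commute)

lemma mpoly_eq_sum_terms:
  fixes f :: "('n, 'k::field) mpoly"
  shows "f = (\<Sum>m\<in>keys f. Poly_Mapping.single m (lookup f m))"
  by (intro poly_mapping_eqI) (auto simp: lookup_sum lookup_single when_def in_keys_iff)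

lemma is_idealI:
  assumes "0 \<in> J" "\<And>x y. x \<in> J \<Longrightarrow> y \<in> J \<Longrightarrow> x + y \<in> J" "\<And>c x. x \<in> J \<Longrightarrow> c * x \<in> J"
  shows "is_ideal J"
  by (rule ring_mod.subspaceI) (use assms in auto)

lemma is_ideal_ideal_gen [simp]: "is_ideal (ideal_gen G)"
  by (rule ring_mod.subspace_span)

text \<open>
  Membership in a monomial ideal is decided monomial by monomial. This turns all ideals of the
  theorem, and their colon ideals, into sets of exponent vectors.
\<close>

lemma ideal_gen_monomials:
  "ideal_gen (xpow ` G) = {f :: ('n::finite, 'k::field) mpoly. \<forall>k\<in>keys f. \<exists>g\<in>G. mdvd g k}"
    (is "_ = ?R")
proof (intro subset_antisym)
  have sub: "is_ideal ?R"
  proof (rule is_idealI)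
    fix x y :: "('n, 'k) mpoly" assume "x \<in> ?R" "y \<in> ?R"
    then show "x + y \<in> ?R" using keys_add[of x y] by blast
  next
    fix c x :: "('n, 'k) mpoly" assume x: "x \<in> ?R"
    show "c * x \<in> ?R"
    proof (safe elim!: keys_multE)
      fix l q assume "q \<in> keys x"
      then obtain g where "g \<in> G" "mdvd g q" using x by blast
      then show "\<exists>g\<in>G. mdvd g (l + q)"
        by (intro bexI[of _ g]) (auto simp: mdvd_def lookup_add trans_le_add2)
    qed
  qed simp
  show "ideal_gen (xpow ` G) \<subseteq> ?R"
    by (rule ring_mod.span_minimal[OF _ sub]) (auto intro: mdvd_refl)
  show "?R \<subseteq> ideal_gen (xpow ` G)"
  proof
    fix f assume f: "f \<in> ?R"
    have "(\<Sum>m\<in>keys f. Poly_Mapping.single m (lookup f m)) \<in> ideal_gen (xpow ` G)"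
    proof (rule ring_mod.span_sum)
      fix m assume "m \<in> keys f"
      then obtain g l where g: "g \<in> G" "m = g + l" using f by (auto simp: mdvd_iff)
      have "Poly_Mapping.single m (lookup f m) = Poly_Mapping.single l (lookup f m) * xpow g"
        by (simp add: mult_single g add.commute)
      also have "\<dots> \<in> ideal_gen (xpow ` G)"
        by (intro ring_mod.span_scale ring_mod.span_base imageI g)
      finally show "Poly_Mapping.single m (lookup f m) \<in> ideal_gen (xpow ` G)" .
    qed
    then show "f \<in> ideal_gen (xpow ` G)" using mpoly_eq_sum_terms[of f] by simp
  qed
qed

lemma single_mdvd_iff: "mdvd (Poly_Mapping.single a 1) k \<longleftrightarrow> 0 < lookup k a"
  by (auto simp: mdvd_def lookup_single when_def)

lemma ideal_gen_Var:
  "ideal_gen (Var ` V) = {f :: ('n::finite, 'k::field) mpoly. \<forall>k\<in>keys f. \<exists>a\<in>V. 0 < lookup k a}"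
proof -
  have "Var ` V = (xpow ` ((\<lambda>a. Poly_Mapping.single a 1) ` V) :: ('n,'k) mpoly set)"
    by (auto simp: Var_eq image_image)
  then show ?thesis by (simp add: ideal_gen_monomials single_mdvd_iff del: One_nat_def)
qed

text \<open>
  So the entries of a minimal resolution are the polynomials without constant term, and minimality
  says that no relation has a unit as a coefficient.
\<close>

lemma irrelevant_ideal_iff:
  "(f :: ('n::finite, 'k::field) mpoly) \<in> irrelevant_ideal \<longleftrightarrow> lookup f 0 = 0"
proof -
  have "(\<exists>a. 0 < lookup k a) \<longleftrightarrow> k \<noteq> 0" for k :: "'n \<Rightarrow>\<^sub>0 nat"
    by (auto simp: poly_mapping_eq_iff fun_eq_iff)
  then show ?thesis
    unfolding irrelevant_ideal_def by (auto simp: ideal_gen_Var in_keys_iff)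
qed

section \<open>A monomial order\<close>

text \<open>
  Any list of all variables defines a lexicographic order on monomials. Repetitions in the list do
  no harm.
\<close>

definition var_list :: "'n::finite list" where
  "var_list = (SOME xs. set xs = UNIV)"

lemma set_var_list [simp]: "set (var_list :: 'n::finite list) = UNIV"
  unfolding var_list_def by (rule someI_ex) (rule finite_list[OF finite])

definition mkey :: "('n::finite \<Rightarrow>\<^sub>0 nat) \<Rightarrow> nat list" where
  "mkey m = map (lookup m) var_list"

lemma mkey_inj [simp]: "mkey m = mkey m' \<longleftrightarrow> m = m'"
  by (simp add: mkey_def poly_mapping_eq_iff fun_eq_iff)

lemma list_add_less_mono:
  fixes f g h :: "'a \<Rightarrow> nat"
  shows "map f xs < map g xs \<Longrightarrow> map (\<lambda>a. h a + f a) xs < map (\<lambda>a. h a + g a) xs"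
  by (induction xs) auto

lemma mkey_add_less: "mkey m < mkey m' \<Longrightarrow> mkey (l + m) < mkey (l + m')"
proof -
  have "lookup (l + n) = (\<lambda>a. lookup l a + lookup n a)" for n
    by (rule ext) (rule lookup_add)
  then show "mkey m < mkey m' \<Longrightarrow> mkey (l + m) < mkey (l + m')"
    using list_add_less_mono[of "lookup m" var_list "lookup m'" "lookup l"] by (simp add: mkey_def)
qed

text \<open>
  A product of two largest monomials arises in one way only; with \<open>lookup_mult_unique\<close>
  this makes leading coefficients multiplicative.
\<close>

lemma mkey_add_mono:
  assumes "mkey l \<le> mkey l0" "mkey q \<le> mkey q0" "l + q = l0 + q0"
  shows "l = l0 \<and> q = q0"
proof (rule ccontr)
  assume "\<not> ?thesis"
  then have "mkey (l + q) < mkey (l0 + q0)"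
    using assms mkey_add_less[of q q0 l] mkey_add_less[of l l0 q0]
    by (cases "l = l0"; cases "q = q0") (auto simp: le_less add.commute)
  then show False using assms by simp
qed

text \<open>
  All keys have the same length, and on lists of the same length the lexicographic order is well
  founded.
\<close>

lemma wf_mkey: "wf {(m, m'). mkey m < mkey (m' :: 'n::finite \<Rightarrow>\<^sub>0 nat)}"
proof -
  have "{(m, m'). mkey m < mkey (m' :: 'n \<Rightarrow>\<^sub>0 nat)} \<subseteq> inv_image (lex {(u, v). u < (v::nat)}) mkey"
    by (auto simp: list_less_def lexord_lex mkey_def)
  moreover have "wf (inv_image (lex {(u, v). u < (v::nat)}) mkey)"
    by (intro wf_inv_image wf_lex wf)
  ultimately show ?thesis by (rule wf_subset[rotated])
qed

definition lead :: "('n::finite, 'k::field) mpoly \<Rightarrow> ('n \<Rightarrow>\<^sub>0 nat)" where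
  "lead f = (ARG_MAX mkey m. m \<in> keys f)"

lemma lead:
  assumes "f \<noteq> 0"
  shows "lead f \<in> keys f" "\<And>m. m \<in> keys f \<Longrightarrow> mkey m \<le> mkey (lead f)"
proof -
  have "Max (mkey ` keys f) \<in> mkey ` keys f" using assms by (intro Max_in) auto
  then obtain m where m: "m \<in> keys f" "Max (mkey ` keys f) = mkey m" by auto
  have *: "mkey m' \<le> mkey m" if "m' \<in> keys f" for m'
    using that unfolding m(2)[symmetric] by simp
  have "lead f = m"
    unfolding lead_def arg_max_def is_arg_max_linorder
  proof (rule some_equality)
    fix m' assume m': "m' \<in> keys f \<and> (\<forall>y. y \<in> keys f \<longrightarrow> mkey y \<le> mkey m')"
    then have "mkey m' = mkey m" using m * by (intro antisym) auto
    then show "m' = m" by simp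
  qed (use m * in auto)
  then show "lead f \<in> keys f" "\<And>m. m \<in> keys f \<Longrightarrow> mkey m \<le> mkey (lead f)"
    using m * by auto
qed

text \<open>
  Modulo the variables in \<open>V\<close> a polynomial is what remains after all terms with such a variable are
  dropped (the map \<open>r\<close>), and the leading terms of two nonzero remainders multiply to a
  term of the product.
\<close>

lemma prime_ideal_Var:
  "prime_ideal (ideal_gen (Var ` V) :: ('n::finite, 'k::field) mpoly set)"
proof -
  let ?P = "ideal_gen (Var ` V) :: ('n, 'k) mpoly set"
  let ?N = "\<lambda>k :: 'n \<Rightarrow>\<^sub>0 nat. \<forall>a\<in>V. lookup k a = 0"
  define r where "r f = Poly_Mapping.mapp (\<lambda>k c. if ?N k then c else 0) f" for f :: "('n, 'k) mpoly"
  have r: "lookup (r f) k = (if ?N k then lookup f k else 0)" for f k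
    by (auto simp: r_def lookup_mapp in_keys_iff when_def)
  have P: "f \<in> ?P \<longleftrightarrow> r f = 0" for f
  proof -
    have "r f = 0 \<longleftrightarrow> (\<forall>k. ?N k \<longrightarrow> lookup f k = 0)"
      by (simp add: poly_mapping_eq_iff fun_eq_iff r)
    also have "\<dots> \<longleftrightarrow> (\<forall>k. k \<in> keys f \<longrightarrow> \<not> ?N k)"
      unfolding in_keys_iff by blast
    finally show ?thesis by (simp add: ideal_gen_Var Ball_def Bex_def)
  qed
  have "a \<in> ?P \<or> b \<in> ?P" if ab: "a * b \<in> ?P" for a b
  proof (rule ccontr)
    assume "\<not> ?thesis"
    then have nz: "r a \<noteq> 0" "r b \<noteq> 0" by (auto simp: P)
    let ?l = "lead (r a)" and ?q = "lead (r b)"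
    have lq: "?l \<in> keys (r a)" "?q \<in> keys (r b)" using lead(1) nz by blast+
    have "?N ?l" "?N ?q" using lq by (auto simp: in_keys_iff r split: if_splits)
    then have N: "?N (?l + ?q)" by (simp add: lookup_add)
    \<comment> \<open>A product that avoids the variables of \<open>V\<close> comes from factors that avoid them.\<close>
    have "lookup (a * b) (?l + ?q) = lookup a ?l * lookup b ?q"
    proof (rule lookup_mult_unique)
      fix l q assume k: "l \<in> keys a" "q \<in> keys b" "l + q = ?l + ?q"
      have "?N l \<and> ?N q" using N by (auto simp: lookup_add simp flip: k(3))
      then have "l \<in> keys (r a)" "q \<in> keys (r b)" using k by (auto simp: in_keys_iff r)
      then show "l = ?l \<and> q = ?q"
        by (intro mkey_add_mono lead(2) nz k(3))
    qed
    also have "\<dots> \<noteq> 0" using lq by (auto simp: in_keys_iff r split: if_splits)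
    finally have "?l + ?q \<in> keys (a * b)" by (simp add: in_keys_iff)
    then show False using ab N by (force simp: ideal_gen_Var)
  qed
  moreover have "(1 :: ('n, 'k) mpoly) \<notin> ?P" by (simp add: ideal_gen_Var)
  ultimately show ?thesis unfolding prime_ideal_def by auto
qed

section \<open>Hilbert's basis theorem\<close>

lemma nat_seq_incseq_subseq:
  fixes f :: "nat \<Rightarrow> nat"
  obtains r where "strict_mono r" "incseq (f \<circ> r)"
proof -
  obtain r where r: "strict_mono (r :: nat \<Rightarrow> nat)" "monoseq (\<lambda>n. f (r n))"
    using seq_monosub by blast
  show ?thesis
  proof (cases "incseq (\<lambda>n. f (r n))")
    case True
    then show ?thesis using that r(1) by (auto simp: comp_def)
  next
    case False
    then have dec: "decseq (\<lambda>n. f (r n))" using r(2) by (simp add: monoseq_iff)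
    \<comment> \<open>A decreasing sequence of natural numbers is constant from the position of its minimum on.\<close>
    obtain N where N: "\<And>n. f (r N) \<le> f (r n)"
      using ex_has_least_nat[of "\<lambda>_. True" _ "\<lambda>n. f (r n)"] by auto
    have "f (r (N + n)) = f (r N)" for n
      using N[of "N + n"] decseqD[OF dec, of N "N + n"] by simp
    then have "incseq (f \<circ> (\<lambda>n. r (N + n)))" by (auto simp: incseq_def)
    moreover have "strict_mono (\<lambda>n. r (N + n))" using r(1) by (auto simp: strict_mono_def)
    ultimately show ?thesis using that by blast
  qed
qed

text \<open>
  Pass to a subsequence on which one exponent after the other is nondecreasing.
\<close>

lemma dickson_seq:
  fixes f :: "nat \<Rightarrow> ('n::finite \<Rightarrow>\<^sub>0 nat)"
  shows "\<exists>i j. i < j \<and> mdvd (f i) (f j)"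
proof -
  have "\<exists>r. strict_mono r \<and> (\<forall>a\<in>V. incseq (\<lambda>i. lookup (f (r i)) a))" if "finite V" for V
    using that
  proof induction
    case empty
    show ?case by (rule exI[of _ id]) (simp add: strict_mono_def)
  next
    case (insert a V)
    then obtain r where r: "strict_mono r" "\<forall>a\<in>V. incseq (\<lambda>i. lookup (f (r i)) a)" by blast
    obtain s where s: "strict_mono s" "incseq ((\<lambda>i. lookup (f (r i)) a) \<circ> s)"
      by (rule nat_seq_incseq_subseq)
    have "strict_mono (r \<circ> s)" using r s by (simp add: strict_mono_o)
    moreover have "\<forall>b\<in>insert a V. incseq (\<lambda>i. lookup (f ((r \<circ> s) i)) b)"
      using r s(2) strict_mono_mono[OF s(1)] by (auto simp: incseq_def mono_def)
    ultimately show ?case by blast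
  qed
  from this[OF finite_UNIV] obtain r where r: "strict_mono r"
    "\<And>a. incseq (\<lambda>i. lookup (f (r i)) a)" by auto
  have "mdvd (f (r 0)) (f (r 1))" using r(2) by (auto simp: mdvd_def incseq_def)
  moreover have "r 0 < r 1" using r(1) by (simp add: strict_mono_def)
  ultimately show ?thesis by blast
qed

text \<open>
  If no finite subset worked, one could choose elements one by one, none a multiple of an earlier
  one.
\<close>

lemma dickson:
  fixes A :: "('n::finite \<Rightarrow>\<^sub>0 nat) set"
  obtains B where "finite B" "B \<subseteq> A" "\<And>a. a \<in> A \<Longrightarrow> \<exists>b\<in>B. mdvd b a"
proof -
  have "\<exists>B. finite B \<and> B \<subseteq> A \<and> (\<forall>a\<in>A. \<exists>b\<in>B. mdvd b a)"
  proof (rule ccontr)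
    assume no: "\<nexists>B. finite B \<and> B \<subseteq> A \<and> (\<forall>a\<in>A. \<exists>b\<in>B. mdvd b a)"
    define P where "P f n x \<longleftrightarrow> x \<in> A \<and> (\<forall>i<n. \<not> mdvd (f i) x)"
      for f :: "nat \<Rightarrow> 'n \<Rightarrow>\<^sub>0 nat" and n x
    have "\<exists>f. \<forall>n. P f n (f n)"
    proof (rule dependent_wellorder_choice)
      fix f n assume "\<And>m. m < n \<Longrightarrow> P f m (f m)"
      then have "f ` {..<n} \<subseteq> A" by (auto simp: P_def)
      then have "\<exists>x\<in>A. \<forall>b\<in>f ` {..<n}. \<not> mdvd b x"
        using no by (meson finite_imageI finite_lessThan)
      then show "\<exists>x. P f n x" unfolding P_def by blast
    qed (simp add: P_def)
    then obtain f where "\<forall>n. P f n (f n)" ..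
    then have "\<And>i n. i < n \<Longrightarrow> \<not> mdvd (f i) (f n)" by (simp add: P_def)
    then show False using dickson_seq[of f] by blast
  qed
  then show ?thesis using that by blast
qed

text \<open>
  The division step: subtract the multiple of \<open>b\<close> that cancels the leading term of \<open>f\<close>.
\<close>

lemma reduce_lead:
  fixes f b :: "('n::finite, 'k::field) mpoly"
  assumes "f \<noteq> 0" "b \<noteq> 0" "lead f = lead b + l"
  obtains c where "f - c * b = 0 \<or> mkey (lead (f - c * b)) < mkey (lead f)"
proof -
  define c where "c = Poly_Mapping.single l (lookup f (lead f) / lookup b (lead b))"
  have b0: "lookup b (lead b) \<noteq> 0" using lead(1)[OF assms(2)] by (simp add: in_keys_iff)
  have "lookup (c * b) (lead f) = lookup f (lead f)"
    unfolding c_def assms(3) add.commute[of "lead b"] using b0 by simp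
  then have z: "lookup (f - c * b) (lead f) = 0" by (simp add: lookup_minus)
  have le: "mkey m \<le> mkey (lead f)" if "m \<in> keys (f - c * b)" for m
  proof -
    have "m \<in> keys f \<or> m \<in> keys (c * b)" using that by (auto simp: in_keys_iff lookup_minus)
    then show ?thesis
    proof
      assume "m \<in> keys (c * b)"
      then obtain q where q: "q \<in> keys b" "m = l + q"
        by (auto elim!: keys_multE simp: c_def split: if_splits)
      then have "mkey q \<le> mkey (lead b)" using lead(2) assms(2) by blast
      then show ?thesis
        using q mkey_add_less[of q "lead b" l] by (auto simp: assms(3) le_less add.commute)
    qed (use lead(2) assms(1) in blast)
  qed
  have "mkey (lead (f - c * b)) < mkey (lead f)" if nz: "f - c * b \<noteq> 0"
  proof -
    have "lead (f - c * b) \<noteq> lead f" using lead(1)[OF nz] z by (metis in_keys_iff)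
    then show ?thesis using le[OF lead(1)[OF nz]] by (simp add: le_less)
  qed
  then show ?thesis using that by blast
qed

text \<open>
  By Dickson's lemma finitely many leading terms of elements of \<open>J\<close> divide all the others. The
  corresponding elements generate \<open>J\<close>, since division by them terminates.
\<close>

theorem hilbert_basis:
  fixes J :: "('n::finite, 'k::field) mpoly set"
  assumes J: "is_ideal J"
  obtains B where "finite B" "J = ideal_gen B"
proof -
  obtain L where L: "finite L" "L \<subseteq> lead ` (J - {0})" "\<And>f. f \<in> J - {0} \<Longrightarrow> \<exists>b\<in>L. mdvd b (lead f)"
    by (rule dickson[of "lead ` (J - {0})"]) blast
  obtain B where B: "finite B" "B \<subseteq> J - {0}" "L = lead ` B"
    using finite_subset_image[OF L(1,2)] by blast
  have "f \<in> ideal_gen B" if "f \<in> J" for f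
  proof (cases "f = 0")
    case False
    have "\<forall>f. f \<in> J - {0} \<longrightarrow> lead f = m \<longrightarrow> f \<in> ideal_gen B" for m
    proof (induction m rule: wf_induct_rule[OF wf_mkey])
      case (1 m)
      show ?case
      proof (intro allI impI)
        fix f assume f: "f \<in> J - {0}" "lead f = m"
        then obtain b where b: "b \<in> B" "mdvd (lead b) (lead f)" using L(3) B(3) by blast
        then obtain l where l: "lead f = lead b + l" by (auto simp: mdvd_iff)
        have b': "b \<in> J" "b \<noteq> 0" using B b by auto
        obtain c where c: "f - c * b = 0 \<or> mkey (lead (f - c * b)) < mkey (lead f)"
          using reduce_lead[OF _ _ l] f b'(2) by blast
        have "f - c * b \<in> J"
          using f b' J by (intro ring_mod.subspace_diff ring_mod.subspace_scale) auto
        then have "f - c * b \<in> ideal_gen B"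
          using c 1 f(2) by (cases "f - c * b = 0") (auto simp: ring_mod.span_zero)
        moreover have "c * b \<in> ideal_gen B"
          by (intro ring_mod.span_scale ring_mod.span_base b)
        ultimately have "f - c * b + c * b \<in> ideal_gen B" by (rule ring_mod.span_add)
        then show "f \<in> ideal_gen B" by simp
      qed
    qed
    then show ?thesis using that False by blast
  qed (simp add: ring_mod.span_zero)
  moreover have "ideal_gen B \<subseteq> J" using B J by (intro ring_mod.span_minimal) auto
  ultimately show ?thesis using that B(1) by blast
qed

section \<open>Homogeneous components\<close>

definition hcomp :: "int \<Rightarrow> ('n::finite, 'k::field) mpoly \<Rightarrow> ('n, 'k) mpoly" where
  "hcomp j = Poly_Mapping.mapp (\<lambda>m c. if int (mdeg m) = j then c else 0)"

lemma lookup_hcomp: "lookup (hcomp j f) m = (if int (mdeg m) = j then lookup f m else 0)"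
  by (auto simp: hcomp_def lookup_mapp in_keys_iff when_def)

lemma hcomp_add: "hcomp j (f + g) = hcomp j f + hcomp j g"
  by (intro poly_mapping_eqI) (simp add: lookup_hcomp lookup_add)

lemma hcomp_0 [simp]: "hcomp j 0 = 0"
  by (intro poly_mapping_eqI) (simp add: lookup_hcomp)

lemma hcomp_sum: "hcomp j (sum f A) = (\<Sum>i\<in>A. hcomp j (f i))"
  by (induction A rule: infinite_finite_induct) (auto simp: hcomp_add)

lemma graded_part_iff: "f \<in> graded_part j \<longleftrightarrow> hcomp j f = f"
proof
  assume "f \<in> graded_part j"
  then show "hcomp j f = f"
    by (intro poly_mapping_eqI) (auto simp: lookup_hcomp graded_part_def in_keys_iff)
next
  assume h: "hcomp j f = f"
  show "f \<in> graded_part j"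
    unfolding graded_part_def
  proof (safe)
    fix m assume "m \<in> keys f"
    then have "lookup (hcomp j f) m \<noteq> 0" by (simp add: h in_keys_iff)
    then show "int (mdeg m) = j" by (simp add: lookup_hcomp split: if_splits)
  qed
qed

lemma hcomp_in_graded_part: "hcomp j f \<in> graded_part j"
  by (auto simp: graded_part_def in_keys_iff lookup_hcomp split: if_splits)

text \<open>
  Split \<open>f\<close> into its component of degree \<open>j\<close> and the rest; multiplication by \<open>a\<close> shifts the degrees
  of both parts by \<open>d\<close>, so the rest contributes nothing.
\<close>

lemma hcomp_mult:
  assumes a: "a \<in> graded_part d"
  shows "hcomp (d + j) (a * f) = a * hcomp j f"
proof -
  have "lookup (a * hcomp j f) k = 0" if "int (mdeg k) \<noteq> d + j" for k
    by (rule lookup_mult_eq_0) (use a that hcomp_in_graded_part[of j f] in \<open>auto simp: graded_part_def\<close>)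
  moreover have "lookup (a * (f - hcomp j f)) k = 0" if "int (mdeg k) = d + j" for k
    by (rule lookup_mult_eq_0)
      (use a that in \<open>auto simp: graded_part_def in_keys_iff lookup_hcomp lookup_minus\<close>)
  ultimately show ?thesis
    by (intro poly_mapping_eqI) (auto simp: lookup_hcomp lookup_minus right_diff_distrib)
qed

section \<open>Submodules of free modules\<close>

definition vec_submodule :: "nat \<Rightarrow> 'a::comm_ring_1 vec set \<Rightarrow> bool" where
  "vec_submodule r M \<longleftrightarrow> M \<subseteq> carrier_vec r \<and> 0\<^sub>v r \<in> M \<and>
     (\<forall>v\<in>M. \<forall>w\<in>M. v + w \<in> M) \<and> (\<forall>c. \<forall>v\<in>M. c \<cdot>\<^sub>v v \<in> M)"

lemma vec_submoduleD:
  assumes "vec_submodule r M"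
  shows "v \<in> M \<Longrightarrow> v \<in> carrier_vec r" "0\<^sub>v r \<in> M"
    "v \<in> M \<Longrightarrow> w \<in> M \<Longrightarrow> v + w \<in> M" "v \<in> M \<Longrightarrow> c \<cdot>\<^sub>v v \<in> M"
  using assms unfolding vec_submodule_def by auto

lemma vec_submodule_diff:
  assumes M: "vec_submodule r M" "v \<in> M" "w \<in> M"
  shows "v - w \<in> M"
proof -
  have "v - w = v + (- 1) \<cdot>\<^sub>v w"
    using vec_submoduleD(1)[OF M(1)] M(2,3) by (intro eq_vecI) auto
  then show ?thesis using vec_submoduleD(3,4)[OF M(1)] M(2,3) by simp
qed

lemma index_mult_mat_vec_sum:
  assumes "A \<in> carrier_mat r n" "w \<in> carrier_vec n" "a < r"
  shows "(A *\<^sub>v w) $ a = (\<Sum>b<n. A $$ (a, b) * w $ b)"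
  using assms by (simp add: scalar_prod_def lessThan_atLeast0)

lemma mult_mat_vec_smult:
  fixes A :: "'a::comm_ring_1 mat"
  assumes "A \<in> carrier_mat r n" "w \<in> carrier_vec n"
  shows "A *\<^sub>v (c \<cdot>\<^sub>v w) = c \<cdot>\<^sub>v (A *\<^sub>v w)"
  using assms by (intro eq_vecI) auto

text \<open>
  Only the columns at which \<open>w\<close> is nonzero have to lie in \<open>N\<close>, so that a single
  column can be left out.
\<close>

lemma mult_mat_vec_supported:
  fixes A :: "'a::comm_ring_1 mat"
  assumes N: "vec_submodule r N" and A: "A \<in> carrier_mat r n" and w: "w \<in> carrier_vec n"
    and cols: "\<And>b. b < n \<Longrightarrow> w $ b \<noteq> 0 \<Longrightarrow> col A b \<in> N"
  shows "A *\<^sub>v w \<in> N"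
proof -
  have "vec r (\<lambda>a. \<Sum>b<k. A $$ (a, b) * w $ b) \<in> N" if "k \<le> n" for k
    using that
  proof (induction k)
    case 0
    have "vec r (\<lambda>a. \<Sum>b<0. A $$ (a, b) * w $ b) = 0\<^sub>v r" by auto
    then show ?case using vec_submoduleD(2)[OF N] by simp
  next
    case (Suc k)
    then have IH: "vec r (\<lambda>a. \<Sum>b<k. A $$ (a, b) * w $ b) \<in> N" by simp
    show ?case
    proof (cases "w $ k = 0")
      case True
      then show ?thesis using IH by simp
    next
      case False
      have "vec r (\<lambda>a. \<Sum>b<Suc k. A $$ (a, b) * w $ b) =
          vec r (\<lambda>a. \<Sum>b<k. A $$ (a, b) * w $ b) + w $ k \<cdot>\<^sub>v col A k"
        using A Suc.prems by (intro eq_vecI) (auto simp: mult.commute)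
      then show ?thesis using IH vec_submoduleD(3,4)[OF N] cols[of k] False Suc.prems by simp
    qed
  qed
  from this[of n] have "vec r (\<lambda>a. \<Sum>b<n. A $$ (a, b) * w $ b) \<in> N" by simp
  moreover have "vec r (\<lambda>a. \<Sum>b<n. A $$ (a, b) * w $ b) = A *\<^sub>v w"
    using A by (intro eq_vecI) (simp_all add: index_mult_mat_vec_sum[OF A w] del: index_mult_mat_vec)
  ultimately show ?thesis by simp
qed

lemma vec_submodule_image:
  fixes A :: "'a::comm_ring_1 mat"
  assumes A: "A \<in> carrier_mat r n" and Z: "vec_submodule n Z"
  shows "vec_submodule r ((*\<^sub>v) A ` Z)"
  unfolding vec_submodule_def
proof (safe)
  have "A *\<^sub>v 0\<^sub>v n = 0\<^sub>v r" using A by (intro eq_vecI) auto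
  then show "0\<^sub>v r \<in> (*\<^sub>v) A ` Z" using vec_submoduleD(2)[OF Z] by (metis imageI)
next
  fix v w assume "v \<in> Z" "w \<in> Z"
  then have "A *\<^sub>v v + A *\<^sub>v w = A *\<^sub>v (v + w)" "v + w \<in> Z"
    using vec_submoduleD[OF Z] A by (simp_all add: mult_add_distrib_mat_vec)
  then show "A *\<^sub>v v + A *\<^sub>v w \<in> (*\<^sub>v) A ` Z" by simp
next
  fix c v assume "v \<in> Z"
  then have "c \<cdot>\<^sub>v (A *\<^sub>v v) = A *\<^sub>v (c \<cdot>\<^sub>v v)" "c \<cdot>\<^sub>v v \<in> Z"
    using vec_submoduleD[OF Z] A by (simp_all add: mult_mat_vec_smult)
  then show "c \<cdot>\<^sub>v (A *\<^sub>v v) \<in> (*\<^sub>v) A ` Z" by simp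
qed (use A in \<open>auto intro: carrier_vecI\<close>)

lemma mat_image_eq:
  assumes "A \<in> carrier_mat r n"
  shows "mat_image A = (*\<^sub>v) A ` carrier_vec n"
  using assms by (auto simp: mat_image_def)

lemma vec_submodule_mat_image:
  fixes A :: "'a::comm_ring_1 mat"
  assumes A: "A \<in> carrier_mat r n"
  shows "vec_submodule r (mat_image A)"
  unfolding mat_image_eq[OF A]
  by (rule vec_submodule_image[OF A]) (simp add: vec_submodule_def)

lemma mult_mat_vec_unit:
  fixes A :: "'a::comm_ring_1 mat"
  assumes "A \<in> carrier_mat r n" "b < n"
  shows "A *\<^sub>v unit_vec n b = col A b"
  using assms by (intro eq_vecI) (auto simp: row_def)

lemma col_in_mat_image:
  fixes A :: "'a::comm_ring_1 mat"
  assumes A: "A \<in> carrier_mat r n" "b < n"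
  shows "col A b \<in> mat_image A"
  unfolding mat_image_eq[OF A(1)] mult_mat_vec_unit[OF A, symmetric] by (rule imageI) simp

lemma mat_image_least:
  fixes A :: "'a::comm_ring_1 mat"
  assumes N: "vec_submodule r N" and A: "A \<in> carrier_mat r n"
    and "\<And>b. b < n \<Longrightarrow> col A b \<in> N"
  shows "mat_image A \<subseteq> N"
  using mult_mat_vec_supported[OF N A] assms(3) A by (auto simp: mat_image_def)

lemma vec_submodule_mat_kernel:
  fixes A :: "'a::comm_ring_1 mat"
  assumes A: "A \<in> carrier_mat r n"
  shows "vec_submodule n (mat_kernel A)"
  unfolding vec_submodule_def mat_kernel[OF A]
proof (safe)
  show "A *\<^sub>v 0\<^sub>v n = 0\<^sub>v r" using A by (intro eq_vecI) auto
next
  fix v w assume "v \<in> carrier_vec n" "A *\<^sub>v v = 0\<^sub>v r" "w \<in> carrier_vec n" "A *\<^sub>v w = 0\<^sub>v r"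
  then show "A *\<^sub>v (v + w) = 0\<^sub>v r" using A by (simp add: mult_add_distrib_mat_vec)
next
  fix c v assume "v \<in> carrier_vec n" "A *\<^sub>v v = 0\<^sub>v r"
  then have "A *\<^sub>v (c \<cdot>\<^sub>v v) = c \<cdot>\<^sub>v 0\<^sub>v r" using mult_mat_vec_smult[OF A, of v c] by simp
  also have "\<dots> = 0\<^sub>v r" by (intro eq_vecI) auto
  finally show "A *\<^sub>v (c \<cdot>\<^sub>v v) = 0\<^sub>v r" .
qed auto

text \<open>
  The \<open>i\<close>-th coordinates of the elements whose later coordinates vanish. These ideals, one for
  each coordinate, carry facts about ideals over to submodules of free modules.
\<close>

definition top_coeffs :: "nat \<Rightarrow> nat \<Rightarrow> 'a::comm_ring_1 vec set \<Rightarrow> 'a set" where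
  "top_coeffs r i M = {w $ i | w. w \<in> M \<and> (\<forall>c. i < c \<and> c < r \<longrightarrow> w $ c = 0)}"

lemma top_coeffsI:
  "w \<in> M \<Longrightarrow> (\<And>c. i < c \<Longrightarrow> c < r \<Longrightarrow> w $ c = 0) \<Longrightarrow> w $ i = a \<Longrightarrow> a \<in> top_coeffs r i M"
  unfolding top_coeffs_def by auto

lemma top_coeffsE:
  assumes "a \<in> top_coeffs r i M"
  obtains w where "w \<in> M" "\<And>c. i < c \<Longrightarrow> c < r \<Longrightarrow> w $ c = 0" "w $ i = a"
  using assms unfolding top_coeffs_def by auto

lemma is_ideal_top_coeffs:
  assumes M: "vec_submodule r M" and i: "i < r"
  shows "is_ideal (top_coeffs r i M)"
proof (rule is_idealI)
  show "0 \<in> top_coeffs r i M"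
    by (rule top_coeffsI[of "0\<^sub>v r"]) (use i vec_submoduleD(2)[OF M] in auto)
next
  fix x y assume "x \<in> top_coeffs r i M" "y \<in> top_coeffs r i M"
  then obtain v w where vw: "v \<in> M" "\<And>c. i < c \<Longrightarrow> c < r \<Longrightarrow> v $ c = 0" "v $ i = x"
    "w \<in> M" "\<And>c. i < c \<Longrightarrow> c < r \<Longrightarrow> w $ c = 0" "w $ i = y"
    by (elim top_coeffsE) blast
  have "v \<in> carrier_vec r" "w \<in> carrier_vec r" using vw vec_submoduleD(1)[OF M] by auto
  then show "x + y \<in> top_coeffs r i M"
    by (intro top_coeffsI[of "v + w"]) (use vw i vec_submoduleD(3)[OF M] in auto)
next
  fix a x assume "x \<in> top_coeffs r i M"
  then obtain v where v: "v \<in> M" "\<And>c. i < c \<Longrightarrow> c < r \<Longrightarrow> v $ c = 0" "v $ i = x"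
    by (elim top_coeffsE) blast
  have "v \<in> carrier_vec r" using v vec_submoduleD(1)[OF M] by auto
  then show "a * x \<in> top_coeffs r i M"
    by (intro top_coeffsI[of "a \<cdot>\<^sub>v v"]) (use v i vec_submoduleD(4)[OF M] in auto)
qed

text \<open>
  Clear the last nonzero coordinate of an element of \<open>M\<close> by subtracting an element of \<open>N\<close>, and
  repeat.
\<close>

lemma vec_submodule_eqI:
  assumes N: "vec_submodule r N" and M: "vec_submodule r M" and "N \<subseteq> M"
    and top: "\<And>i. i < r \<Longrightarrow> top_coeffs r i M \<subseteq> top_coeffs r i N"
  shows "M = N"
proof -
  have *: "w \<in> N" if "w \<in> M" "k \<le> r" "\<And>c. k \<le> c \<Longrightarrow> c < r \<Longrightarrow> w $ c = 0" for w k
    using that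
  proof (induction k arbitrary: w)
    case 0
    then have "w = 0\<^sub>v r" using vec_submoduleD(1)[OF M] by (intro eq_vecI) auto
    then show ?case using vec_submoduleD(2)[OF N] by simp
  next
    case (Suc k)
    have "w $ k \<in> top_coeffs r k M" by (rule top_coeffsI) (use Suc in auto)
    then have "w $ k \<in> top_coeffs r k N" using top[of k] Suc.prems by auto
    then obtain v where v: "v \<in> N" "\<And>c. k < c \<Longrightarrow> c < r \<Longrightarrow> v $ c = 0" "v $ k = w $ k"
      by (elim top_coeffsE) blast
    have car: "v \<in> carrier_vec r" "w \<in> carrier_vec r"
      using v Suc.prems(1) vec_submoduleD(1)[OF N] vec_submoduleD(1)[OF M] by auto
    have "w - v \<in> N"
    proof (rule Suc.IH)
      show "w - v \<in> M" using vec_submodule_diff[OF M] Suc.prems v \<open>N \<subseteq> M\<close> by auto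
      show "(w - v) $ c = 0" if "k \<le> c" "c < r" for c
        using that car v Suc.prems(3)[of c] by (cases "c = k") auto
    qed (use Suc.prems in simp)
    then have "w - v + v \<in> N" using vec_submoduleD(3)[OF N] v by blast
    moreover have "w - v + v = w" using car by (intro eq_vecI) auto
    ultimately show ?case by simp
  qed
  show ?thesis using *[of _ r] \<open>N \<subseteq> M\<close> by auto
qed

text \<open>
  Lift finite generating sets of all \<open>top_coeffs\<close> to elements of \<open>M\<close>.
\<close>

lemma vec_submodule_finitely_generated:
  fixes M :: "('n::finite, 'k::field) mpoly vec set"
  assumes M: "vec_submodule r M"
  obtains n A where "A \<in> carrier_mat r n" "mat_image A = M"
proof -
  have "\<exists>B. finite B \<and> top_coeffs r i M = ideal_gen B" if "i < r" for i
    using hilbert_basis[OF is_ideal_top_coeffs[OF M that]] by metis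
  then obtain B where B: "\<And>i. i < r \<Longrightarrow> finite (B i)" "\<And>i. i < r \<Longrightarrow> top_coeffs r i M = ideal_gen (B i)"
    by metis
  have "\<exists>v. v \<in> M \<and> (\<forall>c. i < c \<and> c < r \<longrightarrow> v $ c = 0) \<and> v $ i = b" if "i < r" "b \<in> B i" for i b
  proof -
    have "b \<in> top_coeffs r i M" using B(2) that by (simp add: ring_mod.span_base)
    then show ?thesis by (auto elim: top_coeffsE)
  qed
  then obtain p where p: "\<And>i b. i < r \<Longrightarrow> b \<in> B i \<Longrightarrow> p i b \<in> M"
    "\<And>i b c. i < r \<Longrightarrow> b \<in> B i \<Longrightarrow> i < c \<Longrightarrow> c < r \<Longrightarrow> p i b $ c = 0"
    "\<And>i b. i < r \<Longrightarrow> b \<in> B i \<Longrightarrow> p i b $ i = b"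
    by metis
  have fin: "finite (\<Union>i<r. p i ` B i)" using B(1) by auto
  obtain vs where vs: "set vs = (\<Union>i<r. p i ` B i)" using finite_list[OF fin] ..
  define A where "A = mat_of_cols r vs"
  have A: "A \<in> carrier_mat r (length vs)" by (simp add: A_def)
  have vsM: "set vs \<subseteq> M" using p(1) by (auto simp: vs)
  have cols: "col A b = vs ! b" if "b < length vs" for b
    unfolding A_def using that vsM vec_submoduleD(1)[OF M] nth_mem[OF that]
    by (intro col_mat_of_cols) blast+
  note im = vec_submodule_mat_image[OF A]
  have "M = mat_image A"
  proof (rule vec_submodule_eqI[OF im M])
    show "mat_image A \<subseteq> M"
      by (rule mat_image_least[OF M A]) (use cols vsM in auto)
    show "top_coeffs r i M \<subseteq> top_coeffs r i (mat_image A)" if i: "i < r" for i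
      unfolding B(2)[OF i]
    proof (rule ring_mod.span_minimal)
      show "is_ideal (top_coeffs r i (mat_image A))" by (rule is_ideal_top_coeffs[OF im i])
      show "B i \<subseteq> top_coeffs r i (mat_image A)"
      proof
        fix b assume b: "b \<in> B i"
        then have "p i b \<in> set vs" using i by (auto simp: vs)
        then obtain j where "j < length vs" "vs ! j = p i b" by (auto simp: in_set_conv_nth)
        then have "p i b \<in> mat_image A" using col_in_mat_image[OF A, of j] cols[of j] by simp
        then show "b \<in> top_coeffs r i (mat_image A)"
          by (rule top_coeffsI) (use p i b in auto)
      qed
    qed
  qed
  then show ?thesis using that A by blast
qed

section \<open>Minimal graded free resolutions\<close>

text \<open>
  The component of degree \<open>j\<close> in the free module whose basis elements have the degrees \<open>ds\<close>.
\<close>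

definition vcomp :: "int list \<Rightarrow> int \<Rightarrow> ('n::finite, 'k::field) mpoly vec \<Rightarrow> ('n, 'k) mpoly vec" where
  "vcomp ds j w = vec (length ds) (\<lambda>c. hcomp (j - ds ! c) (w $ c))"

lemma vcomp_carrier [simp]: "vcomp ds j w \<in> carrier_vec (length ds)"
  by (simp add: vcomp_def)

lemma index_vcomp: "c < length ds \<Longrightarrow> vcomp ds j w $ c = hcomp (j - ds ! c) (w $ c)"
  by (simp add: vcomp_def)

lemma vcomp_mult:
  assumes A: "graded_map ds es A" and w: "w \<in> carrier_vec (length es)"
  shows "A *\<^sub>v vcomp es j w = vcomp ds j (A *\<^sub>v w)"
proof -
  have car: "A \<in> carrier_mat (length ds) (length es)" using A by (simp add: graded_map_def)
  show ?thesis
  proof (rule eq_vecI)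
    fix a assume "a < dim_vec (vcomp ds j (A *\<^sub>v w))"
    then have a: "a < length ds" by (simp add: vcomp_def)
    have "(A *\<^sub>v vcomp es j w) $ a = (\<Sum>b<length es. A $$ (a, b) * hcomp (j - es ! b) (w $ b))"
      unfolding index_mult_mat_vec_sum[OF car vcomp_carrier a] by (simp add: index_vcomp)
    also have "\<dots> = (\<Sum>b<length es. hcomp (j - ds ! a) (A $$ (a, b) * (w $ b)))"
    proof (rule sum.cong[OF refl])
      fix b assume "b \<in> {..<length es}"
      then have "A $$ (a, b) \<in> graded_part (es ! b - ds ! a)" using A a by (simp add: graded_map_def)
      from hcomp_mult[OF this, of "j - es ! b"]
      show "A $$ (a, b) * hcomp (j - es ! b) (w $ b) = hcomp (j - ds ! a) (A $$ (a, b) * (w $ b))"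
        by simp
    qed
    also have "\<dots> = vcomp ds j (A *\<^sub>v w) $ a"
      unfolding index_vcomp[OF a] index_mult_mat_vec_sum[OF car w a] hcomp_sum ..
    finally show "(A *\<^sub>v vcomp es j w) $ a = vcomp ds j (A *\<^sub>v w) $ a" .
  qed (use car in \<open>simp add: vcomp_def\<close>)
qed

lemma graded_map_carrier: "graded_map ds es A \<Longrightarrow> A \<in> carrier_mat (length ds) (length es)"
  by (simp add: graded_map_def)

lemma graded_map_iff_cols:
  "graded_map ds es A \<longleftrightarrow> A \<in> carrier_mat (length ds) (length es) \<and>
     (\<forall>b<length es. vcomp ds (es ! b) (col A b) = col A b)"
proof -
  have "(\<forall>a<length ds. A $$ (a, b) \<in> graded_part (es ! b - ds ! a)) \<longleftrightarrow>
      vcomp ds (es ! b) (col A b) = col A b"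
    if "A \<in> carrier_mat (length ds) (length es)" "b < length es" for b
    using that by (auto simp: vec_eq_iff index_vcomp graded_part_iff vcomp_def)
  then show ?thesis unfolding graded_map_def by blast
qed

lemma graded_map_mult:
  assumes A: "graded_map ds es A" and B: "graded_map es fs B"
  shows "graded_map ds fs (A * B)"
proof -
  note car = graded_map_carrier[OF A] graded_map_carrier[OF B]
  have "vcomp ds (fs ! b) (col (A * B) b) = col (A * B) b" if b: "b < length fs" for b
  proof -
    have c: "col (A * B) b = A *\<^sub>v col B b" using car b by (metis col_mult2)
    have cb: "col B b \<in> carrier_vec (length es)" using car b by auto
    have "vcomp es (fs ! b) (col B b) = col B b" using B b by (simp add: graded_map_iff_cols)
    then show ?thesis unfolding c using vcomp_mult[OF A cb, of "fs ! b"] by simp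
  qed
  then show ?thesis using car by (simp add: graded_map_iff_cols)
qed

text \<open>
  Graded free modules are projective: preimages of the columns exist, and their homogeneous
  components of the right degree are preimages as well.
\<close>

lemma graded_map_lift:
  assumes A: "graded_map ds es A" and B: "graded_map ds fs B"
    and im: "mat_image A \<subseteq> mat_image B"
  obtains C where "graded_map fs es C" "A = B * C"
proof -
  note carA = graded_map_carrier[OF A] and carB = graded_map_carrier[OF B]
  have "\<exists>w. w \<in> carrier_vec (length fs) \<and> B *\<^sub>v w = col A b \<and> vcomp fs (es ! b) w = w"
    if b: "b < length es" for b
  proof -
    have "col A b \<in> mat_image B" using im col_in_mat_image[OF carA b] by blast
    then obtain w where w: "col A b = B *\<^sub>v w" "w \<in> carrier_vec (length fs)"
      using carB by (auto simp: mat_image_def)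
    let ?w = "vcomp fs (es ! b) w"
    have "vcomp ds (es ! b) (col A b) = col A b" using A b by (simp add: graded_map_iff_cols)
    then have "B *\<^sub>v ?w = col A b"
      using vcomp_mult[OF B w(2), of "es ! b"] by (simp add: w(1))
    moreover have "vcomp fs (es ! b) ?w = ?w"
      using hcomp_in_graded_part by (auto simp: vcomp_def vec_eq_iff graded_part_iff)
    ultimately show ?thesis by (metis vcomp_carrier)
  qed
  then obtain w where w: "\<And>b. b < length es \<Longrightarrow> w b \<in> carrier_vec (length fs)"
    "\<And>b. b < length es \<Longrightarrow> B *\<^sub>v w b = col A b"
    "\<And>b. b < length es \<Longrightarrow> vcomp fs (es ! b) (w b) = w b" by metis
  define C where "C = mat_of_cols (length fs) (map w [0..<length es])"
  have C: "C \<in> carrier_mat (length fs) (length es)"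
    unfolding C_def by (rule carrier_matI) auto
  have col: "col C b = w b" if "b < length es" for b
    using w(1)[OF that] that by (simp add: C_def)
  have "graded_map fs es C" using C col w(3) by (simp add: graded_map_iff_cols)
  moreover have "A = B * C"
  proof (rule mat_col_eqI)
    fix b assume "b < dim_col (B * C)"
    then have b: "b < length es" using C by simp
    then have "col (B * C) b = B *\<^sub>v col C b" using carB C by (metis col_mult2)
    then show "col A b = col (B * C) b" using b col w(2) by simp
  qed (use carA carB C in auto)
  ultimately show ?thesis using that by blast
qed

definition graded_submodule :: "int list \<Rightarrow> ('n::finite, 'k::field) mpoly vec set \<Rightarrow> bool" where
  "graded_submodule ds M \<longleftrightarrow> vec_submodule (length ds) M \<and> (\<forall>w\<in>M. \<forall>j. vcomp ds j w \<in> M)"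

lemma graded_submodule_mat_kernel:
  assumes A: "graded_map ds es A"
  shows "graded_submodule es (mat_kernel A)"
proof -
  note car = graded_map_carrier[OF A]
  have "vcomp es j w \<in> mat_kernel A" if "w \<in> mat_kernel A" for w j
  proof -
    have "A *\<^sub>v w = 0\<^sub>v (length ds)" "w \<in> carrier_vec (length es)"
      using that by (auto simp: mat_kernel[OF car])
    moreover have "vcomp ds j (0\<^sub>v (length ds)) = 0\<^sub>v (length ds)"
      by (intro eq_vecI) (auto simp: vcomp_def)
    ultimately show ?thesis using vcomp_mult[OF A, of w j] by (simp add: mat_kernel[OF car])
  qed
  then show ?thesis
    using vec_submodule_mat_kernel[OF car] by (simp add: graded_submodule_def)
qed

text \<open>
  The set \<open>D\<close> collects all degrees that occur in \<open>w\<close>, so that \<open>w\<close> is the sum of finitely many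
  components.
\<close>

lemma vec_in_submodule_if_components:
  assumes N: "vec_submodule (length ds) N" and w: "w \<in> carrier_vec (length ds)"
    and D: "finite D" "\<And>c m. c < length ds \<Longrightarrow> m \<in> keys (w $ c) \<Longrightarrow> int (mdeg m) + ds ! c \<in> D"
    and comp: "\<And>j. j \<in> D \<Longrightarrow> vcomp ds j w \<in> N"
  shows "w \<in> N"
proof -
  have "vec (length ds) (\<lambda>c. \<Sum>j\<in>E. hcomp (j - ds ! c) (w $ c)) \<in> N" if "E \<subseteq> D" "finite E" for E
    using that(2,1)
  proof (induction E)
    case empty
    have "vec (length ds) (\<lambda>c. \<Sum>j\<in>{}. hcomp (j - ds ! c) (w $ c)) = 0\<^sub>v (length ds)" by auto
    then show ?case using vec_submoduleD(2)[OF N] by simp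
  next
    case (insert e E)
    have "vec (length ds) (\<lambda>c. \<Sum>j\<in>insert e E. hcomp (j - ds ! c) (w $ c)) =
        vcomp ds e w + vec (length ds) (\<lambda>c. \<Sum>j\<in>E. hcomp (j - ds ! c) (w $ c))"
      using insert.hyps by (intro eq_vecI) (auto simp: vcomp_def)
    then show ?case using insert comp[of e] vec_submoduleD(3)[OF N] by auto
  qed
  from this[OF subset_refl D(1)]
  have "vec (length ds) (\<lambda>c. \<Sum>j\<in>D. hcomp (j - ds ! c) (w $ c)) \<in> N" .
  moreover have "vec (length ds) (\<lambda>c. \<Sum>j\<in>D. hcomp (j - ds ! c) (w $ c)) = w"
  proof (rule eq_vecI)
    fix c assume "c < dim_vec w"
    then have c: "c < length ds" using w by simp
    have "(\<Sum>j\<in>D. hcomp (j - ds ! c) (w $ c)) = w $ c"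
    proof (rule poly_mapping_eqI)
      fix m
      have "lookup (\<Sum>j\<in>D. hcomp (j - ds ! c) (w $ c)) m =
          (\<Sum>j\<in>D. if j = int (mdeg m) + ds ! c then lookup (w $ c) m else 0)"
        unfolding lookup_sum by (rule sum.cong) (auto simp: lookup_hcomp)
      also have "\<dots> = lookup (w $ c) m"
        using D(1) D(2)[OF c, of m] by (auto simp: in_keys_iff)
      finally show "lookup (\<Sum>j\<in>D. hcomp (j - ds ! c) (w $ c)) m = lookup (w $ c) m" .
    qed
    then show "vec (length ds) (\<lambda>c. \<Sum>j\<in>D. hcomp (j - ds ! c) (w $ c)) $ c = w $ c"
      using c by simp
  qed (use w in simp)
  ultimately show ?thesis by simp
qed

lemma graded_submodule_generators:
  fixes M :: "('n::finite, 'k::field) mpoly vec set"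
  assumes M: "graded_submodule ds M"
  obtains es A where "graded_map ds es A" "mat_image A = M"
proof -
  have Mv: "vec_submodule (length ds) M" using M by (simp add: graded_submodule_def)
  obtain n A where A: "A \<in> carrier_mat (length ds) n" "mat_image A = M"
    by (rule vec_submodule_finitely_generated[OF Mv])
  define D where "D = (\<Union>b<n. \<Union>c<length ds. (\<lambda>m. int (mdeg m) + ds ! c) ` keys (A $$ (c, b)))"
  have finD: "finite D" by (simp add: D_def)
  define ps where "ps = List.product [0..<n] (sorted_list_of_set D)"
  have ps: "set ps = {..<n} \<times> D" using finD by (auto simp: ps_def)
  let ?v = "\<lambda>(b, j). vcomp ds j (col A b)"
  define B where "B = mat_of_cols (length ds) (map ?v ps)"
  have B: "B \<in> carrier_mat (length ds) (length (map snd ps))"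
    unfolding B_def by (rule carrier_matI) auto
  have colB: "col B i = ?v (ps ! i)" if "i < length ps" for i
    using that by (simp add: B_def split: prod.split)
  have "vcomp ds (map snd ps ! i) (col B i) = col B i" if "i < length ps" for i
    using that colB[OF that] hcomp_in_graded_part
    by (auto simp: vcomp_def vec_eq_iff graded_part_iff split: prod.splits)
  then have "graded_map ds (map snd ps) B" using B by (simp add: graded_map_iff_cols)
  moreover have "mat_image B = M"
  proof
    show "mat_image B \<subseteq> M"
    proof (rule mat_image_least[OF Mv B])
      fix i assume i: "i < length (map snd ps)"
      obtain b j where bj: "ps ! i = (b, j)" by force
      then have "b < n" using ps i nth_mem[of i ps] by auto
      then have "col A b \<in> M" using col_in_mat_image[OF A(1)] A(2) by auto
      then show "col B i \<in> M" using colB[of i] i bj M by (simp add: graded_submodule_def)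
    qed
    note imB = vec_submodule_mat_image[OF B]
    have "mat_image A \<subseteq> mat_image B"
    proof (rule mat_image_least[OF imB A(1)])
      fix b assume b: "b < n"
      show "col A b \<in> mat_image B"
      proof (rule vec_in_submodule_if_components[OF imB _ finD])
        show "col A b \<in> carrier_vec (length ds)" using A(1) by (intro carrier_vecI) simp
        show "int (mdeg m) + ds ! c \<in> D" if "c < length ds" "m \<in> keys (col A b $ c)" for c m
          using that b A(1) by (auto simp: D_def)
        fix j assume "j \<in> D"
        then have "(b, j) \<in> set ps" using b by (simp add: ps)
        then obtain i where i: "i < length ps" "ps ! i = (b, j)" by (auto simp: in_set_conv_nth)
        then have "col B i = vcomp ds j (col A b)" using colB[of i] by simp
        then show "vcomp ds j (col A b) \<in> mat_image B"
          using col_in_mat_image[OF B, of i] i by simp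
      qed
    qed
    then show "M \<subseteq> mat_image B" using A(2) by simp
  qed
  ultimately show ?thesis using that by blast
qed

text \<open>
  Take a list of homogeneous generators of least length. If a relation had a coefficient with a
  constant term, its component in the degree of that generator would have a unit as coefficient, and
  the generator could be dropped.
\<close>

lemma graded_submodule_minimal_generators:
  fixes M :: "('n::finite, 'k::field) mpoly vec set"
  assumes M: "graded_submodule ds M"
  obtains es A where "graded_map ds es A" "mat_image A = M"
    "\<And>w c. w \<in> mat_kernel A \<Longrightarrow> c < length es \<Longrightarrow> w $ c \<in> irrelevant_ideal"
proof -
  have Mv: "vec_submodule (length ds) M" using M by (simp add: graded_submodule_def)
  define P where "P n \<longleftrightarrow> (\<exists>es A. graded_map ds es A \<and> mat_image A = M \<and> length es = n)" for n
  have "\<exists>n. P n" using graded_submodule_generators[OF M] unfolding P_def by metis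
  then have "P (LEAST n. P n)" by (rule LeastI_ex)
  then obtain es A where A: "graded_map ds es A" "mat_image A = M" "length es = (LEAST n. P n)"
    unfolding P_def by blast
  note car = graded_map_carrier[OF A(1)]
  have "w $ c \<in> irrelevant_ideal" if w: "w \<in> mat_kernel A" and c: "c < length es" for w c
  proof (rule ccontr)
    assume "\<not> ?thesis"
    then have k0: "lookup (w $ c) 0 \<noteq> 0" by (simp add: irrelevant_ideal_iff)
    define v where "v = vcomp es (es ! c) w"
    have v: "v \<in> mat_kernel A"
      using graded_submodule_mat_kernel[OF A(1)] w by (simp add: v_def graded_submodule_def)
    then have v': "v \<in> carrier_vec (length es)" "A *\<^sub>v v = 0\<^sub>v (length ds)"
      by (auto simp: mat_kernel[OF car])
    let ?k = "Poly_Mapping.single 0 (lookup (w $ c) 0)"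
    have vc: "v $ c = ?k"
      using c by (intro poly_mapping_eqI)
        (auto simp: v_def index_vcomp lookup_hcomp lookup_single when_def mdeg_eq_0_iff)
    \<comment> \<open>A relation with an invertible coefficient makes a generator redundant.\<close>
    define bs where "bs = [b\<leftarrow>[0..<length es]. b \<noteq> c]"
    have bs: "set bs = {..<length es} - {c}" by (auto simp: bs_def)
    have len: "length bs = length es - 1"
    proof -
      have "distinct bs" by (simp add: bs_def)
      then have "length bs = card (set bs)" by (simp add: distinct_card)
      then show ?thesis using c bs by simp
    qed
    define B where "B = mat_of_cols (length ds) (map (col A) bs)"
    define fs where "fs = map ((!) es) bs"
    have B: "B \<in> carrier_mat (length ds) (length fs)"
      unfolding B_def fs_def by (rule carrier_matI) auto
    have bsn: "bs ! i < length es" if "i < length bs" for i using nth_mem[OF that] bs by auto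
    have colB: "col B i = col A (bs ! i)" if "i < length bs" for i
      using that bsn[OF that] car by (simp add: B_def)
    have "graded_map ds fs B"
      using A(1) B bsn by (auto simp: graded_map_iff_cols colB fs_def)
    moreover have "mat_image B = M"
    proof
      show "mat_image B \<subseteq> M"
        by (rule mat_image_least[OF Mv B])
          (use bsn col_in_mat_image[OF car] A(2) in \<open>auto simp: colB fs_def\<close>)
      note imB = vec_submodule_mat_image[OF B]
      have other: "col A b \<in> mat_image B" if "b < length es" "b \<noteq> c" for b
      proof -
        have "b \<in> set bs" using that bs by simp
        then obtain i where "i < length bs" "bs ! i = b" by (auto simp: in_set_conv_nth)
        then show ?thesis using col_in_mat_image[OF B, of i] colB[of i] by (simp add: fs_def)
      qed
      define u where "u = v - v $ c \<cdot>\<^sub>v unit_vec (length es) c"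
      have u: "u \<in> carrier_vec (length es)" "u $ c = 0"
        using v' c by (auto simp: u_def)
      have Au: "A *\<^sub>v u \<in> mat_image B"
        by (rule mult_mat_vec_supported[OF imB car u(1)]) (use u(2) other in metis)
      have "col A c \<in> mat_image B"
      proof -
        let ?k' = "Poly_Mapping.single 0 (- (1 / lookup (w $ c) 0)) :: ('n, 'k) mpoly"
        have unit: "A *\<^sub>v unit_vec (length es) c = col A c"
          using car c by (intro eq_vecI) (auto simp: row_def)
        have "A *\<^sub>v u = 0\<^sub>v (length ds) - ?k \<cdot>\<^sub>v col A c"
          unfolding u_def vc using car v' c
          by (simp add: mult_minus_distrib_mat_vec[OF car] mult_mat_vec_smult[OF car] unit)
        moreover have "col A c \<in> carrier_vec (length ds)" using car by (intro carrier_vecI) simp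
        ultimately have "?k' \<cdot>\<^sub>v (A *\<^sub>v u) = col A c"
          using k0 by (intro eq_vecI) (auto simp: mult_single single_uminus simp flip: mult.assoc)
        then show ?thesis using vec_submoduleD(4)[OF imB Au, of ?k'] by simp
      qed
      then have "mat_image A \<subseteq> mat_image B"
        by (intro mat_image_least[OF imB car]) (metis other)
      then show "M \<subseteq> mat_image B" using A(2) by simp
    qed
    ultimately have "P (length fs)" unfolding P_def by blast
    then have "(LEAST n. P n) \<le> length fs" by (rule Least_le)
    then show False using A(3) c len by (simp add: fs_def)
  qed
  then show ?thesis using that A by blast
qed

text \<open>
  Cover the ideal by minimal generators, then the kernel of this map, and so on.
\<close>

theorem minimal_graded_free_resolution_exists:
  fixes I :: "('n::finite, 'k::field) mpoly set"
  assumes I: "is_ideal I" "\<And>f j. f \<in> I \<Longrightarrow> hcomp j f \<in> I"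
  shows "\<exists>d \<phi>. minimal_graded_free_resolution I d \<phi>"
proof -
  let ?M = "{vec 1 (\<lambda>_. f) | f. f \<in> I}"
  have M: "graded_submodule [0] ?M"
    unfolding graded_submodule_def vec_submodule_def
  proof (safe)
    show "\<exists>f. 0\<^sub>v (length [0]) = vec 1 (\<lambda>_. f) \<and> f \<in> I"
      using ring_mod.subspace_0[OF I(1)] by (intro exI[of _ 0]) auto
  next
    fix f g assume "f \<in> I" "g \<in> I"
    then show "\<exists>h. vec 1 (\<lambda>_. f) + vec 1 (\<lambda>_. g) = vec 1 (\<lambda>_. h) \<and> h \<in> I"
      using ring_mod.subspace_add[OF I(1)] by (intro exI[of _ "f + g"]) auto
  next
    fix c f assume "f \<in> I"
    then show "\<exists>h. c \<cdot>\<^sub>v vec 1 (\<lambda>_. f) = vec 1 (\<lambda>_. h) \<and> h \<in> I"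
      using ring_mod.subspace_scale[OF I(1)] by (intro exI[of _ "c * f"]) auto
  next
    fix f j assume "f \<in> I"
    then show "\<exists>h. vcomp [0] j (vec 1 (\<lambda>_. f)) = vec 1 (\<lambda>_. h) \<and> h \<in> I"
      using I(2) by (intro exI[of _ "hcomp j f"]) (auto simp: vcomp_def)
  qed auto
  define Q where "Q = (\<lambda>(ds, es, A :: ('n, 'k) mpoly mat). graded_map ds es A \<and>
    (\<forall>w\<in>mat_kernel A. \<forall>c<length es. w $ c \<in> irrelevant_ideal))"
  define R where "R = (\<lambda>(ds :: int list, es :: int list, A :: ('n, 'k) mpoly mat)
    (es' :: int list, fs :: int list, B :: ('n, 'k) mpoly mat). es' = es \<and> mat_image B = mat_kernel A)"
  obtain d0 A0 where "graded_map [0] d0 A0" "mat_image A0 = ?M"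
    "\<And>w c. w \<in> mat_kernel A0 \<Longrightarrow> c < length d0 \<Longrightarrow> w $ c \<in> irrelevant_ideal"
    by (rule graded_submodule_minimal_generators[OF M]) blast
  then have 0: "Q ([0], d0, A0)" "mat_image A0 = ?M" by (simp_all add: Q_def)
  have "\<exists>f. \<forall>n::nat. (Q (f n) \<and> (n = 0 \<longrightarrow> f n = ([0], d0, A0))) \<and> R (f n) (f (Suc n))"
  proof (rule dependent_nat_choice)
    show "\<exists>s. Q s \<and> (0 = (0 :: nat) \<longrightarrow> s = ([0], d0, A0))" using 0 by blast
  next
    fix s and n :: nat assume s: "Q s \<and> (n = 0 \<longrightarrow> s = ([0], d0, A0))"
    obtain ds es A where sd: "s = (ds, es, A)" by (cases s)
    have "graded_submodule es (mat_kernel A)"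
      by (rule graded_submodule_mat_kernel[of ds]) (use s in \<open>simp add: sd Q_def\<close>)
    then obtain fs B where "graded_map es fs B" "mat_image B = mat_kernel A"
      "\<And>w c. w \<in> mat_kernel B \<Longrightarrow> c < length fs \<Longrightarrow> w $ c \<in> irrelevant_ideal"
      by (rule graded_submodule_minimal_generators) blast
    then have "Q (es, fs, B) \<and> R s (es, fs, B)" by (simp add: Q_def R_def sd)
    then show "\<exists>s'. (Q s' \<and> (Suc n = 0 \<longrightarrow> s' = ([0], d0, A0))) \<and> R s s'" by blast
  qed
  then obtain f where f: "\<And>n. Q (f n)" "f 0 = ([0], d0, A0)" "\<And>n. R (f n) (f (Suc n))"
    by blast
  define d where "d n = fst (snd (f n))" for n
  define \<phi> where "\<phi> n = snd (snd (f n))" for n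
  have fst: "fst (f (Suc n)) = d n" for n using f(3)[of n] by (auto simp: R_def d_def split: prod.splits)
  have ker: "mat_image (\<phi> (Suc n)) = mat_kernel (\<phi> n)" for n
    using f(3)[of n] by (auto simp: R_def \<phi>_def split: prod.splits)
  have gr: "graded_map (fst (f n)) (d n) (\<phi> n)" for n
    using f(1)[of n] by (auto simp: Q_def d_def \<phi>_def split: prod.splits)
  have irr: "w $ c \<in> irrelevant_ideal" if "w \<in> mat_kernel (\<phi> n)" "c < length (d n)" for w c n
    using f(1)[of n] that by (auto simp: Q_def d_def \<phi>_def split: prod.splits)
  have gS: "graded_map (d n) (d (Suc n)) (\<phi> (Suc n))" for n using gr[of "Suc n"] by (simp add: fst)
  have "\<phi> (Suc n) $$ (a, b) \<in> irrelevant_ideal" if "a < length (d n)" "b < length (d (Suc n))" for n a b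
  proof -
    have "col (\<phi> (Suc n)) b \<in> mat_kernel (\<phi> n)"
      using col_in_mat_image[OF graded_map_carrier[OF gS] that(2)] ker by simp
    then have "col (\<phi> (Suc n)) b $ a \<in> irrelevant_ideal" using irr that(1) by blast
    then show ?thesis using that graded_map_carrier[OF gS, of n] by simp
  qed
  moreover have "graded_map [0] (d 0) (\<phi> 0)" "mat_image (\<phi> 0) = ?M"
    using gr[of 0] 0(2) f(2) by (auto simp: d_def \<phi>_def)
  ultimately have "minimal_graded_free_resolution I d \<phi>"
    unfolding minimal_graded_free_resolution_def graded_free_resolution_def using gS ker by auto
  then show ?thesis by blast
qed

section \<open>Linear quotients\<close>

text \<open>
  The elements of the kernel of \<open>A\<close> whose last nonzero coordinate is the \<open>i\<close>-th one are the
  expressions of multiples of column \<open>i\<close> through the earlier columns. Their \<open>i\<close>-th coordinates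
  therefore form the colon ideal of the earlier columns by column \<open>i\<close>. Stated in this way for
  columns in a free module, and not just for generators of an ideal, the property passes to syzygies.
\<close>

definition linear_quotients ::
    "int list \<Rightarrow> int \<Rightarrow> nat \<Rightarrow> ('n::finite, 'k::field) mpoly mat \<Rightarrow> (nat \<Rightarrow> 'n set) \<Rightarrow> bool" where
  "linear_quotients ds e N A V \<longleftrightarrow> graded_map ds (replicate N e) A \<and>
     (\<forall>i<N. top_coeffs N i (mat_kernel A) = ideal_gen (Var ` V i))"

lemma Var_in_ideal_gen_Var:
  "(Var a :: ('n::finite, 'k::field) mpoly) \<in> ideal_gen (Var ` V) \<longleftrightarrow> a \<in> V"
  unfolding ideal_gen_Var by (auto simp: Var_eq lookup_single when_def split: if_splits)

lemma Var_in_graded_part: "(Var a :: ('n::finite, 'k::field) mpoly) \<in> graded_part 1"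
  by (auto simp: graded_part_def Var_eq split: if_splits)

text \<open>
  For every column \<open>i\<close> and every variable \<open>a \<in> V i\<close> there is a linear relation \<open>s i a\<close> with last
  coordinate \<open>a\<close>. These relations generate the kernel. Ordered by \<open>i\<close> they have linear quotients
  again: if a multiple \<open>g * s i a\<close> is a combination of earlier relations, then coordinate \<open>i\<close> shows
  that \<open>g * a\<close> lies in the prime ideal of the earlier variables for \<open>i\<close>, hence so does \<open>g\<close>;
  conversely \<open>a' * s i a - a * s i a'\<close> has a smaller last coordinate and so is a combination of
  the relations of earlier columns.
\<close>

lemma linear_quotients_kernel:
  fixes A :: "('n::finite, 'k::field) mpoly mat"
  assumes "linear_quotients ds e N A V"
  obtains N' C V' where "linear_quotients (replicate N e) (e + 1) N' C V'" "mat_image C = mat_kernel A"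
proof -
  let ?es = "replicate N e"
  have A: "graded_map ds ?es A"
    and top: "\<And>i. i < N \<Longrightarrow> top_coeffs N i (mat_kernel A) = ideal_gen (Var ` V i)"
    using assms by (auto simp: linear_quotients_def)
  define K where "K = mat_kernel A"
  have K: "graded_submodule ?es K" unfolding K_def by (rule graded_submodule_mat_kernel[OF A])
  then have Kv: "vec_submodule N K" by (simp add: graded_submodule_def)
  define S where "S i a s \<longleftrightarrow> s \<in> K \<and> (\<forall>c. i < c \<and> c < N \<longrightarrow> s $ c = 0) \<and> s $ i = Var a \<and>
    vcomp ?es (e + 1) s = s" for i a s
  have "\<exists>s. S i a s" if i: "i < N" and a: "a \<in> V i" for i a
  proof -
    have "Var a \<in> top_coeffs N i K" using top[OF i] a by (simp add: K_def Var_in_ideal_gen_Var)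
    then obtain s where s: "s \<in> K" "\<And>c. i < c \<Longrightarrow> c < N \<Longrightarrow> s $ c = 0" "s $ i = Var a"
      by (elim top_coeffsE) blast
    let ?s = "vcomp ?es (e + 1) s"
    have "?s \<in> K" using K s(1) by (simp add: graded_submodule_def)
    moreover have "?s $ i = Var a"
      using i s(3) Var_in_graded_part[of a] by (simp add: index_vcomp graded_part_iff)
    moreover have "vcomp ?es (e + 1) ?s = ?s"
      using hcomp_in_graded_part by (auto simp: vcomp_def vec_eq_iff graded_part_iff)
    moreover have "\<forall>c. i < c \<and> c < N \<longrightarrow> ?s $ c = 0" using s(2) by (simp add: index_vcomp)
    ultimately show ?thesis unfolding S_def by blast
  qed
  then obtain s where "\<And>i a. i < N \<Longrightarrow> a \<in> V i \<Longrightarrow> S i a (s i a)" by metis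
  then have s: "\<And>i a. i < N \<Longrightarrow> a \<in> V i \<Longrightarrow> s i a \<in> K"
    "\<And>i a c. i < N \<Longrightarrow> a \<in> V i \<Longrightarrow> i < c \<Longrightarrow> c < N \<Longrightarrow> s i a $ c = 0"
    "\<And>i a. i < N \<Longrightarrow> a \<in> V i \<Longrightarrow> s i a $ i = Var a"
    "\<And>i a. i < N \<Longrightarrow> a \<in> V i \<Longrightarrow> vcomp ?es (e + 1) (s i a) = s i a"
    unfolding S_def by blast+
  have "finite (Sigma {..<N} V)" by (auto intro: finite_subset[OF subset_UNIV])
  then obtain ps0 where ps0: "set ps0 = Sigma {..<N} V" "distinct ps0"
    using finite_distinct_list by blast
  define ps where "ps = sort_key fst ps0"
  have set_ps: "set ps = Sigma {..<N} V" and dist: "distinct ps"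
    and sorted: "sorted (map fst ps)" using ps0 by (simp_all add: ps_def)
  define N' where "N' = length ps"
  define gen where "gen p = fst (ps ! p)" for p
  define var where "var p = snd (ps ! p)" for p
  have rv: "gen p < N" "var p \<in> V (gen p)" if "p < N'" for p
  proof -
    have "ps ! p \<in> set ps" using that by (simp add: N'_def)
    then show "gen p < N" "var p \<in> V (gen p)" unfolding set_ps gen_def var_def by auto
  qed
  have mono: "gen p \<le> gen q" if "p \<le> q" "q < N'" for p q
    using sorted_nth_mono[OF sorted that(1)] that by (simp add: N'_def gen_def)
  have inj: "p = q" if "gen p = gen q" "var p = var q" "p < N'" "q < N'" for p q
    using that dist by (auto simp: gen_def var_def N'_def distinct_conv_nth prod_eq_iff)
  have ex: "\<exists>p<N'. gen p = i \<and> var p = a" if "i < N" "a \<in> V i" for i a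
  proof -
    have "(i, a) \<in> set ps" using that set_ps by auto
    then show ?thesis by (auto simp: in_set_conv_nth N'_def gen_def var_def)
  qed
  define C where "C = mat_of_cols N (map (\<lambda>p. s (gen p) (var p)) [0..<N'])"
  have C: "C \<in> carrier_mat N N'" unfolding C_def by (rule carrier_matI) auto
  have colC: "col C p = s (gen p) (var p)" if "p < N'" for p
    using that s(1)[OF rv[OF that]] vec_submoduleD(1)[OF Kv] by (simp add: C_def)
  have C_entry: "C $$ (c, p) = s (gen p) (var p) $ c" if "c < N" "p < N'" for c p
    using that by (simp add: C_def mat_of_cols_index)
  have Cg: "graded_map ?es (replicate N' (e + 1)) C"
    using C s(4) rv colC by (simp add: graded_map_iff_cols)
  have imC: "mat_image C \<subseteq> K" by (rule mat_image_least[OF Kv C]) (simp add: colC s(1) rv)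
  \<comment> \<open>Relations among the first \<open>i\<close> generators only need the syzygies of these generators.\<close>
  have lower: "\<exists>y\<in>carrier_vec N'. (\<forall>p<N'. i \<le> gen p \<longrightarrow> y $ p = 0) \<and> x = C *\<^sub>v y"
    if x: "x \<in> K" "\<And>c. i \<le> c \<Longrightarrow> c < N \<Longrightarrow> x $ c = 0" for x i
  proof -
    define Z :: "('n, 'k) mpoly vec set"
      where "Z = {y \<in> carrier_vec N'. \<forall>p<N'. i \<le> gen p \<longrightarrow> y $ p = 0}"
    define M where "M = {x \<in> K. \<forall>c. i \<le> c \<and> c < N \<longrightarrow> x $ c = 0}"
    have Zv: "vec_submodule N' Z" by (auto simp: vec_submodule_def Z_def)
    have Mv: "vec_submodule N M"
      using Kv vec_submoduleD(1)[OF Kv] by (fastforce simp: vec_submodule_def M_def)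
    note imv = vec_submodule_image[OF C Zv]
    have "M = (*\<^sub>v) C ` Z"
    proof (rule vec_submodule_eqI[OF imv Mv])
      show "(*\<^sub>v) C ` Z \<subseteq> M"
      proof
        fix x assume "x \<in> (*\<^sub>v) C ` Z"
        then obtain y where y: "x = C *\<^sub>v y" "y \<in> Z" by blast
        then have yc: "y \<in> carrier_vec N'" by (simp add: Z_def)
        have "x \<in> K" using imC y yc C by (auto simp: mat_image_def)
        moreover have "x $ c = 0" if c: "i \<le> c" "c < N" for c
          unfolding y(1) index_mult_mat_vec_sum[OF C yc c(2)]
        proof (rule sum.neutral, safe)
          fix p assume p: "p < N'"
          show "C $$ (c, p) * y $ p = 0"
          proof (cases "i \<le> gen p")
            case True
            then show ?thesis using y p by (simp add: Z_def)
          next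
            case False
            then show ?thesis using C_entry[OF c(2) p] s(2)[OF rv[OF p], of c] c by simp
          qed
        qed
        ultimately show "x \<in> M" by (simp add: M_def)
      qed
      fix j assume j: "j < N"
      have id: "is_ideal (top_coeffs N j ((*\<^sub>v) C ` Z))" by (rule is_ideal_top_coeffs[OF imv j])
      show "top_coeffs N j M \<subseteq> top_coeffs N j ((*\<^sub>v) C ` Z)"
      proof (cases "i \<le> j")
        case True
        then have "top_coeffs N j M \<subseteq> {0}" using j by (auto simp: M_def elim!: top_coeffsE)
        then show ?thesis using ring_mod.subspace_0[OF id] by blast
      next
        case False
        have "top_coeffs N j M \<subseteq> ideal_gen (Var ` V j)"
          unfolding top[OF j, symmetric] by (auto simp: top_coeffs_def M_def K_def)
        also have "\<dots> \<subseteq> top_coeffs N j ((*\<^sub>v) C ` Z)"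
        proof (rule ring_mod.span_minimal[OF _ id], safe)
          fix a assume a: "a \<in> V j"
          obtain p where p: "p < N'" "gen p = j" "var p = a" using ex[OF j a] by blast
          have "C *\<^sub>v unit_vec N' p = s j a"
            using p colC[OF p(1)] mult_mat_vec_unit[OF C p(1)] by simp
          moreover have "unit_vec N' p \<in> Z" using p False by (auto simp: Z_def)
          ultimately have "s j a \<in> (*\<^sub>v) C ` Z" by (metis imageI)
          then show "Var a \<in> top_coeffs N j ((*\<^sub>v) C ` Z)"
            by (rule top_coeffsI) (use s j a in auto)
        qed
        finally show ?thesis .
      qed
    qed
    moreover have "x \<in> M" using x by (simp add: M_def)
    ultimately show ?thesis by (auto simp: Z_def)
  qed
  have image: "mat_image C = K"
  proof
    show "K \<subseteq> mat_image C"
    proof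
      fix x assume "x \<in> K"
      from lower[of x N, OF this] show "x \<in> mat_image C" using C by (auto simp: mat_image_def)
    qed
  qed (rule imC)
  define V' where "V' q = {a. \<exists>p<q. gen p = gen q \<and> var p = a}" for q
  have V'_notin: "var q \<notin> V' q" if "q < N'" for q
    using inj that by (fastforce simp: V'_def)
  note kerC = vec_submodule_mat_kernel[OF C]
  have "top_coeffs N' q (mat_kernel C) = ideal_gen (Var ` V' q)" if q: "q < N'" for q
  proof
    let ?i = "gen q" and ?P = "ideal_gen (Var ` V' q) :: ('n, 'k) mpoly set"
    note iq = rv[OF q]
    show "top_coeffs N' q (mat_kernel C) \<subseteq> ?P"
    proof
      fix g assume "g \<in> top_coeffs N' q (mat_kernel C)"
      then obtain w where w: "w \<in> mat_kernel C" "\<And>c. q < c \<Longrightarrow> c < N' \<Longrightarrow> w $ c = 0" "w $ q = g"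
        by (elim top_coeffsE) blast
      then have w': "w \<in> carrier_vec N'" "C *\<^sub>v w = 0\<^sub>v N" by (auto simp: mat_kernel[OF C])
      \<comment> \<open>Coordinate \<open>gen q\<close> of the relation only involves the syzygies of the same generator.\<close>
      have "0 = (\<Sum>p<N'. C $$ (?i, p) * w $ p)"
        using index_mult_mat_vec_sum[OF C w'(1) iq(1)] w'(2) iq(1) by simp
      also have "\<dots> = C $$ (?i, q) * g + (\<Sum>p\<in>{..<N'} - {q}. C $$ (?i, p) * w $ p)"
        using q w(3) by (simp add: sum.remove)
      finally have "C $$ (?i, q) * g = - (\<Sum>p\<in>{..<N'} - {q}. C $$ (?i, p) * w $ p)"
        by (simp add: eq_neg_iff_add_eq_0)
      moreover have "(\<Sum>p\<in>{..<N'} - {q}. C $$ (?i, p) * w $ p) \<in> ?P"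
      proof (rule ring_mod.span_sum)
        fix p assume "p \<in> {..<N'} - {q}"
        then have p: "p < N'" "p \<noteq> q" by auto
        consider "q < p" | "p < q" "gen p < ?i" | "p < q" "gen p = ?i"
          using mono[of p q] p q by linarith
        then show "C $$ (?i, p) * w $ p \<in> ?P"
        proof cases
          case 1
          then show ?thesis using w(2) p by (simp add: ring_mod.span_zero)
        next
          case 2
          then show ?thesis
            using C_entry[OF iq(1) p(1)] s(2)[OF rv[OF p(1)], of ?i] iq(1)
            by (simp add: ring_mod.span_zero)
        next
          case 3
          then have "C $$ (?i, p) = Var (var p)"
            using C_entry[OF iq(1) p(1)] s(3)[OF rv[OF p(1)]] by simp
          moreover have "Var (var p) \<in> ?P" using 3 by (auto simp: Var_in_ideal_gen_Var V'_def)
          ultimately show ?thesis using ring_mod.span_scale by (metis mult.commute)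
        qed
      qed
      ultimately have "Var (var q) * g \<in> ?P"
        using C_entry[OF iq(1) q] s(3)[OF iq] by (simp add: ring_mod.span_neg)
      then show "g \<in> ?P"
        using prime_ideal_Var[of "V' q"] V'_notin[OF q]
        unfolding prime_ideal_def by (metis Var_in_ideal_gen_Var)
    qed
    show "?P \<subseteq> top_coeffs N' q (mat_kernel C)"
    proof (rule ring_mod.span_minimal[OF _ is_ideal_top_coeffs[OF kerC q]], safe)
      fix a assume "a \<in> V' q"
      then obtain p where p: "p < q" "gen p = ?i" "var p = a" by (auto simp: V'_def)
      then have pN: "p < N'" using q by simp
      \<comment> \<open>The two syzygies with the same leading generator are related through lower ones.\<close>
      define x where "x = Var a \<cdot>\<^sub>v s ?i (var q) - Var (var q) \<cdot>\<^sub>v s ?i a"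
      have aV: "a \<in> V ?i" using rv[OF pN] p by simp
      note sc = vec_submoduleD(1)[OF Kv s(1)[OF iq]] vec_submoduleD(1)[OF Kv s(1)[OF iq(1) aV]]
      have "x \<in> K" unfolding x_def
        by (intro vec_submodule_diff[OF Kv] vec_submoduleD(4)[OF Kv] s(1) iq aV)
      moreover have "x $ c = 0" if "?i \<le> c" "c < N" for c
        using that sc s(2)[OF iq, of c] s(2)[OF iq(1) aV, of c] s(3)[OF iq] s(3)[OF iq(1) aV]
        by (cases "c = ?i") (auto simp: x_def)
      ultimately obtain y where y: "y \<in> carrier_vec N'" "\<And>p. p < N' \<Longrightarrow> ?i \<le> gen p \<Longrightarrow> y $ p = 0"
        "x = C *\<^sub>v y" using lower[of x ?i] by blast
      define w where "w = Var a \<cdot>\<^sub>v unit_vec N' q - Var (var q) \<cdot>\<^sub>v unit_vec N' p - y"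
      have unit: "C *\<^sub>v unit_vec N' b = col C b" if "b < N'" for b
        by (rule mult_mat_vec_unit[OF C that])
      have "C *\<^sub>v w = x - C *\<^sub>v y"
        unfolding w_def x_def using C y(1) q pN p
        by (simp add: mult_minus_distrib_mat_vec[OF C] mult_mat_vec_smult[OF C] unit colC)
      then have "C *\<^sub>v w = 0\<^sub>v N" using y(3) C by auto
      moreover have "w \<in> carrier_vec N'" using y(1) by (simp add: w_def)
      ultimately have "w \<in> mat_kernel C" by (simp add: mat_kernel[OF C])
      then show "Var a \<in> top_coeffs N' q (mat_kernel C)"
      proof (rule top_coeffsI)
        show "w $ c = 0" if "q < c" "c < N'" for c
          using that y(1) y(2)[of c] mono[of q c] p by (simp add: w_def)
        show "w $ q = Var a" using q y(1) y(2)[OF q] p by (simp add: w_def)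
      qed
    qed
  qed
  then have "linear_quotients ?es (e + 1) N' C V'" using Cg by (simp add: linear_quotients_def)
  then show ?thesis using that image by (simp add: K_def)
qed

lemma const_eq_0:
  assumes "f \<in> graded_part 0" "lookup f 0 = 0"
  shows "f = 0"
  using assms by (intro poly_mapping_eqI)
    (metis graded_part_iff lookup_hcomp lookup_zero mdeg_eq_0_iff of_nat_eq_0_iff)

lemma lookup_mult_0:
  fixes f g :: "('n::finite, 'k::field) mpoly"
  shows "lookup (f * g) 0 = lookup f 0 * lookup g 0"
  using lookup_mult_unique[of f g 0 0] by (metis add.right_neutral mdeg_add mdeg_eq_0_iff add_is_0)

lemma is_ideal_irrelevant: "is_ideal (irrelevant_ideal :: ('n::finite, 'k::field) mpoly set)"
  by (simp add: irrelevant_ideal_def)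

text \<open>
  The last nonzero coordinate would be a nonzero constant in an ideal generated by variables.
\<close>

lemma linear_quotients_const_kernel:
  fixes A :: "('n::finite, 'k::field) mpoly mat"
  assumes A: "linear_quotients ds e N A V" and u: "u \<in> mat_kernel A"
    and const: "\<And>c. c < N \<Longrightarrow> u $ c \<in> graded_part 0"
  shows "u = 0\<^sub>v N"
proof (rule ccontr)
  assume "u \<noteq> 0\<^sub>v N"
  have car: "A \<in> carrier_mat (length ds) N"
    using A graded_map_carrier by (force simp: linear_quotients_def)
  then have uN: "u \<in> carrier_vec N" using u by (auto simp: mat_kernel[OF car])
  define S where "S = {c. c < N \<and> u $ c \<noteq> 0}"
  have "finite S" "S \<noteq> {}" using \<open>u \<noteq> 0\<^sub>v N\<close> uN by (auto simp: S_def)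
  then have i: "Max S \<in> S" "\<And>c. c \<in> S \<Longrightarrow> c \<le> Max S" by simp_all
  have "u $ Max S \<in> top_coeffs N (Max S) (mat_kernel A)"
  proof (rule top_coeffsI[OF u])
    fix c assume "Max S < c" "c < N"
    then show "u $ c = 0" using i(2)[of c] by (fastforce simp: S_def)
  qed simp
  then have "u $ Max S \<in> ideal_gen (Var ` V (Max S))"
    using A i(1) by (auto simp: linear_quotients_def S_def)
  then have "0 \<notin> keys (u $ Max S)" by (auto simp: ideal_gen_Var)
  then have "lookup (u $ Max S) 0 = 0" by (simp add: in_keys_iff)
  then show False using const_eq_0 const i(1) by (auto simp: S_def)
qed

text \<open>
  One step of the comparison of a minimal resolution with a given one that has linear quotients. Lift
  the identity of the image in both directions. The two composites agree with the identity up to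
  relations, which have no units as coefficients, so the degrees of both lists of generators agree.
  Then the lifts \<open>P\<close> and \<open>Q\<close> consist of constants and are inverse to each other, and \<open>P\<close> carries the
  generators of the kernel of \<open>A\<close> to those of the kernel of \<open>B\<close> without changing their relations.
\<close>

lemma linear_quotients_minimal_step:
  fixes A B :: "('n::finite, 'k::field) mpoly mat"
  assumes A: "linear_quotients ds e N A V" and B: "graded_map ds es B"
    and im: "mat_image B = mat_image A"
    and min: "\<And>w c. w \<in> mat_kernel B \<Longrightarrow> c < length es \<Longrightarrow> w $ c \<in> irrelevant_ideal"
  shows "set es \<subseteq> {e}"
    and "\<exists>N' C V'. linear_quotients es (e + 1) N' C V' \<and> mat_image C = mat_kernel B"
proof -
  let ?n = "length es"
  have Ag: "graded_map ds (replicate N e) A" using A by (simp add: linear_quotients_def)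
  obtain P where P: "graded_map es (replicate N e) P" "A = B * P"
    using graded_map_lift[OF Ag B] im by blast
  obtain Q where Q: "graded_map (replicate N e) es Q" "B = A * Q"
    using graded_map_lift[OF B Ag] im by blast
  have Ac: "A \<in> carrier_mat (length ds) N" and Bc: "B \<in> carrier_mat (length ds) ?n"
    and Pc: "P \<in> carrier_mat ?n N" and Qc: "Q \<in> carrier_mat N ?n"
    using graded_map_carrier[OF Ag] graded_map_carrier[OF B] graded_map_carrier[OF P(1)]
      graded_map_carrier[OF Q(1)] by simp_all
  have PQc: "P * Q \<in> carrier_mat ?n ?n" and QPc: "Q * P \<in> carrier_mat N N" using Pc Qc by auto
  \<comment> \<open>Lifting forth and back differs from the identity by a relation among the generators.\<close>
  have diff: "unit_vec n b - col X b \<in> mat_kernel Y"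
    if "Y \<in> carrier_mat r n" "X \<in> carrier_mat n n" "Y * X = Y" "b < n"
    for X Y :: "('n, 'k) mpoly mat" and n r b
  proof -
    have c: "col X b \<in> carrier_vec n" using that(2) by (intro carrier_vecI) simp
    have "Y *\<^sub>v (unit_vec n b - col X b) = col Y b - Y *\<^sub>v col X b"
      using c by (simp add: mult_minus_distrib_mat_vec[OF that(1)] mult_mat_vec_unit[OF that(1,4)])
    also have "Y *\<^sub>v col X b = col Y b" using that by (metis col_mult2)
    finally show ?thesis using that(1) c by (auto simp: mat_kernel[OF that(1)])
  qed
  have entry: "(unit_vec n b - col X b) $ a = (if a = b then 1 else 0) - X $$ (a, b)"
    if "X \<in> carrier_mat n n" "a < n" "b < n" for X :: "('n, 'k) mpoly mat" and a b n
    using that by simp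
  have "B * (P * Q) = B" 
    unfolding assoc_mult_mat[OF Bc Pc Qc, symmetric] P(2)[symmetric] Q(2)[symmetric] ..
  from diff[OF Bc PQc this] have kB: "unit_vec ?n b - col (P * Q) b \<in> mat_kernel B" if "b < ?n" for b
    using that .
  have "A * (Q * P) = A" 
    unfolding assoc_mult_mat[OF Ac Qc Pc, symmetric] Q(2)[symmetric] P(2)[symmetric] ..
  from diff[OF Ac QPc this] have kA: "unit_vec N b - col (Q * P) b \<in> mat_kernel A" if "b < N" for b
    using that .
  have PQ0: "lookup ((P * Q) $$ (a, b)) 0 = (if a = b then 1 else 0)" if "a < ?n" "b < ?n" for a b
  proof -
    have "(unit_vec ?n b - col (P * Q) b) $ a \<in> irrelevant_ideal" using min[OF kB] that by blast
    then have "(if a = b then 1 else 0) - (P * Q) $$ (a, b) \<in> irrelevant_ideal"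
      unfolding entry[OF PQc that] .
    then show ?thesis by (auto simp: irrelevant_ideal_iff lookup_minus split: if_splits)
  qed
  show es: "set es \<subseteq> {e}"
  proof (safe)
    fix d assume "d \<in> set es"
    then obtain b where b: "b < ?n" "es ! b = d" by (auto simp: in_set_conv_nth)
    have "(P * Q) $$ (b, b) = (\<Sum>a<N. P $$ (b, a) * Q $$ (a, b))"
      using b Pc Qc by (simp add: scalar_prod_def lessThan_atLeast0)
    then have "(\<Sum>a<N. lookup (P $$ (b, a)) 0 * lookup (Q $$ (a, b)) 0) \<noteq> 0"
      using PQ0[of b b] b by (simp add: lookup_sum lookup_mult_0)
    then obtain a where a: "a < N" "lookup (P $$ (b, a)) 0 \<noteq> 0"
      by (metis (no_types, lifting) lessThan_iff mult_eq_0_iff sum.neutral)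
    moreover have "P $$ (b, a) \<in> graded_part (e - d)" using P(1) a b by (auto simp: graded_map_def)
    ultimately show "d = e" by (force simp: graded_part_def in_keys_iff)
  qed
  have PQ: "P * Q = 1\<^sub>m ?n"
  proof (rule eq_matI)
    fix a b assume ab: "a < dim_row (1\<^sub>m ?n)" "b < dim_col (1\<^sub>m ?n)"
    then have "es ! a \<in> {e}" "es ! b \<in> {e}"
      using subsetD[OF es nth_mem[of a es]] subsetD[OF es nth_mem[of b es]] by simp_all
    then have "es ! a = e" "es ! b = e" by simp_all
    then have "(P * Q) $$ (a, b) \<in> graded_part (e - e)"
      using graded_map_mult[OF P(1) Q(1)] ab by (metis graded_map_def index_one_mat(2,3))
    then have "(P * Q) $$ (a, b) - (if a = b then 1 else 0) \<in> graded_part 0"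
      by (auto simp: graded_part_def in_keys_iff lookup_minus lookup_one when_def split: if_splits)
    then have "(P * Q) $$ (a, b) - (if a = b then 1 else 0) = 0"
      by (rule const_eq_0) (use PQ0[of a b] ab in \<open>simp add: lookup_minus\<close>)
    then show "(P * Q) $$ (a, b) = 1\<^sub>m ?n $$ (a, b)" using ab by simp
  qed (use PQc in auto)
  have QP: "Q * P = 1\<^sub>m N"
  proof (rule mat_col_eqI)
    fix b assume "b < dim_col (1\<^sub>m N)"
    then have b: "b < N" by simp
    have "unit_vec N b - col (Q * P) b = 0\<^sub>v N"
    proof (rule linear_quotients_const_kernel[OF A kA[OF b]])
      fix c assume c: "c < N"
      then have "(Q * P) $$ (c, b) \<in> graded_part (e - e)"
        using graded_map_mult[OF Q(1) P(1)] b by (auto simp: graded_map_def)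
      then have "(if c = b then 1 else 0) - (Q * P) $$ (c, b) \<in> graded_part 0"
        by (auto simp: graded_part_def in_keys_iff lookup_minus lookup_one when_def split: if_splits)
      then show "(unit_vec N b - col (Q * P) b) $ c \<in> graded_part 0"
        unfolding entry[OF QPc c b] .
    qed
    then have z: "(unit_vec N b - col (Q * P) b) $ c = 0" if "c < N" for c using that by simp
    have "(Q * P) $$ (c, b) = (if c = b then 1 else 0)" if "c < N" for c
      using z[OF that] unfolding entry[OF QPc that b] by simp
    then show "col (Q * P) b = col (1\<^sub>m N) b"
      using b Qc Pc by (intro eq_vecI) auto
  qed (use QPc in auto)
  obtain N' C V' where C: "linear_quotients (replicate N e) (e + 1) N' C V'" "mat_image C = mat_kernel A"
    by (rule linear_quotients_kernel[OF A])
  have Cg: "graded_map (replicate N e) (replicate N' (e + 1)) C"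
    using C(1) by (simp add: linear_quotients_def)
  have Cc: "C \<in> carrier_mat N N'" using graded_map_carrier[OF Cg] by simp
  have PCc: "P * C \<in> carrier_mat ?n N'" using Pc Cc by auto
  have "mat_kernel (P * C) = mat_kernel C"
  proof -
    have "P * C *\<^sub>v v = 0\<^sub>v ?n \<longleftrightarrow> C *\<^sub>v v = 0\<^sub>v N" if v: "v \<in> carrier_vec N'" for v
    proof
      assume "P * C *\<^sub>v v = 0\<^sub>v ?n"
      then have "Q *\<^sub>v (P *\<^sub>v (C *\<^sub>v v)) = Q *\<^sub>v 0\<^sub>v ?n" using Pc Cc v by simp
      also have "\<dots> = 0\<^sub>v N" using Qc by (intro eq_vecI) auto
      finally have "Q * P *\<^sub>v (C *\<^sub>v v) = 0\<^sub>v N" using Qc Pc Cc v by simp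
      then show "C *\<^sub>v v = 0\<^sub>v N" using QP Cc v by simp
    next
      assume "C *\<^sub>v v = 0\<^sub>v N"
      then have "P * C *\<^sub>v v = P *\<^sub>v 0\<^sub>v N" using Pc Cc v by simp
      also have "\<dots> = 0\<^sub>v ?n" using Pc by (intro eq_vecI) auto
      finally show "P * C *\<^sub>v v = 0\<^sub>v ?n" .
    qed
    then show ?thesis unfolding mat_kernel[OF PCc] mat_kernel[OF Cc] by auto
  qed
  then have "linear_quotients es (e + 1) N' (P * C) V'"
    using C(1) graded_map_mult[OF P(1) Cg] by (simp add: linear_quotients_def)
  moreover have "mat_image (P * C) = mat_kernel B"
  proof (safe)
    fix w assume "w \<in> mat_image (P * C)"
    then obtain v where v: "w = P * C *\<^sub>v v" "v \<in> carrier_vec N'" using PCc by (auto simp: mat_image_def)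
    have "C *\<^sub>v v \<in> mat_kernel A" using C(2) v(2) Cc by (auto simp: mat_image_def)
    then have "A *\<^sub>v (C *\<^sub>v v) = 0\<^sub>v (length ds)" by (simp add: mat_kernel[OF Ac])
    then have "B *\<^sub>v w = 0\<^sub>v (length ds)" using v P(2) Bc Pc Cc by simp
    moreover have "w \<in> carrier_vec ?n" using v PCc by (auto intro: carrier_vecI)
    ultimately show "w \<in> mat_kernel B" by (simp add: mat_kernel[OF Bc])
  next
    fix w assume "w \<in> mat_kernel B"
    then have w: "w \<in> carrier_vec ?n" "B *\<^sub>v w = 0\<^sub>v (length ds)" by (auto simp: mat_kernel[OF Bc])
    then have "A *\<^sub>v (Q *\<^sub>v w) = 0\<^sub>v (length ds)" using Q(2) Ac Qc by simp
    moreover have "Q *\<^sub>v w \<in> carrier_vec N" using Qc by (auto intro: carrier_vecI)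
    ultimately have "Q *\<^sub>v w \<in> mat_image C" by (simp add: C(2) mat_kernel[OF Ac])
    then obtain v where v: "Q *\<^sub>v w = C *\<^sub>v v" "v \<in> carrier_vec N'" using Cc by (auto simp: mat_image_def)
    have "w = P * Q *\<^sub>v w" using PQ w(1) by simp
    also have "\<dots> = P *\<^sub>v (Q *\<^sub>v w)" using Pc Qc w(1) by simp
    also have "\<dots> = P * C *\<^sub>v v" using v Pc Cc by simp
    finally show "w \<in> mat_image (P * C)" using v(2) Cc by (auto simp: mat_image_def)
  qed
  ultimately show "\<exists>N' C V'. linear_quotients es (e + 1) N' C V' \<and> mat_image C = mat_kernel B"
    by blast
qed

lemma minimal_resolution_kernel:
  assumes "minimal_graded_free_resolution I d \<phi>" "w \<in> mat_kernel (\<phi> i)" "c < length (d i)"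
  shows "w $ c \<in> irrelevant_ideal"
proof -
  have g: "graded_map (d i) (d (Suc i)) (\<phi> (Suc i))" and im: "mat_kernel (\<phi> i) = mat_image (\<phi> (Suc i))"
    and irr: "\<And>b. b < length (d (Suc i)) \<Longrightarrow> \<phi> (Suc i) $$ (c, b) \<in> irrelevant_ideal"
    using assms by (auto simp: minimal_graded_free_resolution_def graded_free_resolution_def)
  note car = graded_map_carrier[OF g]
  obtain y where y: "y \<in> carrier_vec (length (d (Suc i)))" "w = \<phi> (Suc i) *\<^sub>v y"
    using assms(2) car by (auto simp: im mat_image_def)
  show ?thesis
    unfolding y(2) index_mult_mat_vec_sum[OF car y(1) assms(3)]
    using irr by (intro ring_mod.subspace_sum[OF is_ideal_irrelevant])
      (auto simp: mult.commute intro: ring_mod.subspace_scale[OF is_ideal_irrelevant])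
qed

text \<open>
  The step above, applied along the resolution.
\<close>

theorem linear_quotients_resolution_degrees:
  fixes I :: "('n::finite, 'k::field) mpoly set"
  assumes res: "minimal_graded_free_resolution I d \<phi>"
    and A: "linear_quotients [0] e N A V" "mat_image A = {vec 1 (\<lambda>_. f) | f. f \<in> I}"
  shows "set (d i) \<subseteq> {e + int i}"
proof -
  have g0: "graded_map [0] (d 0) (\<phi> 0)" and im0: "mat_image (\<phi> 0) = mat_image A"
    and g: "\<And>i. graded_map (d i) (d (Suc i)) (\<phi> (Suc i))"
    and im: "\<And>i. mat_kernel (\<phi> i) = mat_image (\<phi> (Suc i))"
    using res A(2) by (auto simp: minimal_graded_free_resolution_def graded_free_resolution_def)
  note min = minimal_resolution_kernel[OF res]
  have "set (d i) \<subseteq> {e + int i} \<and>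
    (\<exists>N A V. linear_quotients (d i) (e + int i + 1) N A V \<and> mat_image A = mat_kernel (\<phi> i))"
  proof (induction i)
    case 0
    show ?case using linear_quotients_minimal_step[OF A(1) g0 im0 min[of _ 0]] by simp
  next
    case (Suc i)
    then obtain N A V where A: "linear_quotients (d i) (e + int i + 1) N A V"
      "mat_image (\<phi> (Suc i)) = mat_image A" using im by metis
    show ?case using linear_quotients_minimal_step[OF A(1) g A(2) min[of _ "Suc i"]]
      by (simp add: algebra_simps)
  qed
  then show ?thesis by blast
qed

section \<open>Monomial ideals with linear quotients\<close>

text \<open>
  For monomials the colon ideals are generated by the quotients \<open>us ! j / gcd (us ! j) (us ! i)\<close>. The
  first condition puts the variables of \<open>V i\<close> into the colon ideal, the second says that each of these
  quotients is divisible by one of them.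
\<close>

lemma linear_quotients_monomials:
  fixes us :: "('n::finite \<Rightarrow>\<^sub>0 nat) list" and V :: "nat \<Rightarrow> 'n set"
  defines "A \<equiv> mat 1 (length us) (\<lambda>(_, c). xpow (us ! c)) :: ('n, 'k::field) mpoly mat"
  assumes deg: "\<And>u. u \<in> set us \<Longrightarrow> mdeg u = e"
    and V1: "\<And>i a. i < length us \<Longrightarrow> a \<in> V i \<Longrightarrow>
      \<exists>l<i. mdvd (us ! l) (us ! i + Poly_Mapping.single a 1)"
    and V2: "\<And>i j. i < length us \<Longrightarrow> j < i \<Longrightarrow> \<exists>a\<in>V i. lookup (us ! i) a < lookup (us ! j) a"
  shows "linear_quotients [0] (int e) (length us) A V"
    and "mat_image A = {vec 1 (\<lambda>_. f) | f. f \<in> ideal_gen (xpow ` set us)}"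
proof -
  let ?N = "length us"
  have car: "A \<in> carrier_mat 1 ?N" by (simp add: A_def)
  have g: "graded_map [0] (replicate ?N (int e)) A"
    using deg by (auto simp: graded_map_def A_def graded_part_def)
  have mult: "A *\<^sub>v w = vec 1 (\<lambda>_. \<Sum>b<?N. xpow (us ! b) * w $ b)" if "w \<in> carrier_vec ?N" for w
    using index_mult_mat_vec_sum[OF car that, of 0] car by (intro eq_vecI) (simp_all add: A_def)
  have vec1: "vec 1 (\<lambda>_. f) = 0\<^sub>v 1 \<longleftrightarrow> f = 0" for f :: "('n, 'k) mpoly"
    by (auto simp: vec_eq_iff)
  have ker: "w \<in> mat_kernel A \<longleftrightarrow> w \<in> carrier_vec ?N \<and> (\<Sum>b<?N. xpow (us ! b) * w $ b) = 0" for w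
  proof (cases "w \<in> carrier_vec ?N")
    case True
    show ?thesis unfolding mat_kernel[OF car] mem_Collect_eq mult[OF True] vec1 ..
  qed (simp add: mat_kernel[OF car])
  have "top_coeffs ?N i (mat_kernel A) = ideal_gen (Var ` V i)" if i: "i < ?N" for i
  proof
    show "top_coeffs ?N i (mat_kernel A) \<subseteq> ideal_gen (Var ` V i)"
    proof
      fix g assume "g \<in> top_coeffs ?N i (mat_kernel A)"
      then obtain w where w: "w \<in> mat_kernel A" "\<And>c. i < c \<Longrightarrow> c < ?N \<Longrightarrow> w $ c = 0" "w $ i = g"
        by (elim top_coeffsE) blast
      have "0 = (\<Sum>b<?N. xpow (us ! b) * w $ b)" using w(1) by (simp add: ker)
      also have "\<dots> = (\<Sum>b\<le>i. xpow (us ! b) * w $ b)"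
        by (rule sum.mono_neutral_right) (use i w(2) in auto)
      also have "\<dots> = (\<Sum>b<i. xpow (us ! b) * w $ b) + xpow (us ! i) * g"
        unfolding lessThan_Suc_atMost[symmetric] by (simp add: w(3))
      finally have eq: "xpow (us ! i) * g = - (\<Sum>b<i. xpow (us ! b) * w $ b)"
        by (simp add: eq_neg_iff_add_eq_0 add.commute)
      have "(\<Sum>b<i. xpow (us ! b) * w $ b) \<in> ideal_gen (xpow ` (!) us ` {..<i})"
        by (intro ring_mod.span_sum, subst mult.commute, intro ring_mod.span_scale ring_mod.span_base) auto
      then have mem: "xpow (us ! i) * g \<in> ideal_gen (xpow ` (!) us ` {..<i})"
        by (simp add: eq ring_mod.span_neg)
      have "\<exists>a\<in>V i. 0 < lookup k a" if "k \<in> keys g" for k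
      proof -
        have "us ! i + k \<in> keys (xpow (us ! i) * g)" using that by (simp add: in_keys_iff)
        then obtain b where b: "b < i" "mdvd (us ! b) (us ! i + k)"
          using mem by (auto simp: ideal_gen_monomials)
        then obtain a where a: "a \<in> V i" "lookup (us ! i) a < lookup (us ! b) a" using V2[OF i] by blast
        have "lookup (us ! b) a \<le> lookup (us ! i) a + lookup k a"
          using b(2) by (simp add: mdvd_def lookup_add)
        then show ?thesis using a by force
      qed
      then show "g \<in> ideal_gen (Var ` V i)" by (simp add: ideal_gen_Var)
    qed
    have id: "is_ideal (top_coeffs ?N i (mat_kernel A))"
      by (rule is_ideal_top_coeffs[OF vec_submodule_mat_kernel[OF car] i])
    show "ideal_gen (Var ` V i) \<subseteq> top_coeffs ?N i (mat_kernel A)"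
    proof (rule ring_mod.span_minimal[OF _ id], safe)
      fix a assume a: "a \<in> V i"
      obtain l q where l: "l < i" "us ! i + Poly_Mapping.single a 1 = us ! l + q"
        using V1[OF i a] by (auto simp: mdvd_iff)
      define w :: "('n, 'k) mpoly vec"
        where "w = Var a \<cdot>\<^sub>v unit_vec ?N i - xpow q \<cdot>\<^sub>v unit_vec ?N l"
      have lN: "l < ?N" using l i by simp
      have wc: "w \<in> carrier_vec ?N" by (simp add: w_def)
      have "A *\<^sub>v w = Var a \<cdot>\<^sub>v col A i - xpow q \<cdot>\<^sub>v col A l"
        by (simp add: w_def mult_minus_distrib_mat_vec[OF car] mult_mat_vec_smult[OF car]
            mult_mat_vec_unit[OF car] i lN)
      also have "\<dots> = 0\<^sub>v 1"
        using i lN l(2) by (intro eq_vecI) (auto simp: A_def Var_eq xpow_mult add.commute)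
      finally have "w \<in> mat_kernel A" using wc by (simp add: mat_kernel[OF car])
      then show "Var a \<in> top_coeffs ?N i (mat_kernel A)"
        by (rule top_coeffsI) (use i l lN in \<open>auto simp: w_def\<close>)
    qed
  qed
  then show "linear_quotients [0] (int e) (length us) A V"
    using g by (simp add: linear_quotients_def)
  show "mat_image A = {vec 1 (\<lambda>_. f) | f. f \<in> ideal_gen (xpow ` set us)}" (is "_ = ?M")
  proof
    show "mat_image A \<subseteq> ?M"
    proof
      fix v assume "v \<in> mat_image A"
      then obtain w where w: "v = A *\<^sub>v w" "w \<in> carrier_vec ?N" using car by (auto simp: mat_image_def)
      have "(\<Sum>b<?N. xpow (us ! b) * w $ b) \<in> ideal_gen (xpow ` set us)"
        by (intro ring_mod.span_sum, subst mult.commute, intro ring_mod.span_scale ring_mod.span_base) auto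
      then show "v \<in> ?M" unfolding w(1) mult[OF w(2)] by blast
    qed
    let ?J = "{f. vec 1 (\<lambda>_. f) \<in> mat_image A}"
    note im = vec_submodule_mat_image[OF car]
    have J: "is_ideal ?J"
    proof (rule is_idealI)
      show "0 \<in> ?J" using vec_submoduleD(2)[OF im] vec1[of 0] by simp
    next
      fix f g assume "f \<in> ?J" "g \<in> ?J"
      moreover have "vec 1 (\<lambda>_. f + g) = vec 1 (\<lambda>_. f) + vec 1 (\<lambda>_. g)" by auto
      ultimately show "f + g \<in> ?J" using vec_submoduleD(3)[OF im] by simp
    next
      fix c f assume "f \<in> ?J"
      moreover have "vec 1 (\<lambda>_. c * f) = c \<cdot>\<^sub>v vec 1 (\<lambda>_. f)" by auto
      ultimately show "c * f \<in> ?J" using vec_submoduleD(4)[OF im] by simp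
    qed
    have "ideal_gen (xpow ` set us) \<subseteq> ?J"
    proof (rule ring_mod.span_minimal[OF _ J], safe)
      fix u assume "u \<in> set us"
      then obtain b where b: "b < ?N" "us ! b = u" by (auto simp: in_set_conv_nth)
      then have "vec 1 (\<lambda>_. xpow u) = col A b" by (auto simp: A_def)
      then show "vec 1 (\<lambda>_. xpow u) \<in> mat_image A" using col_in_mat_image[OF car b(1)] by simp
    qed
    then show "?M \<subseteq> mat_image A" by auto
  qed
qed

lemma hcomp_monomial_ideal:
  "f \<in> ideal_gen (xpow ` U) \<Longrightarrow> hcomp j f \<in> ideal_gen (xpow ` U)"
  by (auto simp: ideal_gen_monomials in_keys_iff lookup_hcomp split: if_splits)

lemma resolution_degrees_minimal:
  fixes U :: "('n::finite \<Rightarrow>\<^sub>0 nat) set"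
  assumes "I = (ideal_gen (xpow ` U) :: ('n, 'k::field) mpoly set)"
  obtains \<phi> where "minimal_graded_free_resolution I (resolution_degrees I) \<phi>"
proof -
  have "\<exists>d. \<exists>\<phi>. minimal_graded_free_resolution I d \<phi>"
    by (rule minimal_graded_free_resolution_exists) (use hcomp_monomial_ideal in \<open>auto simp: assms\<close>)
  from someI_ex[OF this] show ?thesis using that unfolding resolution_degrees_def by blast
qed

text \<open>
  Every monomial of an element of the ideal is a multiple of a generator.
\<close>

lemma alpha_monomial_ideal:
  fixes U :: "('n::finite \<Rightarrow>\<^sub>0 nat) set"
  assumes I: "I = (ideal_gen (xpow ` U) :: ('n, 'k::field) mpoly set)"
    and U: "U \<noteq> {}" "\<And>u. u \<in> U \<Longrightarrow> mdeg u = e"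
  shows "alpha I = e"
  unfolding alpha_def
proof (rule Least_equality)
  obtain u where u: "u \<in> U" using U(1) by blast
  then have "xpow u \<in> I - {0}" "xpow u \<in> graded_part (int e)"
    using U(2) by (auto simp: I graded_part_def intro: ring_mod.span_base simp flip: keys_eq_empty)
  then show "\<exists>f\<in>I - {0}. f \<in> graded_part (int e)" by blast
next
  fix d assume "\<exists>f\<in>I - {0}. f \<in> graded_part (int d)"
  then obtain f where f: "f \<in> I" "f \<noteq> 0" "f \<in> graded_part (int d)" by blast
  then obtain k where k: "k \<in> keys f" by fastforce
  then obtain u l where "u \<in> U" "k = u + l" using f(1) by (auto simp: I ideal_gen_monomials mdvd_iff)
  moreover have "mdeg k = d" using f(3) k by (simp add: graded_part_def)
  ultimately show "e \<le> d" using U(2) by auto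
qed

lemma has_linear_resolution_linear_quotients:
  fixes us :: "('n::finite \<Rightarrow>\<^sub>0 nat) list"
  assumes I: "I = (ideal_gen (xpow ` set us) :: ('n, 'k::field) mpoly set)" and ne: "us \<noteq> []"
    and deg: "\<And>u. u \<in> set us \<Longrightarrow> mdeg u = e"
    and exch: "\<And>i j. i < length us \<Longrightarrow> j < i \<Longrightarrow> \<exists>l<i. \<exists>a.
      mdvd (us ! l) (us ! i + Poly_Mapping.single a 1) \<and> lookup (us ! i) a < lookup (us ! j) a"
  shows "has_linear_resolution I"
proof -
  define V where "V i = {a. \<exists>l<i. mdvd (us ! l) (us ! i + Poly_Mapping.single a 1)}" for i
  let ?A = "mat 1 (length us) (\<lambda>(_, c). xpow (us ! c)) :: ('n, 'k) mpoly mat"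
  have V1: "\<exists>l<i. mdvd (us ! l) (us ! i + Poly_Mapping.single a 1)" if "a \<in> V i" for i a
    using that by (simp add: V_def)
  have V2: "\<exists>a\<in>V i. lookup (us ! i) a < lookup (us ! j) a" if "i < length us" "j < i" for i j
    using exch[OF that] by (auto simp: V_def)
  note LQ = linear_quotients_monomials[where V = V and 'k = 'k, OF deg V1 V2, folded I]
  let ?d = "resolution_degrees I"
  obtain \<phi> where res: "minimal_graded_free_resolution I ?d \<phi>"
    by (rule resolution_degrees_minimal[OF I])
  have d: "set (?d i) \<subseteq> {int e + int i}" for i
    by (rule linear_quotients_resolution_degrees[OF res LQ])
  have "?d 0 \<noteq> []"
  proof
    assume e: "?d 0 = []"
    have "graded_map [0] (?d 0) (\<phi> 0)" "mat_image (\<phi> 0) = {vec 1 (\<lambda>_. f) | f. f \<in> I}"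
      using res by (auto simp: minimal_graded_free_resolution_def graded_free_resolution_def)
    then have c: "\<phi> 0 \<in> carrier_mat 1 0" "vec 1 (\<lambda>_. xpow (us ! 0)) \<in> mat_image (\<phi> 0)"
      using graded_map_carrier ne e by (force simp: I intro: ring_mod.span_base)+
    then obtain w where w: "vec 1 (\<lambda>_. xpow (us ! 0)) = \<phi> 0 *\<^sub>v w" "w \<in> carrier_vec 0"
      by (auto simp: mat_image_def)
    have "xpow (us ! 0) = vec 1 (\<lambda>_. xpow (us ! 0) :: ('n, 'k) mpoly) $ 0" by simp
    also have "\<dots> = 0"
      unfolding w(1) using index_mult_mat_vec_sum[OF c(1) w(2), of 0] by simp
    finally have "lookup (xpow (us ! 0) :: ('n, 'k) mpoly) (us ! 0) = 0" by simp
    then show False by simp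
  qed
  then obtain j where j: "j \<in> set (?d 0)" by (cases "?d 0") auto
  have "{ereal (of_int (j - int i)) | i j. graded_betti I i j \<noteq> 0} = {ereal (real e)}" (is "?D = _")
  proof (intro subset_antisym subsetI)
    fix r assume "r \<in> ?D"
    then obtain i j where "r = ereal (of_int (j - int i))" "j \<in> set (?d i)"
      by (auto simp: graded_betti_def count_list_0_iff simp flip: neq0_conv)
    then show "r \<in> {ereal (real e)}" using d[of i] by auto
  next
    fix r assume r: "r \<in> {ereal (real e)}"
    have "j = int e" using d[of 0] j by auto
    moreover have "graded_betti I 0 j \<noteq> 0" using j by (simp add: graded_betti_def count_list_0_iff)
    ultimately show "r \<in> ?D"
      using r by (intro CollectI exI[of _ 0] exI[of _ j]) auto
  qed
  then have "regularity I = ereal (real e)" unfolding regularity_def by simp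
  moreover have "alpha I = e" by (rule alpha_monomial_ideal[OF I]) (use ne deg in auto)
  moreover have "equigenerated I"
    unfolding equigenerated_def I using deg
    by (intro exI[of _ "int e"] exI[of _ "xpow ` set us"]) (auto simp: graded_part_def)
  ultimately show ?thesis by (simp add: has_linear_resolution_def)
qed

section \<open>An obstruction to a linear resolution\<close>

text \<open>
  If the resolution were linear, all relations would be combinations of linear ones. The functional
  that sends a relation to the coefficient at \<open>u2\<close> of its coordinate at \<open>u1\<close> vanishes on all
  combinations of linear relations: a linear relation in which \<open>u1\<close> has a coefficient \<open>x\<close>, for a
  variable \<open>x\<close> of \<open>u2\<close>, would need a second generator that divides \<open>x * u1\<close>. But its value on the
  relation \<open>u2 * u1 - u1 * u2 = 0\<close> is 1. As the basis of the resolution need not be mapped to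
  monomials, the coordinate at \<open>u1\<close> is computed from the coefficients of \<open>u1\<close> in the images of the
  basis elements.
\<close>

lemma not_has_linear_resolution:
  fixes U :: "('n::finite \<Rightarrow>\<^sub>0 nat) set"
  assumes I: "I = (ideal_gen (xpow ` U) :: ('n, 'k::field) mpoly set)"
    and deg: "\<And>u. u \<in> U \<Longrightarrow> mdeg u = t"
    and u: "u1 \<in> U" "u2 \<in> U" "u1 \<noteq> u2"
    and isolated: "\<And>u a. u \<in> U \<Longrightarrow> 0 < lookup u2 a \<Longrightarrow> mdvd u (u1 + Poly_Mapping.single a 1) \<Longrightarrow> u = u1"
  shows "\<not> has_linear_resolution I"
proof
  assume lin: "has_linear_resolution I"
  let ?d = "resolution_degrees I"
  obtain \<phi> where res: "minimal_graded_free_resolution I ?d \<phi>"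
    by (rule resolution_degrees_minimal[OF I])
  then have g0: "graded_map [0] (?d 0) (\<phi> 0)" and im0: "mat_image (\<phi> 0) = {vec 1 (\<lambda>_. f) | f. f \<in> I}"
    and g1: "graded_map (?d 0) (?d 1) (\<phi> 1)" and im1: "mat_kernel (\<phi> 0) = mat_image (\<phi> 1)"
    by (auto simp: minimal_graded_free_resolution_def graded_free_resolution_def)
  have "alpha I = t" by (rule alpha_monomial_ideal[OF I]) (use u deg in auto)
  then have reg: "regularity I = ereal (real t)" using lin by (simp add: has_linear_resolution_def)
  have bound: "j \<le> int t + int i" if "j \<in> set (?d i)" for i j
  proof -
    have "graded_betti I i j \<noteq> 0" using that by (simp add: graded_betti_def count_list_0_iff)
    then have "ereal (of_int (j - int i)) \<le> regularity I"
      unfolding regularity_def by (intro Sup_upper) blast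
    then have "real_of_int (j - int i) \<le> real t" unfolding reg by simp
    then show ?thesis by linarith
  qed
  let ?N0 = "length (?d 0)" and ?N1 = "length (?d 1)"
  have c0: "\<phi> 0 \<in> carrier_mat 1 ?N0" and c1: "\<phi> 1 \<in> carrier_mat ?N0 ?N1"
    using graded_map_carrier[OF g0] graded_map_carrier[OF g1] by simp_all
  define f where "f c = \<phi> 0 $$ (0, c)" for c
  have mult0: "(\<phi> 0 *\<^sub>v w) $ 0 = (\<Sum>c<?N0. f c * w $ c)" if "w \<in> carrier_vec ?N0" for w
    using index_mult_mat_vec_sum[OF c0 that] by (simp add: f_def)
  have fI: "f c \<in> I" if "c < ?N0" for c
  proof -
    have "col (\<phi> 0) c \<in> {vec 1 (\<lambda>_. f) | f. f \<in> I}" using col_in_mat_image[OF c0 that] im0 by simp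
    then obtain g where "col (\<phi> 0) c = vec 1 (\<lambda>_. g)" "g \<in> I" by blast
    moreover have "col (\<phi> 0) c $ 0 = f c" using c0 that by (simp add: f_def)
    ultimately show ?thesis by simp
  qed
  \<comment> \<open>All monomials of the images of the basis are generators of \<open>I\<close>.\<close>
  have fU: "q \<in> U" "?d 0 ! c = int t" if cq: "c < ?N0" "q \<in> keys (f c)" for c q
  proof -
    obtain u l where ul: "u \<in> U" "q = u + l"
      using fI[OF cq(1)] cq(2) by (auto simp: I ideal_gen_monomials mdvd_iff)
    have q: "int (mdeg q) = ?d 0 ! c"
      using g0 cq by (auto simp: graded_map_def graded_part_def f_def)
    moreover have "?d 0 ! c \<le> int t" using bound[of _ 0] cq(1) by simp
    ultimately have "mdeg l = 0" using deg[OF ul(1)] ul(2) by simp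
    then have "q = u" using ul(2) by (simp add: mdeg_eq_0_iff)
    then show "q \<in> U" "?d 0 ! c = int t" using ul(1) q deg by simp_all
  qed
  \<comment> \<open>The functional that separates the syzygy of \<open>u1\<close> and \<open>u2\<close> from the linear syzygies.\<close>
  define \<Lambda> where "\<Lambda> v = (\<Sum>c<?N0. Poly_Mapping.single 0 (lookup (f c) u1) * v $ c)"
    for v :: "('n, 'k) mpoly vec"
  have lookup_const: "lookup (Poly_Mapping.single 0 x * g) m = x * lookup g m" for x m and g :: "('n, 'k) mpoly"
    using lookup_xpow_mult_add[of 0 x g m] by simp
  have \<Lambda>_lookup: "lookup (\<Lambda> v) m = (\<Sum>c<?N0. lookup (f c) u1 * lookup (v $ c) m)" for v m
    by (simp add: \<Lambda>_def lookup_sum lookup_const)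
  have ex: "\<exists>a. a \<in> carrier_vec ?N0 \<and> (\<phi> 0 *\<^sub>v a) $ 0 = xpow v" if "v \<in> U" for v
  proof -
    have "vec 1 (\<lambda>_. xpow v) \<in> mat_image (\<phi> 0)"
      unfolding im0 I using that by (blast intro: ring_mod.span_base)
    then obtain a where a: "vec 1 (\<lambda>_. xpow v) = \<phi> 0 *\<^sub>v a" "a \<in> carrier_vec ?N0"
      using c0 by (auto simp: mat_image_def)
    have "(\<phi> 0 *\<^sub>v a) $ 0 = xpow v" unfolding a(1)[symmetric] by simp
    then show ?thesis using a(2) by blast
  qed
  obtain a b where a: "a \<in> carrier_vec ?N0" "(\<phi> 0 *\<^sub>v a) $ 0 = xpow u1"
    and b: "b \<in> carrier_vec ?N0" "(\<phi> 0 *\<^sub>v b) $ 0 = xpow u2" using ex[OF u(1)] ex[OF u(2)] by blast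
  have not_dvd: "\<not> mdvd u1 u2"
  proof
    assume "mdvd u1 u2"
    then obtain l where l: "u2 = u1 + l" by (auto simp: mdvd_iff)
    then have "mdeg l = 0" using deg[OF u(1)] deg[OF u(2)] by simp
    then show False using l u(3) by (simp add: mdeg_eq_0_iff)
  qed
  define z where "z = xpow u2 \<cdot>\<^sub>v a - xpow u1 \<cdot>\<^sub>v b"
  have zc: "z \<in> carrier_vec ?N0" using a b by (simp add: z_def)
  have "\<phi> 0 *\<^sub>v z = xpow u2 \<cdot>\<^sub>v (\<phi> 0 *\<^sub>v a) - xpow u1 \<cdot>\<^sub>v (\<phi> 0 *\<^sub>v b)"
    using a(1) b(1) by (simp add: z_def mult_minus_distrib_mat_vec[OF c0] mult_mat_vec_smult[OF c0])
  also have "\<dots> = 0\<^sub>v 1"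
    using c0 a(2) b(2) by (intro eq_vecI) (auto simp: xpow_mult add.commute simp del: index_mult_mat_vec)
  finally have "z \<in> mat_kernel (\<phi> 0)" using zc by (simp add: mat_kernel[OF c0])
  then obtain w where w: "w \<in> carrier_vec ?N1" "z = \<phi> 1 *\<^sub>v w"
    using im1 c1 by (auto simp: mat_image_def)
  have "lookup (\<Lambda> z) u2 = 1"
  proof -
    have "lookup (z $ c) u2 = lookup (a $ c) 0" if c: "c < ?N0" for c
    proof -
      have "lookup (xpow u1 * b $ c) u2 = 0"
        by (rule lookup_mult_eq_0) (use not_dvd in \<open>auto simp: mdvd_iff\<close>)
      moreover have "lookup (xpow u2 * a $ c) u2 = lookup (a $ c) 0"
        using lookup_xpow_mult_add[of u2 1 "a $ c" 0] by simp
      ultimately show ?thesis using a b c by (simp add: z_def lookup_minus)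
    qed
    then have "lookup (\<Lambda> z) u2 = (\<Sum>c<?N0. lookup (f c) u1 * lookup (a $ c) 0)"
      by (simp add: \<Lambda>_lookup)
    also have "\<dots> = (\<Sum>c<?N0. lookup (f c * a $ c) (u1 + 0))"
    proof (rule sum.cong[OF refl], rule lookup_mult_unique[symmetric])
      fix c l q assume c: "c \<in> {..<?N0}" "l \<in> keys (f c)" "q \<in> keys (a $ c)" "l + q = u1 + 0"
      then have "mdeg l = t" using fU(1) deg by simp
      moreover have "mdeg l + mdeg q = t" using c(4) deg[OF u(1)] by (metis add.right_neutral mdeg_add)
      ultimately have "q = 0" by (simp add: mdeg_eq_0_iff)
      then show "l = u1 \<and> q = 0" using c(4) by simp
    qed
    also have "\<dots> = lookup (xpow u1) u1"
      using mult0[OF a(1)] a(2) by (simp add: lookup_sum)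
    finally show ?thesis by simp
  qed
  moreover have "lookup (\<Lambda> z) u2 = 0"
  proof -
    have "lookup (\<Lambda> (col (\<phi> 1) s)) m = 0" if s: "s < ?N1" and m: "mdvd m u2" for s m
    proof (cases "mdeg m \<le> 1")
      case False
      have "lookup (f c) u1 * lookup (col (\<phi> 1) s $ c) m = 0" if c: "c < ?N0" for c
      proof (rule ccontr)
        assume nz: "lookup (f c) u1 * lookup (col (\<phi> 1) s $ c) m \<noteq> 0"
        then have "?d 0 ! c = int t" using fU(2)[OF c] by (auto simp: in_keys_iff)
        moreover have "\<phi> 1 $$ (c, s) \<in> graded_part (?d 1 ! s - ?d 0 ! c)"
          using g1 c s by (auto simp: graded_map_def)
        moreover have "m \<in> keys (\<phi> 1 $$ (c, s))" using nz c s c1 by (simp add: in_keys_iff)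
        ultimately have "int (mdeg m) = ?d 1 ! s - int t" by (auto simp: graded_part_def)
        then show False using bound[of "?d 1 ! s" 1] s False by simp
      qed
      then show ?thesis unfolding \<Lambda>_lookup by (intro sum.neutral) blast
    next
      case True
      have "col (\<phi> 1) s \<in> mat_kernel (\<phi> 0)" using col_in_mat_image[OF c1 s] im1 by simp
      then have ker: "\<phi> 0 *\<^sub>v col (\<phi> 1) s = 0\<^sub>v 1" and cc: "col (\<phi> 1) s \<in> carrier_vec ?N0"
        by (auto simp: mat_kernel[OF c0])
      \<comment> \<open>In multidegree \<open>u1 + m\<close> the only generator is \<open>u1\<close>.\<close>
      have "lookup (\<Lambda> (col (\<phi> 1) s)) m = (\<Sum>c<?N0. lookup (f c * col (\<phi> 1) s $ c) (u1 + m))"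
        unfolding \<Lambda>_lookup
      proof (rule sum.cong[OF refl], rule lookup_mult_unique[symmetric])
        fix c l q assume c: "c \<in> {..<?N0}" "l \<in> keys (f c)" "q \<in> keys (col (\<phi> 1) s $ c)" "l + q = u1 + m"
        have lU: "l \<in> U" using fU(1) c by simp
        have dvd: "mdvd l (u1 + m)" using c(4) by (metis mdvd_iff)
        have "l = u1"
        proof (cases "mdeg m = 1")
          case True
          then obtain v where v: "m = Poly_Mapping.single v 1" by (rule mdeg_1_cases)
          have "0 < lookup u2 v" using m unfolding v single_mdvd_iff .
          then show ?thesis using isolated[OF lU] dvd v by simp
        next
          case False
          then have "mdeg m = 0" using \<open>mdeg m \<le> 1\<close> by simp
          then have m0: "m = 0" by (simp add: mdeg_eq_0_iff)
          have "mdeg l + mdeg q = mdeg u1" using c(4) m0 by (metis add.right_neutral mdeg_add)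
          then have "q = 0" using deg[OF lU] deg[OF u(1)] by (simp add: mdeg_eq_0_iff)
          then show ?thesis using c(4) m0 by simp
        qed
        then show "l = u1 \<and> q = m" using c(4) by simp
      qed
      also have "\<dots> = 0" using mult0[OF cc] ker by (simp flip: lookup_sum)
      finally show ?thesis .
    qed
    note col0 = this
    have "\<Lambda> z = (\<Sum>s<?N1. \<Lambda> (col (\<phi> 1) s) * w $ s)"
    proof -
      have "\<Lambda> z = (\<Sum>c<?N0. \<Sum>s<?N1. Poly_Mapping.single 0 (lookup (f c) u1) * (col (\<phi> 1) s $ c * w $ s))"
        unfolding \<Lambda>_def sum_distrib_left[symmetric] w(2)
      proof (intro sum.cong refl arg_cong2[of _ _ _ _ "(*)"])
        fix c assume "c \<in> {..<?N0}"
        then show "(\<phi> 1 *\<^sub>v w) $ c = (\<Sum>s<?N1. col (\<phi> 1) s $ c * w $ s)"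
          using index_mult_mat_vec_sum[OF c1 w(1), of c] c1 by (simp del: index_mult_mat_vec)
      qed
      also have "\<dots> = (\<Sum>s<?N1. \<Lambda> (col (\<phi> 1) s) * w $ s)"
        by (subst sum.swap) (simp only: \<Lambda>_def sum_distrib_right mult.assoc)
      finally show ?thesis .
    qed
    then have "lookup (\<Lambda> z) u2 = (\<Sum>s<?N1. lookup (\<Lambda> (col (\<phi> 1) s) * w $ s) u2)"
      by (simp add: lookup_sum)
    also have "\<dots> = 0"
    proof (rule sum.neutral, safe, rule lookup_mult_eq_0)
      fix s l q assume "s < ?N1" "l \<in> keys (\<Lambda> (col (\<phi> 1) s))"
      then show "l + q \<noteq> u2" using col0[of s l] by (metis in_keys_iff mdvd_iff)
    qed
    finally show ?thesis .
  qed
  ultimately show False by simp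
qed

section \<open>The v-number of a monomial ideal\<close>

text \<open>
  The element \<open>h\<close>, a generator divided by a variable, has degree \<open>e - 1\<close>. By the exchange condition
  its colon ideal is generated by the variables that multiply \<open>h\<close> into \<open>U\<close>, and so is prime. No
  smaller degree is possible: a prime colon ideal contains the ideal, hence a variable, and this
  variable times the element is a nonzero element of the ideal, of degree at least \<open>e\<close>.
\<close>

lemma v_number_monomial_ideal:
  fixes U :: "('n::finite \<Rightarrow>\<^sub>0 nat) set"
  assumes I: "I = (ideal_gen (xpow ` U) :: ('n, 'k::field) mpoly set)"
    and deg: "\<And>u. u \<in> U \<Longrightarrow> mdeg u = e"
    and v: "v \<in> U" "v = h + Poly_Mapping.single z 1"
    and exch: "\<And>u. u \<in> U \<Longrightarrow> u \<noteq> v \<Longrightarrow> \<exists>a. h + Poly_Mapping.single a 1 \<in> U \<and> lookup h a < lookup u a"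
  shows "v_number I = enat (e - 1)"
proof -
  have e: "e = mdeg h + 1" using deg[OF v(1)] v(2) by simp
  let ?D = "{d. \<exists>f\<in>graded_part (int d). \<exists>P\<in>Ass I. ideal_colon I f = P}"
  have mem: "e - 1 \<in> ?D"
  proof -
    define V where "V = {a. h + Poly_Mapping.single a 1 \<in> U}"
    have "ideal_colon I (xpow h) = ideal_gen (Var ` V)"
    proof (intro subset_antisym subsetI)
      fix g assume g: "g \<in> ideal_colon I (xpow h)"
      have "\<exists>a\<in>V. 0 < lookup k a" if "k \<in> keys g" for k
      proof -
        have "k + h \<in> keys (g * xpow h)" using that by (simp add: in_keys_iff)
        then obtain u where u: "u \<in> U" "mdvd u (k + h)"
          using g by (auto simp: ideal_colon_def I ideal_gen_monomials)
        have "\<exists>a\<in>V. lookup h a < lookup u a"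
        proof (cases "u = v")
          case True
          then show ?thesis using v by (intro bexI[of _ z]) (auto simp: V_def lookup_add)
        next
          case False
          then show ?thesis using exch[OF u(1)] by (auto simp: V_def)
        qed
        then obtain a where a: "a \<in> V" "lookup h a < lookup u a" by blast
        have "lookup u a \<le> lookup k a + lookup h a" using u(2) by (simp add: mdvd_def lookup_add)
        then show ?thesis using a by force
      qed
      then show "g \<in> ideal_gen (Var ` V)" by (simp add: ideal_gen_Var)
    next
      fix g :: "('n, 'k) mpoly" assume g: "g \<in> ideal_gen (Var ` V)"
      have "\<exists>u\<in>U. mdvd u k" if k: "k \<in> keys (g * xpow h)" for k
      proof -
        obtain l where l: "l \<in> keys g" "k = l + h" using k by (auto elim!: keys_multE split: if_splits)
        then obtain a where a: "a \<in> V" "0 < lookup l a" using g by (auto simp: ideal_gen_Var)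
        then obtain q where q: "l = Poly_Mapping.single a 1 + q"
          using single_mdvd_iff mdvd_iff by metis
        have "k = (h + Poly_Mapping.single a 1) + q" using l q by (simp add: algebra_simps)
        then show ?thesis using a by (auto simp: V_def mdvd_iff)
      qed
      then show "g \<in> ideal_colon I (xpow h)" by (simp add: ideal_colon_def I ideal_gen_monomials)
    qed
    then have "ideal_colon I (xpow h) \<in> Ass I"
      using prime_ideal_Var[of V] by (auto simp: Ass_def)
    moreover have "xpow h \<in> graded_part (int (e - 1))" by (simp add: graded_part_def e)
    ultimately show ?thesis by blast
  qed
  have low: "e - 1 \<le> d" if "d \<in> ?D" for d
  proof -
    obtain f P where f: "f \<in> graded_part (int d)" "P \<in> Ass I" "ideal_colon I f = P" using \<open>d \<in> ?D\<close> by blast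
    then have P: "prime_ideal P" by (simp add: Ass_def)
    have idI: "is_ideal I" by (simp add: I)
    have "1 \<notin> P"
    proof
      assume "1 \<in> P"
      then have "P = UNIV" using P ring_mod.subspace_scale[of P 1] by (auto simp: prime_ideal_def)
      then show False using P by (simp add: prime_ideal_def)
    qed
    have xP: "xpow m \<in> P \<Longrightarrow> \<exists>a. Var a \<in> P" for m
    proof (induction "mdeg m" arbitrary: m)
      case 0
      then show ?case using \<open>1 \<notin> P\<close> by (simp add: mdeg_eq_0_iff)
    next
      case (Suc n)
      then have "m \<noteq> 0" by auto
      then obtain a where "0 < lookup m a" by (auto simp: poly_mapping_eq_iff fun_eq_iff)
      then obtain q where q: "m = Poly_Mapping.single a 1 + q" using single_mdvd_iff mdvd_iff by metis
      then have "Var a * xpow q \<in> P" using Suc.prems by (simp add: Var_eq xpow_mult)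
      then have "Var a \<in> P \<or> xpow q \<in> P" using P by (simp add: prime_ideal_def)
      moreover have "n = mdeg q" using Suc.hyps(2) q by simp
      ultimately show ?case using Suc.hyps(1) by blast
    qed
    have "xpow v * f \<in> I"
      using ring_mod.subspace_scale[OF idI, of "xpow v" f] v(1)
      by (metis I mult.commute ring_mod.span_base ring_mod.span_scale imageI)
    then have "xpow v \<in> P" using f(3) by (auto simp: ideal_colon_def)
    then obtain a where "Var a \<in> P" using xP by blast
    then have af: "Var a * f \<in> I" using f(3) by (auto simp: ideal_colon_def)
    have "f \<noteq> 0"
      using \<open>1 \<notin> P\<close> f(3) ring_mod.subspace_0[OF idI] by (auto simp: ideal_colon_def)
    then obtain k where k: "k \<in> keys f" by fastforce
    then have "Poly_Mapping.single a 1 + k \<in> keys (Var a * f)" unfolding Var_eq by (simp add: in_keys_iff)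
    then obtain u l where ul: "u \<in> U" "Poly_Mapping.single a 1 + k = u + l"
      using af unfolding I ideal_gen_monomials mdvd_iff by blast
    have "mdeg (Poly_Mapping.single a 1 + k) = mdeg u + mdeg l" unfolding ul(2) by simp
    moreover have "mdeg k = d" using f(1) k by (simp add: graded_part_def)
    ultimately show ?thesis using deg[OF ul(1)] by simp
  qed
  have "Inf (enat ` ?D) = enat (e - 1)"
  proof (rule antisym)
    show "Inf (enat ` ?D) \<le> enat (e - 1)" using mem by (intro Inf_lower imageI)
    show "enat (e - 1) \<le> Inf (enat ` ?D)"
    proof (rule INF_greatest)
      fix d assume "d \<in> ?D"
      from low[OF this] show "enat (e - 1) \<le> enat d" by simp
    qed
  qed
  then show ?thesis by (simp add: v_number_def)
qed

section \<open>Powers\<close>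

lemma ideal_mult_gen:
  "ideal_mult (ideal_gen A) (ideal_gen B) = ideal_gen {a * b | a b. a \<in> A \<and> b \<in> B}"
    (is "_ = ?R")
proof
  have 1: "a * b \<in> ?R" if a: "a \<in> A" and "b \<in> ideal_gen B" for a b
  proof -
    have "is_ideal {b. a * b \<in> ?R}"
    proof (rule is_idealI; unfold mem_Collect_eq)
      fix c x assume "a * x \<in> ?R"
      then have "c * (a * x) \<in> ?R" by (rule ring_mod.span_scale)
      then show "a * (c * x) \<in> ?R" by (simp only: mult.left_commute)
    qed (simp_all add: distrib_left ring_mod.span_zero ring_mod.span_add)
    then have "ideal_gen B \<subseteq> {b. a * b \<in> ?R}"
      by (intro ring_mod.span_minimal) (use a in \<open>auto intro: ring_mod.span_base\<close>)
    then show ?thesis using that by blast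
  qed
  have 2: "a * b \<in> ?R" if "a \<in> ideal_gen A" and b: "b \<in> ideal_gen B" for a b
  proof -
    have "is_ideal {a. a * b \<in> ?R}"
    proof (rule is_idealI; unfold mem_Collect_eq)
      fix c x assume "x * b \<in> ?R"
      then have "c * (x * b) \<in> ?R" by (rule ring_mod.span_scale)
      then show "c * x * b \<in> ?R" by (simp only: mult.assoc)
    qed (simp_all add: distrib_right ring_mod.span_zero ring_mod.span_add)
    then have "ideal_gen A \<subseteq> {a. a * b \<in> ?R}"
      by (intro ring_mod.span_minimal) (use 1 b in auto)
    then show ?thesis using that by blast
  qed
  show "ideal_mult (ideal_gen A) (ideal_gen B) \<subseteq> ?R"
    unfolding ideal_mult_def by (rule ring_mod.span_minimal) (use 2 in auto)
  show "?R \<subseteq> ideal_mult (ideal_gen A) (ideal_gen B)"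
    unfolding ideal_mult_def by (rule ring_mod.span_mono) (auto intro: ring_mod.span_base)
qed

text \<open>
  The lists of multiplicities of \<open>m\<close> generators in the products of \<open>k\<close> of them.
\<close>

definition weak_comps :: "nat \<Rightarrow> nat \<Rightarrow> nat list set" where
  "weak_comps m k = {cs. length cs = m \<and> sum_list cs = k}"

text \<open>
  The exponent of the product in which the generator with exponent \<open>E i\<close> occurs \<open>cs ! i\<close> times.
\<close>

definition expo :: "(nat \<Rightarrow> 'n::finite \<Rightarrow> nat) \<Rightarrow> nat list \<Rightarrow> ('n \<Rightarrow>\<^sub>0 nat)" where
  "expo E cs = expt (\<lambda>a. \<Sum>i<length cs. cs ! i * E i a)"

lemma expo_incr:
  assumes "i < length cs"
  shows "expo E (cs[i := Suc (cs ! i)]) = expt (E i) + expo E cs"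
proof (rule poly_mapping_eqI)
  fix a
  have "(\<Sum>j<length cs. cs[i := Suc (cs ! i)] ! j * E j a) =
      (\<Sum>j<length cs. (if j = i then E i a else 0) + cs ! j * E j a)"
    by (rule sum.cong) (auto simp: nth_list_update)
  then show "lookup (expo E (cs[i := Suc (cs ! i)])) a = lookup (expt (E i) + expo E cs) a"
    using assms by (simp add: expo_def lookup_add sum.distrib)
qed

lemma weak_comps_incr:
  assumes "cs \<in> weak_comps m k" "i < m"
  shows "cs[i := Suc (cs ! i)] \<in> weak_comps m (Suc k)"
  using assms by (auto simp: weak_comps_def sum_list_update)

lemma weak_comps_decr:
  assumes "cs \<in> weak_comps m k" "i < m" "0 < cs ! i"
  obtains bs where "bs \<in> weak_comps m (k - 1)" "cs = bs[i := Suc (bs ! i)]" "0 < k"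
    "bs = cs[i := cs ! i - 1]"
proof -
  have len: "length cs = m" and k: "sum_list cs = k" using assms by (auto simp: weak_comps_def)
  have le: "cs ! i \<le> k" using assms(2) member_le_sum_list[of "cs ! i" cs] len k by simp
  then have 1: "cs[i := cs ! i - 1] \<in> weak_comps m (k - 1)"
    using assms(2,3) len k by (auto simp: weak_comps_def sum_list_update)
  have 2: "cs = (cs[i := cs ! i - 1])[i := Suc ((cs[i := cs ! i - 1]) ! i)]"
    using assms(2,3) len by simp
  show ?thesis by (rule that[OF 1 2 _ refl]) (use le assms(3) in simp)
qed

lemma sum_weak_comps: "cs \<in> weak_comps m k \<Longrightarrow> (\<Sum>i<m. cs ! i) = k"
  by (auto simp: weak_comps_def sum_list_sum_nth lessThan_atLeast0)

lemma finite_weak_comps: "finite (weak_comps m k)"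
  by (rule finite_subset[OF _ finite_lists_length_eq[of "{..k}" m]])
    (auto simp: weak_comps_def member_le_sum_list)

lemma weak_comps_nonempty: "k # replicate m 0 \<in> weak_comps (Suc m) k"
  by (simp add: weak_comps_def sum_list_replicate)

lemma ideal_power_monomial_ideal:
  assumes I: "I = (ideal_gen (xpow ` (\<lambda>i. expt (E i)) ` {..<m}) :: ('n::finite, 'k::field) mpoly set)"
  shows "ideal_power I k = ideal_gen (xpow ` expo E ` weak_comps m k)"
proof (induction k)
  case 0
  have "expo E (replicate m 0) = 0"
    by (intro poly_mapping_eqI) (simp add: expo_def)
  moreover have "replicate m 0 \<in> weak_comps m 0" by (simp add: weak_comps_def sum_list_replicate)
  ultimately have "0 \<in> expo E ` weak_comps m 0" by (metis imageI)
  moreover have "mdvd 0 k" for k :: "'n \<Rightarrow>\<^sub>0 nat" by (simp add: mdvd_def)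
  ultimately have "(f :: ('n, 'k) mpoly) \<in> ideal_gen (xpow ` expo E ` weak_comps m 0)" for f
    unfolding ideal_gen_monomials by blast
  then show ?case by auto
next
  case (Suc k)
  let ?A = "(\<lambda>i. expt (E i)) ` {..<m}" and ?B = "expo E ` weak_comps m k"
  have "{a * b | a b. a \<in> xpow ` ?A \<and> b \<in> (xpow ` ?B :: ('n, 'k) mpoly set)} =
      xpow ` expo E ` weak_comps m (Suc k)" (is "?L = ?R")
  proof
    show "?L \<subseteq> ?R"
    proof (safe)
      fix i cs assume "i < m" "cs \<in> weak_comps m k"
      moreover from this have "expt (E i) + expo E cs = expo E (cs[i := Suc (cs ! i)])"
        by (simp add: expo_incr weak_comps_def)
      ultimately show "xpow (expt (E i)) * xpow (expo E cs) \<in> ?R"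
        using weak_comps_incr by (auto simp: xpow_mult)
    qed
    show "?R \<subseteq> ?L"
    proof (safe)
      fix cs assume cs: "cs \<in> weak_comps m (Suc k)"
      have "\<exists>i<m. 0 < cs ! i" using sum_weak_comps[OF cs] by (metis lessThan_iff nat.distinct(1) not_gr_zero sum.neutral)
      then obtain i where i: "i < m" "0 < cs ! i" by blast
      obtain bs where bs: "bs \<in> weak_comps m (Suc k - 1)" "cs = bs[i := Suc (bs ! i)]"
        by (rule weak_comps_decr[OF cs i])
      have "expo E cs = expt (E i) + expo E bs"
        unfolding bs(2) by (rule expo_incr) (use bs(1) i in \<open>simp add: weak_comps_def\<close>)
      then have "xpow (expo E cs) = xpow (expt (E i)) * (xpow (expo E bs) :: ('n, 'k) mpoly)"
        by (simp add: xpow_mult)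
      then show "\<exists>a b. (xpow (expo E cs) :: ('n, 'k) mpoly) = a * b \<and> a \<in> xpow ` ?A \<and> b \<in> xpow ` ?B"
        using i(1) bs(1) unfolding diff_Suc_1 by blast
    qed
  qed
  then show ?case unfolding ideal_power.simps(2) Suc.IH unfolding I ideal_mult_gen by (rule arg_cong)
qed

text \<open>
  In the product \<open>cs'\<close>, trading a factor \<open>j\<close> for the factor \<open>l\<close> replaces the variable \<open>b j\<close> by \<open>a\<close>.
  Since \<open>l\<close> comes after \<open>j\<close>, the new list precedes \<open>cs'\<close> in the lexicographic order. The variable that
  is given up must depend on \<open>j\<close> only: for \<open>j = 0\<close> it is the one by which the \<open>k\<close>-th power of the first
  generator is divided in the computation of the v-number.
\<close>

definition exchange_property :: "(nat \<Rightarrow> 'n::finite \<Rightarrow> nat) \<Rightarrow> nat \<Rightarrow> (nat \<Rightarrow> 'n) \<Rightarrow> bool" where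
  "exchange_property E m b \<longleftrightarrow> (\<forall>k. \<forall>cs\<in>weak_comps m k. \<forall>cs'\<in>weak_comps m k. \<forall>j<m.
     (\<forall>i<j. cs ! i = cs' ! i) \<longrightarrow> cs ! j < cs' ! j \<longrightarrow>
     (\<exists>l a. j < l \<and> l < m \<and>
        expt (E l) + Poly_Mapping.single (b j) 1 = expt (E j) + Poly_Mapping.single a 1 \<and>
        lookup (expo E cs') a < lookup (expo E cs) a))"

lemma mdeg_expo:
  assumes "\<And>i. i < m \<Longrightarrow> mdeg (expt (E i)) = t" "cs \<in> weak_comps m k"
  shows "mdeg (expo E cs) = t * k"
proof -
  have "mdeg (expo E cs) = (\<Sum>i<m. cs ! i * (\<Sum>a\<in>UNIV. E i a))"
    using assms(2) unfolding mdeg_def expo_def lookup_expt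
    by (subst sum.swap) (simp add: weak_comps_def sum_distrib_left)
  also have "\<dots> = (\<Sum>i<m. t * cs ! i)"
    using assms(1) by (intro sum.cong) (simp_all add: mdeg_def)
  finally show ?thesis using sum_weak_comps[OF assms(2)] by (simp flip: sum_distrib_left)
qed

lemma list_less_first_difference:
  fixes xs ys :: "'a::order list"
  assumes "length xs = length ys"
  shows "xs < ys \<longleftrightarrow> (\<exists>j<length xs. (\<forall>i<j. xs ! i = ys ! i) \<and> xs ! j < ys ! j)"
proof -
  have "take j xs = take j ys \<longleftrightarrow> (\<forall>i<j. xs ! i = ys ! i)" if "j < length xs" for j
    using that assms by (auto simp: list_eq_iff_nth_eq)
  then show ?thesis
    using assms by (auto simp: list_less_def lexord_take_index_conv)
qed

text \<open>
  Sorted by their lists of multiplicities, the products have linear quotients. For an earlier and a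
  later product the exchange property yields a variable that occurs to a higher power in the earlier
  one, and trading a factor of the later product shows that this variable lies in the colon ideal.
\<close>

lemma has_linear_resolution_power:
  fixes E :: "nat \<Rightarrow> 'n::finite \<Rightarrow> nat"
  assumes I: "I = (ideal_gen (xpow ` (\<lambda>i. expt (E i)) ` {..<m}) :: ('n, 'k::field) mpoly set)"
    and m: "0 < m" and deg: "\<And>i. i < m \<Longrightarrow> mdeg (expt (E i)) = t"
    and exch: "exchange_property E m b"
  shows "has_linear_resolution (ideal_power I k)"
proof (rule has_linear_resolution_linear_quotients)
  let ?W = "weak_comps m k"
  define xs where "xs = sorted_list_of_set ?W"
  have set_xs: "set xs = ?W" and len: "length xs = card ?W" and sorted: "sorted_wrt (<) xs"
    using finite_weak_comps by (auto simp: xs_def)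
  show "ideal_power I k = ideal_gen (xpow ` set (map (expo E) xs))"
    using ideal_power_monomial_ideal[OF I] by (simp add: set_xs)
  obtain m' where "m = Suc m'" using m by (cases m) auto
  then have "?W \<noteq> {}" using weak_comps_nonempty by blast
  then show "map (expo E) xs \<noteq> []" using set_xs by auto
  show "mdeg u = t * k" if "u \<in> set (map (expo E) xs)" for u
    using that mdeg_expo[OF deg] by (auto simp: set_xs)
  fix i j assume "i < length (map (expo E) xs)" and ji: "j < i"
  then have i: "i < length xs" by simp
  let ?c = "xs ! j" and ?c' = "xs ! i"
  have c: "?c \<in> ?W" "?c' \<in> ?W" using i ji nth_mem[of _ xs] set_xs by auto
  then have lens: "length ?c = m" "length ?c' = m" by (auto simp: weak_comps_def)
  have "?c < ?c'" using sorted_wrt_nth_less[OF sorted ji i] .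
  then obtain p where p: "p < m" "\<forall>i<p. ?c ! i = ?c' ! i" "?c ! p < ?c' ! p"
    using list_less_first_difference[of ?c ?c'] lens by auto
  then obtain l a where l: "p < l" "l < m"
    "expt (E l) + Poly_Mapping.single (b p) 1 = expt (E p) + Poly_Mapping.single a 1"
    "lookup (expo E ?c') a < lookup (expo E ?c) a"
    using exch c unfolding exchange_property_def by meson
  \<comment> \<open>Replacing one factor \<open>p\<close> of the later product by \<open>l\<close> gives an earlier product.\<close>
  have "0 < ?c' ! p" using p(3) by simp
  then obtain bs where bs: "bs \<in> weak_comps m (k - 1)" "?c' = bs[p := Suc (bs ! p)]" "0 < k"
    "bs = ?c'[p := ?c' ! p - 1]" by (rule weak_comps_decr[OF c(2) p(1)])
  have bl: "length bs = m" using bs(1) by (simp add: weak_comps_def)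
  let ?c2 = "bs[l := Suc (bs ! l)]"
  have "?c2 \<in> ?W" using weak_comps_incr[OF bs(1) l(2)] bs(3) by simp
  then obtain q where q: "q < length xs" "xs ! q = ?c2" using set_xs by (metis in_set_conv_nth)
  have "?c2 < ?c'"
    using list_less_first_difference[of ?c2 ?c'] lens bl p(1) l(1) bs(4) \<open>0 < ?c' ! p\<close>
    by (auto simp: nth_list_update intro!: exI[of _ p])
  then have "q < i"
    using sorted_wrt_nth_less[OF sorted, of i q] q i by (metis less_asym linorder_neqE_nat order_less_irrefl)
  moreover have "mdvd (expo E ?c2) (expo E ?c' + Poly_Mapping.single a 1)"
  proof -
    have "expo E ?c' + Poly_Mapping.single a 1 = expo E bs + (expt (E p) + Poly_Mapping.single a 1)"
      using expo_incr[of p bs E] p(1) bl bs(2) by (simp add: algebra_simps)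
    also have "\<dots> = expo E ?c2 + Poly_Mapping.single (b p) 1"
      unfolding l(3)[symmetric] using expo_incr[of l bs E] l(2) bl by (simp add: algebra_simps)
    finally show ?thesis by (auto simp: mdvd_iff)
  qed
  ultimately show "\<exists>l<i. \<exists>a. mdvd (map (expo E) xs ! l) (map (expo E) xs ! i + Poly_Mapping.single a 1) \<and>
      lookup (map (expo E) xs ! i) a < lookup (map (expo E) xs ! j) a"
    using q(1) i ji l(4) q(2) by (intro exI[of _ q] conjI exI[of _ a]) auto
qed

text \<open>
  Among all products of \<open>k\<close> generators the \<open>k\<close>-th power of the first one has the lexicographically
  largest list of multiplicities. So every other product first differs from it at position 0, and the
  exchange property trades the first generator.
\<close>

lemma v_number_power:
  fixes E :: "nat \<Rightarrow> 'n::finite \<Rightarrow> nat"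
  assumes I: "I = (ideal_gen (xpow ` (\<lambda>i. expt (E i)) ` {..<m}) :: ('n, 'k::field) mpoly set)"
    and m: "0 < m" and deg: "\<And>i. i < m \<Longrightarrow> mdeg (expt (E i)) = t"
    and exch: "exchange_property E m b" and b0: "0 < E 0 (b 0)" and k: "1 \<le> k"
  shows "v_number (ideal_power I k) = enat (t * k - 1)"
proof -
  obtain m' where m': "m = Suc m'" using m by (cases m) auto
  let ?c = "k # replicate m' 0" and ?d = "(k - 1) # replicate m' 0"
  have cW: "?c \<in> weak_comps m k" and dW: "?d \<in> weak_comps m (k - 1)"
    using weak_comps_nonempty by (auto simp: m')
  have "expo E (?d[0 := Suc (?d ! 0)]) = expt (E 0) + expo E ?d" by (rule expo_incr) simp
  then have cd: "expo E ?c = expt (E 0) + expo E ?d" using k by simp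
  have "mdvd (Poly_Mapping.single (b 0) 1) (expt (E 0))" using b0 unfolding single_mdvd_iff by simp
  then obtain r where r: "expt (E 0) = Poly_Mapping.single (b 0) 1 + r" by (auto simp: mdvd_iff)
  define h where "h = r + expo E ?d"
  have ch: "expo E ?c = h + Poly_Mapping.single (b 0) 1" unfolding cd r h_def by (simp add: algebra_simps)
  show ?thesis
  proof (rule v_number_monomial_ideal[OF ideal_power_monomial_ideal[OF I] _ _ ch])
    show "expo E ?c \<in> expo E ` weak_comps m k" using cW by blast
    show "mdeg u = t * k" if "u \<in> expo E ` weak_comps m k" for u
      using that mdeg_expo[OF deg] by auto
    fix u assume "u \<in> expo E ` weak_comps m k" "u \<noteq> expo E ?c"
    then obtain cs where cs: "u = expo E cs" "cs \<in> weak_comps m k" "cs \<noteq> ?c" by blast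
    obtain y ys where ys: "cs = y # ys" "length ys = m'"
      using cs(2) by (cases cs) (auto simp: weak_comps_def m')
    have "y < k"
    proof (rule ccontr)
      assume "\<not> y < k"
      then have "y = k" "sum_list ys = 0" using cs(2) ys by (auto simp: weak_comps_def)
      then have "ys = replicate m' 0" using ys(2) by (auto intro!: replicate_eqI)
      then show False using cs(3) ys(1) \<open>y = k\<close> by simp
    qed
    then have "cs ! 0 < ?c ! 0" by (simp add: ys)
    then obtain l a where l: "0 < l" "l < m"
      "expt (E l) + Poly_Mapping.single (b 0) 1 = expt (E 0) + Poly_Mapping.single a 1"
      "lookup (expo E ?c) a < lookup (expo E cs) a"
      using exch cs(2) cW m unfolding exchange_property_def by (meson not_less_zero)
    have "h + Poly_Mapping.single a 1 + Poly_Mapping.single (b 0) 1 =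
        expt (E l) + expo E ?d + Poly_Mapping.single (b 0) 1"
    proof -
      have "h + Poly_Mapping.single a 1 + Poly_Mapping.single (b 0) 1 =
          (expt (E 0) + Poly_Mapping.single a 1) + expo E ?d"
        by (simp add: h_def r algebra_simps)
      then show ?thesis unfolding l(3)[symmetric] by (simp add: algebra_simps)
    qed
    then have "h + Poly_Mapping.single a 1 = expt (E l) + expo E ?d" by simp
    also have "\<dots> = expo E (?d[l := Suc (?d ! l)])"
      by (rule expo_incr[symmetric]) (use l(2) m' in simp)
    also have "\<dots> \<in> expo E ` weak_comps m k"
      using weak_comps_incr[OF dW l(2)] k by (metis Suc_diff_1 imageI less_eq_Suc_le One_nat_def)
    finally have "h + Poly_Mapping.single a 1 \<in> expo E ` weak_comps m k" .
    moreover have "lookup h a < lookup u a" using l(4) unfolding ch cs(1) by (simp add: lookup_add)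
    ultimately show "\<exists>a. h + Poly_Mapping.single a 1 \<in> expo E ` weak_comps m k \<and> lookup h a < lookup u a"
      by blast
  qed
qed

section \<open>Path ideals of path graphs\<close>

lemma prod_Var:
  "finite S \<Longrightarrow> (\<Prod>a\<in>S. Var a) = (xpow (expt (\<lambda>a. if a \<in> S then 1 else 0)) :: ('n::finite, 'k::field) mpoly)"
proof (induction S rule: finite_induct)
  case empty
  have "expt (\<lambda>_ :: 'n. 0) = 0" by (intro poly_mapping_eqI) simp
  then show ?case by simp
next
  case (insert b S)
  have "Poly_Mapping.single b 1 + expt (\<lambda>a. if a \<in> S then 1 else 0) =
      expt (\<lambda>a. if a \<in> insert b S then 1 else 0)"
    using insert.hyps by (intro poly_mapping_eqI) (auto simp: lookup_add lookup_single when_def)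
  then show ?case using insert by (simp add: Var_eq xpow_mult)
qed

text \<open>
  A path in the path graph cannot turn around, so it runs through an interval in one of the two
  directions. For the induction it matters that its first vertex is an end of the interval.
\<close>

lemma neighbouring_list_interval:
  fixes js :: "nat list"
  assumes "js \<noteq> []" "distinct js" "successively (\<lambda>p q. q = Suc p \<or> p = Suc q) js"
  shows "\<exists>i. set js = {i..<i + length js} \<and> (hd js = i \<or> hd js = i + length js - 1)"
  using assms
proof (induction js)
  case (Cons p js)
  show ?case
  proof (cases js)
    case Nil
    then show ?thesis by (intro exI[of _ p]) auto
  next
    case (Cons q ks)
    have pq: "q = Suc p \<or> p = Suc q" using Cons.prems(3) Cons by simp
    obtain i where i: "set js = {i..<i + length js}" "hd js = i \<or> hd js = i + length js - 1"
      using Cons.IH Cons.prems Cons by auto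
    have p: "p \<notin> {i..<i + length js}" using Cons.prems(2) i(1) by simp
    have "q \<in> {i..<i + length js}" using i(1) Cons by auto
    then consider "Suc p = i" | "p = i + length js" using pq p by force
    then show ?thesis
    proof cases
      case 1
      have "insert p {Suc p..<Suc p + length js} = {p..<p + Suc (length js)}" by force
      then have "set (p # js) = {p..<p + length (p # js)}" unfolding set_simps i(1) 1[symmetric] by simp
      then show ?thesis by (intro exI[of _ p]) simp
    next
      case 2
      have "insert (i + length js) {i..<i + length js} = {i..<i + Suc (length js)}" by force
      then have "set (p # js) = {i..<i + length (p # js)}" unfolding set_simps i(1) 2 by simp
      then show ?thesis using 2 by (intro exI[of _ i]) simp
    qed
  qed
qed simp

locale numbered_path =
  fixes n t :: nat and x :: "nat \<Rightarrow> 'n::finite"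
  assumes t: "1 \<le> t" "t \<le> n" and bij: "bij_betw x {1..n} UNIV"
begin

lemma x_eq_iff [simp]: "p \<in> {1..n} \<Longrightarrow> q \<in> {1..n} \<Longrightarrow> x p = x q \<longleftrightarrow> p = q"
  using bij inj_on_eq_iff[of x "{1..n}" p q] by (simp add: bij_betw_def)

lemma x_cases: obtains p where "p \<in> {1..n}" "a = x p"
proof -
  have "a \<in> x ` {1..n}" using bij by (simp add: bij_betw_def)
  then show ?thesis using that by blast
qed

definition m :: nat where "m = Suc n - t"

lemma m_pos: "0 < m" and m_plus_t: "m + t = Suc n"
  using t by (simp_all add: m_def)

definition E :: "nat \<Rightarrow> 'n \<Rightarrow> nat" where
  "E i a = (if a \<in> x ` {Suc i..i + t} then 1 else 0)"

lemma E_x: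
  assumes "i < m" "p \<in> {1..n}"
  shows "E i (x p) = (if Suc i \<le> p \<and> p \<le> i + t then 1 else 0)"
proof -
  have "{Suc i..i + t} \<subseteq> {1..n}" using assms(1) m_plus_t by auto
  then have "x p \<in> x ` {Suc i..i + t} \<longleftrightarrow> p \<in> {Suc i..i + t}"
    using inj_on_image_mem_iff[of x "{1..n}" p] bij assms(2) by (simp add: bij_betw_def)
  then show ?thesis by (simp add: E_def)
qed

lemma edge_iff:
  assumes "p \<in> {1..n}" "q \<in> {1..n}"
  shows "{x p, x q} \<in> path_graph x n \<longleftrightarrow> q = Suc p \<or> p = Suc q"
proof
  assume "{x p, x q} \<in> path_graph x n"
  then obtain i where i: "{x p, x q} = {x i, x (Suc i)}" "1 \<le> i" "i < n"
    by (auto simp: path_graph_def)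
  then show "q = Suc p \<or> p = Suc q" using assms by (auto simp: doubleton_eq_iff)
next
  assume "q = Suc p \<or> p = Suc q"
  then show "{x p, x q} \<in> path_graph x n"
    using assms by (auto simp: path_graph_def insert_commute)
qed

lemma path_vertex_sets:
  "{set vs | vs. is_path (path_graph x n) vs \<and> length vs = t} = (\<lambda>i. x ` {Suc i..i + t}) ` {..<m}"
    (is "?L = ?R")
proof
  show "?L \<subseteq> ?R"
  proof
    fix S assume "S \<in> ?L"
    then obtain vs where vs: "S = set vs" "is_path (path_graph x n) vs" "length vs = t" by blast
    define y where "y = inv_into {1..n} x"
    have range: "a \<in> x ` {1..n}" for a using bij by (simp add: bij_betw_def)
    have y: "y a \<in> {1..n}" "x (y a) = a" for a
      unfolding y_def by (rule inv_into_into[OF range], rule f_inv_into_f[OF range])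
    define js where "js = map y vs"
    have xj: "map x js = vs" by (simp add: js_def o_def y(2) map_idI)
    have d: "distinct vs" "successively (\<lambda>a b. {a, b} \<in> path_graph x n) vs"
      using vs(2) by (simp_all add: is_path_def)
    have "js \<noteq> []" using t vs(3) by (auto simp: js_def)
    moreover have "distinct js"
      using d(1)[folded xj] by (simp add: distinct_map)
    moreover have "successively (\<lambda>p q. q = Suc p \<or> p = Suc q) js"
    proof -
      have "successively (\<lambda>p q. {x p, x q} \<in> path_graph x n) js"
        using d(2)[folded xj] by (simp add: successively_map)
      then show ?thesis
        by (rule successively_mono) (use y(1) edge_iff in \<open>auto simp: js_def\<close>)
    qed
    ultimately obtain i where i: "set js = {i..<i + t}"
      using neighbouring_list_interval[of js] vs(3) by (auto simp: js_def)
    have "set js \<subseteq> {1..n}" using y(1) by (auto simp: js_def)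
    then have "{i..<i + t} \<subseteq> {1..n}" unfolding i .
    then have "i \<in> {1..n}" "i + t - 1 \<in> {1..n}" using t by (auto simp: subset_iff)
    then have "i - 1 < m" "{i..<i + t} = {Suc (i - 1)..i - 1 + t}" using m_plus_t t by auto
    moreover have "S = x ` set js" using vs(1) xj by (metis list.set_map)
    ultimately show "S \<in> ?R" using i by auto
  qed
  show "?R \<subseteq> ?L"
  proof (safe)
    fix i assume i: "i < m"
    define js where "js = [Suc i..<Suc i + t]"
    have js: "set js = {Suc i..i + t}" by (auto simp: js_def)
    then have sub: "set js \<subseteq> {1..n}" using i m_plus_t by auto
    have "successively (\<lambda>p q. q = Suc p) [a..<a + l]" for a l
      by (simp add: successively_conv_nth)
    then have "successively (\<lambda>p q. {x p, x q} \<in> path_graph x n) js"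
      unfolding js_def by (rule successively_mono) (use sub edge_iff in \<open>auto simp: js_def\<close>)
    moreover have "inj_on x (set js)" using bij sub by (meson bij_betw_imp_inj_on inj_on_subset)
    ultimately have "is_path (path_graph x n) (map x js)"
      by (simp add: is_path_def successively_map distinct_map js_def)
    then show "\<exists>vs. x ` {Suc i..i + t} = set vs \<and> is_path (path_graph x n) vs \<and> length vs = t"
      by (intro exI[of _ "map x js"]) (simp add: js[symmetric] js_def)
  qed
qed

lemma path_ideal_monomial:
  "path_ideal t (path_graph x n) = (ideal_gen (xpow ` (\<lambda>i. expt (E i)) ` {..<m}) :: ('n, 'k::field) mpoly set)"
proof -
  have "{\<Prod>a\<in>set vs. Var a | vs. is_path (path_graph x n) vs \<and> length vs = t} =
      (\<lambda>S. \<Prod>a\<in>S. Var a :: ('n, 'k) mpoly) ` {set vs | vs. is_path (path_graph x n) vs \<and> length vs = t}"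
    by (simp add: setcompr_eq_image image_image)
  also have "\<dots> = xpow ` (\<lambda>i. expt (E i)) ` {..<m}"
    unfolding path_vertex_sets image_image by (simp add: prod_Var E_def[abs_def])
  finally show ?thesis unfolding path_ideal_def by simp
qed

lemma mdeg_E:
  assumes "i < m" shows "mdeg (expt (E i)) = t"
proof -
  have "inj_on x {Suc i..i + t}"
    using bij assms m_plus_t by (auto intro: inj_on_subset simp: bij_betw_def)
  then have "card (x ` {Suc i..i + t}) = t" by (simp add: card_image)
  moreover have "mdeg (expt (E i)) = card (x ` {Suc i..i + t})"
    by (simp add: mdeg_def E_def sum.If_cases)
  ultimately show ?thesis by simp
qed

lemma expo_x:
  "cs \<in> weak_comps m k \<Longrightarrow> p \<in> {1..n} \<Longrightarrow>
    lookup (expo E cs) (x p) = (\<Sum>i<m. if Suc i \<le> p \<and> p \<le> i + t then cs ! i else 0)"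
  by (auto simp: expo_def weak_comps_def E_x intro!: sum.cong)

text \<open>
  For \<open>t = 1\<close> the generators are the variables, and some later one must occur more often in the
  smaller list. For \<open>n \<le> 2 * t\<close> the factor \<open>j\<close> is traded for \<open>j + 1\<close>, that is, the variable \<open>j + 1\<close>
  for \<open>j + 1 + t\<close>; since there are at most \<open>t + 1\<close> generators, this variable divides exactly the
  generators after \<open>j\<close>, and the smaller list has more of these.
\<close>

lemma exchange_property_E:
  assumes good: "t = 1 \<or> n \<le> 2 * t"
  shows "exchange_property E m (\<lambda>j. x (Suc j))"
  unfolding exchange_property_def
proof (intro allI ballI impI)
  fix k cs cs' j
  assume cs: "cs \<in> weak_comps m k" "cs' \<in> weak_comps m k" and j: "j < m"
    and eq: "\<forall>i<j. cs ! i = cs' ! i" and lt: "cs ! j < cs' ! j"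
  have low: "(\<Sum>i<Suc j. cs ! i) < (\<Sum>i<Suc j. cs' ! i)" using eq lt by simp
  have jn: "Suc j \<in> {1..n}" using j m_plus_t t by auto
  show "\<exists>l a. j < l \<and> l < m \<and>
      expt (E l) + Poly_Mapping.single (x (Suc j)) 1 = expt (E j) + Poly_Mapping.single a 1 \<and>
      lookup (expo E cs') a < lookup (expo E cs) a"
    using good
  proof
    assume t1: "t = 1"
    have "\<exists>l<m. cs' ! l < cs ! l"
    proof (rule ccontr)
      assume "\<not> ?thesis"
      then have "\<And>l. l \<in> {..<m} \<Longrightarrow> cs ! l \<le> cs' ! l" by force
      then have "(\<Sum>i<m. cs ! i) < (\<Sum>i<m. cs' ! i)" using j lt by (intro sum_strict_mono_ex1) auto
      then show False using cs sum_weak_comps by simp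
    qed
    then obtain l where l: "l < m" "cs' ! l < cs ! l" by blast
    have jl: "j < l" using l(2) eq lt by (metis less_asym linorder_neqE_nat order_less_irrefl)
    have ln: "Suc l \<in> {1..n}" using l m_plus_t t by auto
    have val: "lookup (expo E ds) (x (Suc l)) = ds ! l" if "ds \<in> weak_comps m k" for ds
    proof -
      have "(\<Sum>i<m. if Suc i \<le> Suc l \<and> Suc l \<le> i + t then ds ! i else 0) = (\<Sum>i<m. if i = l then ds ! i else 0)"
        using t1 by (intro sum.cong) auto
      then show ?thesis using expo_x[OF that ln] l(1) by simp
    qed
    have single: "{Suc i..i + t} = {Suc i}" for i using t1 by simp
    have E1: "E i a = (if a = x (Suc i) then 1 else 0)" for i a unfolding E_def single by simp
    have "expt (E l) + Poly_Mapping.single (x (Suc j)) 1 = expt (E j) + Poly_Mapping.single (x (Suc l)) 1"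
      by (intro poly_mapping_eqI) (auto simp: lookup_add lookup_single when_def E1)
    then show ?thesis using jl l val cs by (intro exI[of _ l] exI[of _ "x (Suc l)"]) simp
  next
    assume n2: "n \<le> 2 * t"
    have jm: "Suc j < m"
    proof (rule ccontr)
      assume "\<not> Suc j < m"
      then have "Suc j = m" using j by simp
      then show False using low cs sum_weak_comps by simp
    qed
    let ?p = "Suc j + t"
    have pn: "?p \<in> {1..n}" using jm m_plus_t by auto
    have val: "lookup (expo E ds) (x ?p) + (\<Sum>i<Suc j. ds ! i) = k" if "ds \<in> weak_comps m k" for ds
    proof -
      have "(\<Sum>i<m. if Suc i \<le> ?p \<and> ?p \<le> i + t then ds ! i else 0) =
          (\<Sum>i<m. if Suc j \<le> i then ds ! i else 0)"
        using n2 m_plus_t by (intro sum.cong) auto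
      also have "\<dots> = (\<Sum>i\<in>{Suc j..<m}. ds ! i)"
        by (rule sum.mono_neutral_cong_right) auto
      finally have "lookup (expo E ds) (x ?p) = (\<Sum>i\<in>{Suc j..<m}. ds ! i)" using expo_x[OF that pn] by simp
      moreover have "(\<Sum>i<m. ds ! i) = (\<Sum>i<Suc j. ds ! i) + (\<Sum>i\<in>{Suc j..<m}. ds ! i)"
        using jm sum.atLeastLessThan_concat[of 0 "Suc j" m "(!) ds"] by (simp add: lessThan_atLeast0)
      ultimately show ?thesis using sum_weak_comps[OF that] by simp
    qed
    have "expt (E (Suc j)) + Poly_Mapping.single (x (Suc j)) 1 = expt (E j) + Poly_Mapping.single (x ?p) 1"
    proof (rule poly_mapping_eqI)
      fix a
      obtain q where q: "q \<in> {1..n}" "a = x q" by (rule x_cases)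
      have "(if x (Suc j) = a then 1 else 0) = (if Suc j = q then 1 else (0::nat))"
        "(if x ?p = a then 1 else 0) = (if ?p = q then 1 else (0::nat))"
        unfolding q(2) x_eq_iff[OF jn q(1)] x_eq_iff[OF pn q(1)] by simp_all
      then show "lookup (expt (E (Suc j)) + Poly_Mapping.single (x (Suc j)) 1) a =
          lookup (expt (E j) + Poly_Mapping.single (x ?p) 1) a"
        unfolding lookup_add lookup_single when_def lookup_expt
        using E_x[OF j q(1)] E_x[OF jm q(1)] t(1) by (auto simp: q(2))
    qed
    moreover have "lookup (expo E cs') (x ?p) < lookup (expo E cs) (x ?p)"
      using val[OF cs(1)] val[OF cs(2)] low by linarith
    ultimately show ?thesis using jm by (intro exI[of _ "Suc j"] exI[of _ "x ?p"]) simp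
  qed
qed

text \<open>
  The vertex \<open>t + 1\<close> separates the paths that start at \<open>1\<close> and at \<open>t + 2\<close>. A path whose vertices lie
  on the first one, apart from possibly one vertex of the second, avoids \<open>t + 1\<close>. So it is the first
  path, or it consists of that one vertex, which is impossible for \<open>t \<ge> 2\<close>.
\<close>

lemma path_ideal_not_linear:
  assumes "2 \<le> t" "2 * t < n"
  shows "\<not> has_linear_resolution (path_ideal t (path_graph x n) :: ('n, 'k::field) mpoly set)"
proof (rule not_has_linear_resolution[OF path_ideal_monomial])
  have m: "Suc t < m" using assms(2) m_plus_t by linarith
  show "expt (E 0) \<in> (\<lambda>i. expt (E i)) ` {..<m}" "expt (E (Suc t)) \<in> (\<lambda>i. expt (E i)) ` {..<m}"
    using m by auto
  show "mdeg u = t" if "u \<in> (\<lambda>i. expt (E i)) ` {..<m}" for u using that mdeg_E by auto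
  have 1: "1 \<in> {1..n}" using t by simp
  have "E 0 (x 1) \<noteq> E (Suc t) (x 1)" using E_x[OF m_pos 1] E_x[OF m 1] t by simp
  then show "expt (E 0) \<noteq> expt (E (Suc t))" by (metis lookup_expt)
  fix u a
  assume "u \<in> (\<lambda>i. expt (E i)) ` {..<m}" "0 < lookup (expt (E (Suc t))) a"
    and dvd: "mdvd u (expt (E 0) + Poly_Mapping.single a 1)"
  then obtain i where i: "i < m" "u = expt (E i)" by auto
  obtain p where p: "p \<in> {1..n}" "a = x p" by (rule x_cases)
  have pt: "Suc t < p" using \<open>0 < lookup (expt (E (Suc t))) a\<close> E_x[OF m p(1)] p(2) by (simp split: if_splits)
  \<comment> \<open>Every vertex of the path \<open>i\<close> lies on the first path or is \<open>p\<close>.\<close>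
  have vert: "q \<le> t \<or> q = p" if "q \<in> {Suc i..i + t}" for q
  proof -
    have q: "q \<in> {1..n}" using that i(1) m_plus_t by auto
    have "lookup u (x q) \<le> lookup (expt (E 0) + Poly_Mapping.single a 1) (x q)"
      using dvd by (simp only: mdvd_def)
    then have "1 \<le> (if q \<le> t then 1 else 0) + (if p = q then 1 else (0::nat))"
      using that q i p E_x[OF i(1) q] E_x[OF m_pos q]
      by (simp add: lookup_add lookup_single when_def split: if_splits)
    then show ?thesis by (auto split: if_splits)
  qed
  have "i = 0"
  proof (rule ccontr)
    assume "i \<noteq> 0"
    show False
    proof (cases "i \<le> t")
      case True
      then show False using vert[of "Suc t"] pt \<open>i \<noteq> 0\<close> by auto
    next
      case False
      then show False using vert[of "Suc i"] vert[of "Suc (Suc i)"] assms(1) by auto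
    qed
  qed
  then show "u = expt (E 0)" by (simp add: i(2))
qed

end

lemma ideal_power_1:
  assumes "is_ideal I"
  shows "ideal_power I 1 = I"
proof -
  have "{a * b | a b. a \<in> I \<and> b \<in> (UNIV :: 'a set)} \<subseteq> I"
    using ring_mod.subspace_scale[OF assms] by (auto simp: mult.commute)
  moreover have "I \<subseteq> {a * b | a b. a \<in> I \<and> b \<in> UNIV}"
  proof
    fix a assume "a \<in> I"
    then have "a = a * 1 \<and> a \<in> I \<and> 1 \<in> (UNIV :: 'a set)" by simp
    then show "a \<in> {a * b | a b. a \<in> I \<and> b \<in> UNIV}" by blast
  qed
  ultimately have "{a * b | a b. a \<in> I \<and> b \<in> UNIV} = I" by blast
  then show ?thesis using assms by (simp add: ideal_mult_def)
qed

theorem corollary4p4: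
  fixes n t :: nat
    and x :: "nat \<Rightarrow> 'n::finite"
    and I :: "('n, 'k::field) mpoly set"
  assumes "1 \<le> t" and "t \<le> n"
    and "bij_betw x {1..n} UNIV"
    and "I = path_ideal t (path_graph x n)"
  shows "(has_linear_resolution I \<longleftrightarrow> has_linear_powers I) \<and>
    (has_linear_resolution I \<longrightarrow>
      (\<forall>k\<ge>1. v_number (ideal_power I k) = enat (alpha I * k - 1)))"
proof -
  interpret numbered_path n t x by unfold_locales (use assms in auto)
  have I: "I = ideal_gen (xpow ` (\<lambda>i. expt (E i)) ` {..<m})"
    unfolding assms(4) by (rule path_ideal_monomial)
  have "is_ideal I" by (simp add: I)
  then have powers: "has_linear_powers I \<Longrightarrow> has_linear_resolution I"
    unfolding has_linear_powers_def by (metis ideal_power_1 le_refl)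
  have alpha: "alpha I = t"
    by (rule alpha_monomial_ideal[OF I]) (use m_pos mdeg_E in auto)
  have "has_linear_powers I \<and> (\<forall>k\<ge>1. v_number (ideal_power I k) = enat (alpha I * k - 1))"
    if lin: "has_linear_resolution I"
  proof -
    have "\<not> (2 \<le> t \<and> 2 * t < n)" using lin path_ideal_not_linear assms(4) by blast
    then have "t = 1 \<or> n \<le> 2 * t" using t by linarith
    then have exch: "exchange_property E m (\<lambda>j. x (Suc j))" by (rule exchange_property_E)
    have E0: "0 < E 0 (x (Suc 0))" using E_x[OF m_pos, of 1] t by simp
    have "v_number (ideal_power I k) = enat (alpha I * k - 1)" if "1 \<le> k" for k
      unfolding alpha by (rule v_number_power[OF I m_pos mdeg_E exch E0 that])
    moreover have "has_linear_powers I"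
      unfolding has_linear_powers_def using has_linear_resolution_power[OF I m_pos mdeg_E exch] by blast
    ultimately show ?thesis by blast
  qed
  then show ?thesis using powers by blast
qed

end
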